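(* Let $n\ge 2$ and $a_1,\dots,a_n,b\in i\mathbb{R}$. Let $$Z(s)=\prod_{p\text{ prime}}\left((1-p^{a_1-s})\cdots(1-p^{a_n-s})+(-1)^n\left(p^{b}-p^{a_1+\cdots+a_n}\right)p^{-ns}\right)^{-1},$$ an Euler product converging absolutely for $\operatorname{Re}(s)>1$. Then $Z(s)$ has an analytic continuation to all $s\in\mathbb{C}$ as a meromorphic function if and only if $a_1+\cdots+a_n=b$, in which case $Z(s)=\zeta(s-a_1)\cdots\zeta(s-a_n)$ with $\zeta$ the Riemann zeta function. When $a_1+\cdots+a_n\neq b$, $Z(s)$ is meromorphic in $\operatorname{Re}(s)>0$ with natural boundary $\operatorname{Re}(s)=0$.
   Context: For $p$ prime and $z\in\mathbb{C}$, $p^{z}=e^{z\log p}$. "Natural boundary $\operatorname{Re}(s)=0$" means the function continues meromorphically to $\operatorname{Re}(s)>0$ but cannot be meromorphically continued across any point of the line $\operatorname{Re}(s)=0$. *)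

theory Defs
  imports "HOL-Complex_Analysis.Complex_Analysis" "HOL-Computational_Algebra.Primes"
begin

text \<open>
  \<open>meromorphic_continuation f D g U\<close>: the function \<open>g\<close> is a meromorphic continuation of \<open>f\<close>
  from \<open>D\<close> to \<open>U\<close>. The predicate \<open>meromorphic_on\<close> ignores the values of a function on a discrete
  set (in particular the junk values at poles), so \<open>f\<close> and \<open>g\<close> are only compared outside a set
  without accumulation points in \<open>D\<close>.
\<close>

definition meromorphic_continuation ::
  "(complex \<Rightarrow> complex) \<Rightarrow> complex set \<Rightarrow> (complex \<Rightarrow> complex) \<Rightarrow> complex set \<Rightarrow> bool" where
  "meromorphic_continuation f D g U \<longleftrightarrow>
     D \<subseteq> U \<and> g meromorphic_on U \<and> (\<forall>\<^sub>\<approx>s\<in>D. g s = f s)"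

definition natural_boundary_imaginary_axis ::
  "(complex \<Rightarrow> complex) \<Rightarrow> complex set \<Rightarrow> bool" where
  "natural_boundary_imaginary_axis f D \<longleftrightarrow>
     (\<exists>g. meromorphic_continuation f D g {s. Re s > 0} \<and>
       (\<forall>z r. Re z = 0 \<longrightarrow> r > 0 \<longrightarrow>
         \<not> (\<exists>h. meromorphic_continuation g {s. Re s > 0} h ({s. Re s > 0} \<union> ball z r))))"

text \<open>
  The Riemann zeta function on the whole plane. \<open>nicely_meromorphic_on\<close> fixes the value at every
  pole to be 0 and excludes removable singularities, which makes the continuation of the
  Dirichlet series unique as a HOL function.
\<close>

definition riemann_zeta :: "complex \<Rightarrow> complex" where
  "riemann_zeta = (THE f. f nicely_meromorphic_on UNIV \<and>
     (\<forall>s. Re s > 1 \<longrightarrow> (\<lambda>k. of_nat (Suc k) powr (- s)) sums f s))"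

definition local_polynomial ::
  "nat \<Rightarrow> (nat \<Rightarrow> complex) \<Rightarrow> complex \<Rightarrow> nat \<Rightarrow> complex \<Rightarrow> complex" where
  "local_polynomial n a b p s =
     (\<Prod>i=1..n. 1 - of_nat p powr (a i - s)) +
     (-1) ^ n * (of_nat p powr b - of_nat p powr (\<Sum>i=1..n. a i)) * of_nat p powr (- (of_nat n * s))"

text \<open>
  The product over primes is a product over all natural numbers with factor 1 at the non-primes.
  For \<open>Re s > 1\<close> at most the factor at \<open>p = 2\<close> can have a pole (for example \<open>n = 2\<close>, \<open>a = 0\<close>,
  \<open>2 powr b = -1\<close>); there it takes the value \<open>inverse 0 = 0\<close>.
\<close>

definition euler_factor ::
  "nat \<Rightarrow> (nat \<Rightarrow> complex) \<Rightarrow> complex \<Rightarrow> complex \<Rightarrow> nat \<Rightarrow> complex" where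
  "euler_factor n a b s p = (if prime p then inverse (local_polynomial n a b p s) else 1)"

definition Z :: "nat \<Rightarrow> (nat \<Rightarrow> complex) \<Rightarrow> complex \<Rightarrow> complex \<Rightarrow> complex" where
  "Z n a b s = (\<Prod>p. euler_factor n a b s p)"

end

theory Submission
  imports Defs "HOL-Computational_Algebra.Fundamental_Theorem_Algebra"
begin

text \<open>
  With \<open>T = p powr (-s)\<close> each local factor is a polynomial \<open>1 + \<Sum> \<plusminus> p powr (c - k * s)\<close> with imaginary \<open>c\<close>.
  Multiplying by factors \<open>1 \<mp> p powr (c - k * s)\<close> removes the terms of lowest degree \<open>k\<close> at the price of
  new terms of higher degree. The product of such a factor over all primes is a quotient of zeta values,
  and once all terms of degree \<open>\<le> K\<close> are removed the remaining Euler product converges for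
  \<open>Re s > 1 / (K + 1)\<close>. This continues \<open>Z\<close> to \<open>Re s > 0\<close>.

  A zero of a local polynomial is a pole of \<open>Z\<close> unless it lies in the set of points where one of the zeta
  quotients for \<open>k \<le> K\<close> is irregular, and by Jensen's inequality near a given boundary point that set has
  only polynomially many elements in \<open>K\<close>. A continuation across the boundary point has finitely many
  poles there, so the local polynomials have polynomially many distinct zeros with \<open>Re s > 1 / (K + 1)\<close>.
  As a function of \<open>log p\<close> the local polynomial at a fixed \<open>s\<close> is an exponential polynomial, so
  Jensen's inequality also shows that \<open>s\<close> is a zero for only \<open>O(K)\<close> primes.

  On the other hand, if all roots of the local polynomial in \<open>T\<close> have modulus close to \<open>1\<close>, comparing the
  coefficients of \<open>T\<close> and \<open>T ^ (n - 1)\<close> forces \<open>(\<Sum>i. p powr a i) * (p powr b - p powr (\<Sum>i. a i))\<close> to be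
  small. Its squared modulus is a trigonometric polynomial in \<open>log p\<close> with positive mean, so by the
  non-vanishing of zeta on \<open>Re s = 1\<close> it is bounded below on a set of primes with divergent
  reciprocal sum. For these primes \<open>p < exp (\<eta> * K)\<close> there is a zero with \<open>Re s > 1 / (K + 1)\<close>
  near the boundary point, which contradicts the polynomial count.
\<close>

section \<open>Holomorphic limits and zero counting\<close>

text \<open>The obstacle is that zeros and poles of zeta, of unknown location, may hide a zero of a
  local polynomial. No individual zero is therefore singled out as a pole; the proof compares growth
  rates in K. The roots T found inside the unit circle satisfy |T| < rho with rho < 1 independent of
  p, that is Re s * ln p >= eta = -ln rho, so the half-plane Re s > 1/(K+1) contains a zero for
  every good prime below exp(eta (K+1)). As p^(-s) has period 2 pi i / ln p, these zeros can be
  shifted to within O(1 / ln p) of any boundary point, so one argument serves the whole line. The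
  hiding places stay polynomial in number because all exponents of degree k are combinations of the
  a_i and b with multiplicities at most k, hence at most (k+1)^(n+1) of them, and only zeta zeros up
  to height O(K) matter. Any polynomial bound will do, so all counts are crude.\<close>

lemma holomorphic_on_suminf:
  fixes f :: "nat \<Rightarrow> complex \<Rightarrow> complex"
  assumes "open S" and hol: "\<And>n. f n holomorphic_on S"
    and loc: "\<And>x. x \<in> S \<Longrightarrow> \<exists>U M. open U \<and> x \<in> U \<and> summable M \<and> (\<forall>n. \<forall>z\<in>U \<inter> S. norm (f n z) \<le> M n)"
  shows "(\<lambda>z. \<Sum>n. f n z) holomorphic_on S"
proof (rule holomorphic_uniform_sequence[OF \<open>open S\<close>])
  show "(\<lambda>z. \<Sum>k<n. f k z) holomorphic_on S" for n
    by (intro holomorphic_intros hol)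
next
  fix x assume "x \<in> S"
  with loc obtain U M where U: "open U" "x \<in> U" "summable M" "\<And>n z. z \<in> U \<inter> S \<Longrightarrow> norm (f n z) \<le> M n"
    by meson
  then obtain d where d: "d > 0" "cball x d \<subseteq> U \<inter> S"
    using \<open>open S\<close> \<open>x \<in> S\<close> open_contains_cball[of "U \<inter> S"] by blast
  have "uniform_limit (cball x d) (\<lambda>n z. \<Sum>k<n. f k z) (\<lambda>z. \<Sum>n. f n z) sequentially"
    by (rule Weierstrass_m_test[OF _ U(3)]) (use U(4) d in blast)
  then show "\<exists>d>0. cball x d \<subseteq> S \<and> uniform_limit (cball x d) (\<lambda>n z. \<Sum>k<n. f k z) (\<lambda>z. \<Sum>n. f n z) sequentially"
    using d by blast
qed

text \<open>Factors may vanish: zeros of single local factors have to survive as zeros of the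
  limit.\<close>

lemma holomorphic_on_prodinf:
  fixes f :: "nat \<Rightarrow> complex \<Rightarrow> complex"
  assumes "open S" and hol: "\<And>n. f n holomorphic_on S"
    and loc: "\<And>x. x \<in> S \<Longrightarrow> \<exists>U M. open U \<and> x \<in> U \<and> summable M \<and> (\<forall>n. \<forall>z\<in>U \<inter> S. norm (f n z - 1) \<le> M n)"
  shows "(\<lambda>z. \<Prod>n. f n z) holomorphic_on S"
proof (rule holomorphic_uniform_sequence[OF \<open>open S\<close>])
  show "(\<lambda>z. \<Prod>k<n. f k z) holomorphic_on S" for n
    by (intro holomorphic_intros hol)
next
  fix x assume "x \<in> S"
  with loc obtain U M where U: "open U" "x \<in> U" "summable M" "\<And>n z. z \<in> U \<inter> S \<Longrightarrow> norm (f n z - 1) \<le> M n"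
    by meson
  then obtain d where d: "d > 0" "cball x d \<subseteq> U \<inter> S"
    using \<open>open S\<close> \<open>x \<in> S\<close> open_contains_cball[of "U \<inter> S"] by blast
  have bnd: "norm (norm (f n z - 1)) \<le> M n" if "z \<in> cball x d" for n z
  proof -
    have "z \<in> U \<inter> S" using d that by blast
    then show ?thesis using U(4)[of z n] by simp
  qed
  have conv: "convergent_prod (\<lambda>n. f n z)" if "z \<in> cball x d" for z
  proof (rule abs_convergent_prod_imp_convergent_prod, rule summable_imp_abs_convergent_prod)
    show "summable (\<lambda>n. norm (f n z - 1))"
      by (rule summable_comparison_test'[OF U(3), of 0]) (use bnd that in auto)
  qed
  have "uniformly_convergent_on (cball x d) (\<lambda>n z. \<Prod>k<n. f k z)"
  proof (rule uniformly_convergent_on_prod')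
    show "continuous_on (cball x d) (f n)" for n
      using hol[of n] d by (meson holomorphic_on_imp_continuous_on holomorphic_on_subset le_inf_iff)
    show "uniformly_convergent_on (cball x d) (\<lambda>n z. \<Sum>k<n. norm (f k z - 1))"
      unfolding uniformly_convergent_on_def
      by (rule exI, rule Weierstrass_m_test[OF _ U(3)]) (use bnd in auto)
  qed auto
  then have "uniform_limit (cball x d) (\<lambda>n z. \<Prod>k<n. f k z) (\<lambda>z. lim (\<lambda>n. \<Prod>k<n. f k z)) sequentially"
    by (simp add: uniformly_convergent_uniform_limit_iff)
  moreover have "lim (\<lambda>n. \<Prod>k<n. f k z) = (\<Prod>n. f n z)" if "z \<in> cball x d" for z
    using conv[OF that] by (intro limI has_prod_imp_tendsto' convergent_prod_has_prod)
  ultimately have "uniform_limit (cball x d) (\<lambda>n z. \<Prod>k<n. f k z) (\<lambda>z. \<Prod>n. f n z) sequentially"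
    using uniform_limit_cong'[of "cball x d"] by (smt (verit))
  then show "\<exists>d>0. cball x d \<subseteq> S \<and> uniform_limit (cball x d) (\<lambda>n z. \<Prod>k<n. f k z) (\<lambda>z. \<Prod>n. f n z) sequentially"
    using d by blast
qed

text \<open>For \<open>z \<noteq> a\<close> on this circle the quotient
  \<open>(R^2 - cnj a * z) / (R * (z - a))\<close> has modulus 1, so a zero can be divided out
  without changing the bound there.\<close>

lemma Blaschke_sphere:
  fixes a z :: complex
  assumes "norm z = R"
  shows "norm (of_real (R\<^sup>2) - cnj a * z) = R * norm (z - a)"
proof -
  have "of_real (R\<^sup>2) = z * cnj z" using assms complex_norm_square[of z] by simp
  then have "of_real (R\<^sup>2) - cnj a * z = z * cnj (z - a)" by (simp add: algebra_simps)
  then show ?thesis using assms by (simp only: norm_mult complex_mod_cnj)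
qed

text \<open>Dividing out a zero \<open>a\<close> by its Blaschke factor keeps the bound on the
  circle and multiplies the modulus at 0 by \<open>R / norm a\<close>, which is at least
  \<open>R / r\<close>. Zeros are counted without multiplicity, because distinct points are what is
  counted later.\<close>

lemma Jensen_zeros_0:
  fixes f :: "complex \<Rightarrow> complex"
  assumes "f holomorphic_on UNIV" "finite A" "\<And>a. a \<in> A \<Longrightarrow> f a = 0 \<and> norm a \<le> r"
    and "0 < r" "r < R" "\<And>z. norm z = R \<Longrightarrow> norm (f z) \<le> M" "f 0 \<noteq> 0"
  shows "norm (f 0) \<le> M * (r / R) ^ card A"
  using assms(2,1,3-)
proof (induction A arbitrary: f rule: finite_induct)
  case empty
  have "norm (f 0) \<le> M"
    by (rule maximum_modulus_frontier[of f "cball 0 R"])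
      (use empty in \<open>auto intro: holomorphic_on_subset holomorphic_on_imp_continuous_on\<close>)
  then show ?case by simp
next
  case (insert a A)
  have a: "f a = 0" "norm a \<le> r" "a \<noteq> 0" using insert.prems by auto
  define g where "g = (\<lambda>z. if z = a then deriv f a else f z / (z - a))"
  have g: "g holomorphic_on UNIV"
    unfolding g_def using pole_lemma_open[of f UNIV a] insert.prems(1) by (simp add: a(1) cong: if_cong)
  have fg: "f z = (z - a) * g z" for z using a by (auto simp: g_def)
  \<comment> \<open>This is \<open>f\<close> times the Blaschke quotient for \<open>a\<close>;
    \<open>g\<close> fills the removable singularity at \<open>a\<close>.\<close>
  define h where "h = (\<lambda>z. g z * (of_real (R\<^sup>2) - cnj a * z) / of_real R)"
  have R: "R > 0" using insert.prems by auto
  have "norm (h 0) \<le> M * (r / R) ^ card A"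
  proof (rule insert.IH)
    show "h holomorphic_on UNIV" unfolding h_def by (intro holomorphic_intros g) (use R in auto)
    show "h b = 0 \<and> norm b \<le> r" if "b \<in> A" for b
    proof -
      have "b \<noteq> a" using that insert by auto
      moreover have "f b = 0" "norm b \<le> r" using that insert by auto
      ultimately show ?thesis by (simp add: h_def g_def)
    qed
    show "norm (h z) \<le> M" if "norm z = R" for z
    proof -
      have "norm (h z) = norm (f z)"
        unfolding h_def fg norm_mult norm_divide Blaschke_sphere[OF that] using R by (simp add: field_simps)
      then show ?thesis using insert.prems that by auto
    qed
    show "h 0 \<noteq> 0" using fg[of 0] insert.prems R by (auto simp: h_def)
  qed (use insert.prems in auto)
  moreover have "norm (f 0) = norm (h 0) * (norm a / R)"
    unfolding fg h_def using R by (simp add: norm_mult norm_divide power2_eq_square)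
  ultimately have "norm (f 0) \<le> (M * (r / R) ^ card A) * (r / R)"
    using a R insert.prems by (auto intro!: mult_mono divide_right_mono intro: order_trans[OF norm_ge_zero])
  then show ?case using insert.hyps by (simp add: mult_ac)
qed

lemma Jensen_zeros:
  fixes f :: "complex \<Rightarrow> complex"
  assumes "f holomorphic_on UNIV" "0 < r" "r < R" "\<And>z. norm (z - c) = R \<Longrightarrow> norm (f z) \<le> M" "f c \<noteq> 0"
  shows "finite {z \<in> cball c r. f z = 0}"
    and "real (card {z \<in> cball c r. f z = 0}) \<le> ln (M / norm (f c)) / ln (R / r)"
proof -
  let ?Z = "{z \<in> cball c r. f z = 0}"
  \<comment> \<open>The bound is proved for every finite set of zeros first, so that finiteness of
    the full zero set is a consequence.\<close>
  have *: "real (card A) \<le> ln (M / norm (f c)) / ln (R / r)" if "finite A" "A \<subseteq> ?Z" for A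
  proof -
    have "norm (f c) \<le> M * (r / R) ^ card ((\<lambda>z. z - c) ` A)"
    proof -
      have "norm ((f \<circ> (\<lambda>z. z + c)) 0) \<le> M * (r / R) ^ card ((\<lambda>z. z - c) ` A)"
      proof (rule Jensen_zeros_0)
        show "(f \<circ> (\<lambda>z. z + c)) holomorphic_on UNIV"
          by (rule holomorphic_on_compose) (use assms in \<open>auto intro!: holomorphic_intros intro: holomorphic_on_subset\<close>)
        show "(f \<circ> (\<lambda>z. z + c)) a = 0 \<and> norm a \<le> r" if "a \<in> (\<lambda>z. z - c) ` A" for a
          using that \<open>A \<subseteq> ?Z\<close> by (auto simp: dist_norm norm_minus_commute)
      qed (use assms that in auto)
      then show ?thesis by simp
    qed
    also have "card ((\<lambda>z. z - c) ` A) = card A" by (intro card_image inj_onI) auto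
    finally have 1: "norm (f c) \<le> M * (r / R) ^ card A" .
    have "norm (f c) > 0" using assms by auto
    with 1 have M: "M > 0" using assms
      by (smt (verit) zero_less_divide_iff zero_less_mult_iff zero_less_power)
    have "(R / r) ^ card A \<le> M / norm (f c)"
      using 1 \<open>norm (f c) > 0\<close> assms(2,3) by (simp add: field_simps)
    then have "ln ((R / r) ^ card A) \<le> ln (M / norm (f c))"
      using assms by (intro ln_mono) auto
    then have "card A * ln (R / r) \<le> ln (M / norm (f c))"
      using assms by (simp add: ln_realpow)
    moreover have "ln (R / r) > 0" using assms by simp
    ultimately show ?thesis by (simp add: field_simps)
  qed
  show "finite ?Z"
  proof (rule ccontr)
    assume "infinite ?Z"
    then obtain A where "A \<subseteq> ?Z" "finite A" "card A = Suc (nat \<lceil>ln (M / norm (f c)) / ln (R / r)\<rceil>)"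
      using infinite_arbitrarily_large[of ?Z] by blast
    with *[of A] show False by linarith
  qed
  then show "real (card ?Z) \<le> ln (M / norm (f c)) / ln (R / r)" using * by blast
qed

section \<open>Analytic continuation of the Riemann zeta function\<close>

lemma norm_of_nat_powr: "p > 0 \<Longrightarrow> norm (of_nat p powr (z::complex)) = real p powr Re z"
  by (simp add: norm_powr_real_powr)

lemma Dirichlet_summable:
  fixes s :: complex assumes "Re s > 1"
  shows "summable (\<lambda>k. norm (of_nat (Suc k) powr (-s)))"
proof -
  have "summable (\<lambda>k. real (Suc k) powr (- Re s))"
    using assms by (subst summable_Suc_iff) (simp add: summable_real_powr_iff)
  then show ?thesis by (simp add: norm_of_nat_powr del: of_nat_Suc)
qed

definition dirichlet_zeta :: "complex \<Rightarrow> complex" where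
  "dirichlet_zeta s = (\<Sum>k. of_nat (Suc k) powr (-s))"

lemma dirichlet_zeta_sums: "Re s > 1 \<Longrightarrow> (\<lambda>k. of_nat (Suc k) powr (-s)) sums dirichlet_zeta s"
  unfolding dirichlet_zeta_def by (intro summable_sums summable_norm_cancel[OF Dirichlet_summable])

lemma norm_dirichlet_zeta_le:
  assumes "Re s \<ge> \<sigma>" "\<sigma> > 1"
  shows "norm (dirichlet_zeta s) \<le> (\<Sum>k. real (Suc k) powr (-\<sigma>))"
  unfolding dirichlet_zeta_def
proof (rule norm_suminf_le)
  show "summable (\<lambda>k. real (Suc k) powr (-\<sigma>))"
    using assms by (subst summable_Suc_iff) (simp add: summable_real_powr_iff)
  show "norm (of_nat (Suc k) powr (-s)) \<le> real (Suc k) powr (-\<sigma>)" for k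
    using assms by (simp add: norm_of_nat_powr powr_mono del: of_nat_Suc)
qed

text \<open>The shift \<open>d\<close> is the decay beyond that of the Dirichlet series: 0 for the
  series itself, \<open>M\<close> for Taylor remainders of order \<open>M\<close>.\<close>

lemma summable_on_halfplane_bound:
  fixes f :: "nat \<Rightarrow> complex \<Rightarrow> complex"
  assumes hol: "\<And>n. f n holomorphic_on {s. Re s > c}" and "c + d \<ge> 1"
    and B: "\<And>n s. Re s > c \<Longrightarrow> norm (f n s) \<le> B s * real (Suc n) powr (- (Re s + d))"
    and cont: "continuous_on UNIV B"
  shows "(\<lambda>s. \<Sum>n. f n s) holomorphic_on {s. Re s > c}"
proof (rule holomorphic_on_suminf[OF _ hol])
  show "open {s. Re s > c}" by (rule open_halfspace_Re_gt)
next
  fix x assume "x \<in> {s. Re s > c}"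
  then have x: "Re x > c" by simp
  define \<sigma> where "\<sigma> = (Re x + c) / 2"
  have \<sigma>: "c < \<sigma>" "\<sigma> < Re x" using x by (auto simp: \<sigma>_def)
  have "compact (B ` cball x 1)" by (intro compact_continuous_image continuous_on_subset[OF cont]) auto
  then obtain C where C: "\<And>z. z \<in> cball x 1 \<Longrightarrow> B z \<le> C"
    by (metis bounded_has_Sup(1) compact_imp_bounded image_eqI image_is_empty empty_iff)
  have C': "\<bar>C\<bar> \<ge> B z" if "z \<in> cball x 1" for z using C[OF that] by simp
  show "\<exists>U M. open U \<and> x \<in> U \<and> summable M \<and> (\<forall>n. \<forall>z\<in>U \<inter> {s. Re s > c}. norm (f n z) \<le> M n)"
  proof (intro exI conjI allI ballI)
    show "open (ball x 1 \<inter> {s. Re s > \<sigma>})" by (intro open_Int open_ball open_halfspace_Re_gt)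
    show "x \<in> ball x 1 \<inter> {s. Re s > \<sigma>}" using \<sigma> by simp
    have "summable (\<lambda>n. real (Suc n) powr (- (\<sigma> + d)))"
      using assms(2) \<sigma> by (subst summable_Suc_iff) (simp add: summable_real_powr_iff)
    then show "summable (\<lambda>n. \<bar>C\<bar> * real (Suc n) powr (- (\<sigma> + d)))" by (rule summable_mult)
    fix n z assume z: "z \<in> ball x 1 \<inter> {s. Re s > \<sigma>} \<inter> {s. Re s > c}"
    then have "norm (f n z) \<le> B z * real (Suc n) powr (- (Re z + d))" using B by auto
    also have "\<dots> \<le> \<bar>C\<bar> * real (Suc n) powr (- (\<sigma> + d))"
      using z C'[of z] by (intro mult_mono powr_mono) auto
    finally show "norm (f n z) \<le> \<bar>C\<bar> * real (Suc n) powr (- (\<sigma> + d))" .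
  qed
qed

text \<open>The falling factorial of \<open>1 - s\<close>: the \<open>i\<close>-th derivative of
  \<open>x powr (1 - s)\<close> is \<open>ffact i s * x powr (1 - s - i)\<close>.\<close>

definition ffact :: "nat \<Rightarrow> complex \<Rightarrow> complex" where
  "ffact i s = (\<Prod>j<i. 1 - s - of_nat j)"

text \<open>The Taylor remainder of order \<open>M\<close> of \<open>x powr (1 - s)\<close>,
  expanded at \<open>n\<close> and evaluated at \<open>n + 1\<close>.\<close>

definition zeta_rem :: "nat \<Rightarrow> nat \<Rightarrow> complex \<Rightarrow> complex" where
  "zeta_rem M n s = of_nat (n + 1) powr (1 - s) - (\<Sum>i\<le>M. ffact i s / fact i * of_nat n powr (1 - s - of_nat i))"

lemma ffact_holomorphic [holomorphic_intros]: "ffact i holomorphic_on A"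
  unfolding ffact_def by (intro holomorphic_intros)

lemma norm_ffact_le: "norm (ffact i s) \<le> (real i + 1 + norm s) ^ i"
proof -
  have "norm (ffact i s) = (\<Prod>j<i. norm (1 - s - of_nat j))" by (simp add: ffact_def prod_norm)
  also have "\<dots> \<le> (\<Prod>j<i. real i + 1 + norm s)"
  proof (intro prod_mono conjI)
    fix j assume j: "j \<in> {..<i}"
    have "norm (1 - s - of_nat j) \<le> norm (1 - s) + norm (of_nat j :: complex)" by (rule norm_triangle_ineq4)
    also have "\<dots> \<le> 1 + norm s + real j" using norm_triangle_ineq4[of 1 s] by simp
    finally show "norm (1 - s - of_nat j) \<le> real i + 1 + norm s" using j by simp
  qed simp
  finally show ?thesis by simp
qed

text \<open>Taylor's formula on the real segment from \<open>n\<close> to \<open>n + 1\<close>.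
  Since \<open>Re s + M\<close> is nonnegative, the modulus of the last derivative does not increase
  along it and is bounded by its value at \<open>n\<close>.\<close>

lemma zeta_rem_bound:
  assumes "n > 0" "Re s + real M \<ge> 0"
  shows "norm (zeta_rem M n s) \<le> norm (ffact (Suc M) s) / fact M * real n powr (- (Re s + real M))"
proof -
  define S where "S = closed_segment (of_nat n :: complex) (of_nat (n + 1))"
  have S: "\<exists>r. x = of_real r \<and> real n \<le> r" if "x \<in> S" for x
  proof -
    have "x \<in> closed_segment (of_real (real n)) (of_real (real n + 1))" using that by (simp add: S_def add.commute)
    then obtain r where "r \<in> closed_segment (real n) (real n + 1)" "x = of_real r"
      unfolding closed_segment_of_real by auto
    then show ?thesis by (auto simp: closed_segment_eq_real_ivl)
  qed
  define f where "f = (\<lambda>i x. ffact i s * x powr (1 - s - of_nat i))"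
  have "cmod (f 0 (of_nat (n + 1)) - (\<Sum>i\<le>M. f i (of_nat n) * (of_nat (n + 1) - of_nat n) ^ i / fact i))
     \<le> (norm (ffact (Suc M) s) * real n powr (- (Re s + real M))) * cmod (of_nat (n + 1) - of_nat n :: complex) ^ (Suc M) / fact M"
  proof (rule complex_Taylor)
    show "convex S" "of_nat n \<in> S" "of_nat (n + 1) \<in> S" by (auto simp: S_def)
  next
    fix i x assume "x \<in> S"
    then obtain r where r: "x = of_real r" "real n \<le> r" using S by blast
    then have "x \<notin> \<real>\<^sub>\<le>\<^sub>0" using assms by (auto simp: complex_nonpos_Reals_iff)
    then have "(f i has_field_derivative f (Suc i) x) (at x)"
      unfolding f_def by (auto intro!: derivative_eq_intros simp: ffact_def algebra_simps)
    then show "(f i has_field_derivative f (Suc i) x) (at x within S)"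
      by (rule has_field_derivative_at_within)
  next
    fix x assume "x \<in> S"
    then obtain r where r: "x = of_real r" "real n \<le> r" using S by blast
    have "cmod (x powr (1 - s - of_nat (Suc M))) = r powr (- (Re s + real M))"
      using r assms by (subst norm_powr_real_powr) auto
    also have "\<dots> \<le> real n powr (- (Re s + real M))"
      using r assms by (intro powr_mono2') auto
    finally show "cmod (f (Suc M) x) \<le> norm (ffact (Suc M) s) * real n powr (- (Re s + real M))"
      unfolding f_def norm_mult by (intro mult_left_mono) auto
  qed
  then show ?thesis by (simp add: f_def zeta_rem_def ffact_def)
qed

text \<open>At \<open>s = 1\<close> the expanded function is constant. This yields the value 1 of
  \<open>(s - 1) * zeta(s)\<close> at the pole.\<close>

lemma zeta_rem_1: "n > 0 \<Longrightarrow> zeta_rem M n 1 = 0"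
proof -
  assume n: "n > 0"
  have "(\<Sum>i\<le>M. ffact i 1 / fact i * of_nat n powr (1 - 1 - of_nat i)) = (\<Sum>i\<le>M. if i = 0 then 1 else 0)"
    using n by (intro sum.cong refl) (auto simp: ffact_def prod_zero_iff)
  moreover have "(1 + of_nat n :: complex) \<noteq> 0" by (metis of_nat_Suc of_nat_neq_0)
  ultimately show ?thesis using n by (simp add: zeta_rem_def)
qed

lemma holomorphic_zeta_rem_sum:
  "(\<lambda>s. \<Sum>n. zeta_rem M (Suc n) s) holomorphic_on {s. Re s > 1 - real M}"
proof (rule summable_on_halfplane_bound)
  show "zeta_rem M (Suc n) holomorphic_on {s. Re s > 1 - real M}" for n
    unfolding zeta_rem_def by (intro holomorphic_intros) auto
  show "norm (zeta_rem M (Suc n) s) \<le> (norm (ffact (Suc M) s) / fact M) * real (Suc n) powr (- (Re s + real M))"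
    if "Re s > 1 - real M" for n s
    by (rule zeta_rem_bound) (use that in auto)
  show "continuous_on UNIV (\<lambda>s. norm (ffact (Suc M) s) / fact M)"
    by (intro continuous_intros holomorphic_on_imp_continuous_on holomorphic_intros) auto
qed auto

lemma summable_zeta_rem:
  assumes "Re s > 1 - real M"
  shows "summable (\<lambda>n. zeta_rem M (Suc n) s)"
proof (rule summable_comparison_test', rule summable_mult)
  show "summable (\<lambda>n. real (Suc n) powr (- (Re s + real M)))"
    using assms by (subst summable_Suc_iff) (simp add: summable_real_powr_iff)
  show "norm (zeta_rem M (Suc n) s) \<le> (norm (ffact (Suc M) s) / fact M) * real (Suc n) powr (- (Re s + real M))" for n
    by (rule zeta_rem_bound) (use assms in auto)
qed

lemma norm_zeta_rem_sum_le:
  assumes "Re s \<ge> \<sigma>" "\<sigma> > 1 - real M"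
  shows "norm (\<Sum>n. zeta_rem M (Suc n) s) \<le>
    (norm (ffact (Suc M) s) / fact M) * (\<Sum>n. real (Suc n) powr (- (\<sigma> + real M)))"
proof -
  have sm: "summable (\<lambda>n. real (Suc n) powr (- (\<sigma> + real M)))"
    using assms by (subst summable_Suc_iff) (simp add: summable_real_powr_iff)
  have "norm (\<Sum>n. zeta_rem M (Suc n) s) \<le> (\<Sum>n. (norm (ffact (Suc M) s) / fact M) * real (Suc n) powr (- (\<sigma> + real M)))"
  proof (rule norm_suminf_le)
    fix n
    have "norm (zeta_rem M (Suc n) s) \<le> (norm (ffact (Suc M) s) / fact M) * real (Suc n) powr (- (Re s + real M))"
      by (rule zeta_rem_bound) (use assms in auto)
    also have "\<dots> \<le> (norm (ffact (Suc M) s) / fact M) * real (Suc n) powr (- (\<sigma> + real M))"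
      using assms by (intro mult_left_mono powr_mono) auto
    finally show "norm (zeta_rem M (Suc n) s) \<le> \<dots>" .
  qed (use sm summable_mult in blast)
  then show ?thesis unfolding suminf_mult[OF sm] .
qed

text \<open>Summing the Taylor expansions over \<open>n\<close>, the left-hand sides telescope to -1
  and the term of order \<open>i\<close> becomes a multiple of zeta at \<open>s + i - 1\<close>. One
  linear factor of each falling factorial is attached to zeta, so that only values of
  \<open>(w - 1) * zeta(w)\<close> at \<open>w = s + j\<close> with \<open>j \<ge> 1\<close> occur
  on the right.\<close>

lemma dirichlet_zeta_recurrence:
  assumes s: "Re s > 1"
  shows "(s - 1) * dirichlet_zeta s =
    1 - (\<Sum>j\<in>{1..M}. ffact j s / fact (Suc j) * ((s + of_nat j - 1) * dirichlet_zeta (s + of_nat j)))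
      + (\<Sum>n. zeta_rem (Suc M) (Suc n) s)"
proof -
  have "(\<lambda>n. of_nat (Suc n) powr (1 - s)) \<longlonglongrightarrow> (0::complex)"
  proof -
    have "(\<lambda>n. real (Suc n) powr (1 - Re s)) \<longlonglongrightarrow> 0"
      using s by (intro tendsto_neg_powr filterlim_compose[OF filterlim_real_sequentially filterlim_Suc]) auto
    then show ?thesis
      by (intro tendsto_norm_zero_cancel[of "\<lambda>n. of_nat (Suc n) powr (1 - s)"]) (simp add: norm_of_nat_powr del: of_nat_Suc)
  qed
  from telescope_sums[OF this]
  have 1: "(\<lambda>n. of_nat (Suc (Suc n)) powr (1 - s) - of_nat (Suc n) powr (1 - s)) sums (- 1 :: complex)"
    by simp
  have 2: "(\<lambda>n. \<Sum>i\<in>{1..Suc M}. ffact i s / fact i * of_nat (Suc n) powr (- (s + of_nat i - 1)))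
      sums (\<Sum>i\<in>{1..Suc M}. ffact i s / fact i * dirichlet_zeta (s + of_nat i - 1))"
    by (intro sums_sum sums_mult dirichlet_zeta_sums) (use s in auto)
  have 3: "(\<lambda>n. zeta_rem (Suc M) (Suc n) s) sums (\<Sum>n. zeta_rem (Suc M) (Suc n) s)"
    by (intro summable_sums summable_zeta_rem) (use s in auto)
  have split: "(\<Sum>i\<le>Suc M. F i) = F 0 + (\<Sum>i\<in>{1..Suc M}. F i)" for F :: "nat \<Rightarrow> complex"
    unfolding atMost_atLeast0 One_nat_def by (rule sum.atLeast_Suc_atMost) simp
  have eq: "- (s + of_nat i - 1) = 1 - s - of_nat i" for i by simp
  have [simp]: "ffact 0 s = 1" by (simp add: ffact_def)
  have 4: "of_nat (Suc (Suc n)) powr (1 - s) - of_nat (Suc n) powr (1 - s) =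
     (\<Sum>i\<in>{1..Suc M}. ffact i s / fact i * of_nat (Suc n) powr (- (s + of_nat i - 1))) + zeta_rem (Suc M) (Suc n) s" for n
    unfolding zeta_rem_def split eq by (simp del: of_nat_Suc sum.cl_ivl_Suc)
  have "-1 = (\<Sum>i\<in>{1..Suc M}. ffact i s / fact i * dirichlet_zeta (s + of_nat i - 1)) + (\<Sum>n. zeta_rem (Suc M) (Suc n) s)"
    using sums_add[OF 2 3] by (intro sums_unique2[OF 1]) (simp only: 4)
  also have "(\<Sum>i\<in>{1..Suc M}. ffact i s / fact i * dirichlet_zeta (s + of_nat i - 1)) =
     (\<Sum>j\<in>{0..M}. ffact (Suc j) s / fact (Suc j) * dirichlet_zeta (s + of_nat j))"
    by (rule sum.reindex_bij_witness[of _ Suc "\<lambda>i. i - 1"]) (auto simp: of_nat_diff algebra_simps)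
  also have "{0..M} = insert 0 {1..M}" by auto
  also have "(\<Sum>j\<in>insert 0 {1..M}. ffact (Suc j) s / fact (Suc j) * dirichlet_zeta (s + of_nat j)) =
     (1 - s) * dirichlet_zeta s + (\<Sum>j\<in>{1..M}. ffact (Suc j) s / fact (Suc j) * dirichlet_zeta (s + of_nat j))"
    by (subst sum.insert) (auto simp: ffact_def)
  also have "(\<Sum>j\<in>{1..M}. ffact (Suc j) s / fact (Suc j) * dirichlet_zeta (s + of_nat j)) =
     - (\<Sum>j\<in>{1..M}. ffact j s / fact (Suc j) * ((s + of_nat j - 1) * dirichlet_zeta (s + of_nat j)))"
    unfolding sum_negf[symmetric] by (intro sum.cong refl) (simp add: ffact_def divide_simps, simp add: algebra_simps)
  finally show ?thesis by (simp add: algebra_simps)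
qed

text \<open>The growth hypothesis for Jensen's inequality. Only its logarithm enters there, so the
  exponent \<open>k\<close> is left unspecified.\<close>

definition poly_growth_right :: "(complex \<Rightarrow> complex) \<Rightarrow> real \<Rightarrow> bool" where
  "poly_growth_right f \<sigma> \<longleftrightarrow> (\<exists>C k. \<forall>s. Re s \<ge> \<sigma> \<longrightarrow> norm (f s) \<le> C * (1 + norm s) ^ k)"

lemma poly_growth_rightI:
  "(\<And>s. Re s \<ge> \<sigma> \<Longrightarrow> norm (f s) \<le> C * (1 + norm s) ^ k) \<Longrightarrow> poly_growth_right f \<sigma>"
  unfolding poly_growth_right_def by blast

lemma poly_growth_right_add:
  assumes "poly_growth_right f \<sigma>" "poly_growth_right g \<sigma>"
  shows "poly_growth_right (\<lambda>s. f s + g s) \<sigma>"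
proof -
  obtain C k where 1: "\<And>s. Re s \<ge> \<sigma> \<Longrightarrow> norm (f s) \<le> C * (1 + norm s) ^ k" using assms unfolding poly_growth_right_def by blast
  obtain D l where 2: "\<And>s. Re s \<ge> \<sigma> \<Longrightarrow> norm (g s) \<le> D * (1 + norm s) ^ l" using assms unfolding poly_growth_right_def by blast
  show ?thesis
  proof (rule poly_growth_rightI)
    fix s :: complex assume s: "Re s \<ge> \<sigma>"
    have "norm (f s + g s) \<le> C * (1 + norm s) ^ k + D * (1 + norm s) ^ l"
      using 1[OF s] 2[OF s] norm_triangle_ineq[of "f s" "g s"] by linarith
    also have "\<dots> \<le> \<bar>C\<bar> * (1 + norm s) ^ (k + l) + \<bar>D\<bar> * (1 + norm s) ^ (k + l)"
      by (intro add_mono mult_mono power_increasing) auto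
    finally show "norm (f s + g s) \<le> (\<bar>C\<bar> + \<bar>D\<bar>) * (1 + norm s) ^ (k + l)" by (simp add: algebra_simps)
  qed
qed

lemma poly_growth_right_mult:
  assumes "poly_growth_right f \<sigma>" "poly_growth_right g \<sigma>"
  shows "poly_growth_right (\<lambda>s. f s * g s) \<sigma>"
proof -
  obtain C k where 1: "\<And>s. Re s \<ge> \<sigma> \<Longrightarrow> norm (f s) \<le> C * (1 + norm s) ^ k" using assms unfolding poly_growth_right_def by blast
  obtain D l where 2: "\<And>s. Re s \<ge> \<sigma> \<Longrightarrow> norm (g s) \<le> D * (1 + norm s) ^ l" using assms unfolding poly_growth_right_def by blast
  show ?thesis
  proof (rule poly_growth_rightI)
    fix s :: complex assume s: "Re s \<ge> \<sigma>"
    have "norm (f s * g s) \<le> (C * (1 + norm s) ^ k) * (D * (1 + norm s) ^ l)"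
      unfolding norm_mult using 1[OF s] 2[OF s] order_trans[OF norm_ge_zero 1[OF s]] by (intro mult_mono) auto
    then show "norm (f s * g s) \<le> (C * D) * (1 + norm s) ^ (k + l)" by (simp add: power_add mult_ac)
  qed
qed

lemma poly_growth_right_const: "poly_growth_right (\<lambda>s. c) \<sigma>"
  by (rule poly_growth_rightI[of _ _ "norm c" 0]) auto

lemma poly_growth_right_cmult: "poly_growth_right f \<sigma> \<Longrightarrow> poly_growth_right (\<lambda>s. c * f s) \<sigma>"
  by (intro poly_growth_right_mult poly_growth_right_const)

lemma poly_growth_right_sum:
  "finite A \<Longrightarrow> (\<And>i. i \<in> A \<Longrightarrow> poly_growth_right (f i) \<sigma>) \<Longrightarrow> poly_growth_right (\<lambda>s. \<Sum>i\<in>A. f i s) \<sigma>"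
  by (induction A rule: finite_induct) (auto intro: poly_growth_right_add poly_growth_right_const)

lemma poly_growth_right_shift:
  assumes "poly_growth_right f (\<sigma> + real j)"
  shows "poly_growth_right (\<lambda>s. f (s + of_nat j)) \<sigma>"
proof -
  obtain C k where 1: "\<And>s. Re s \<ge> \<sigma> + real j \<Longrightarrow> norm (f s) \<le> C * (1 + norm s) ^ k"
    using assms unfolding poly_growth_right_def by blast
  show ?thesis
  proof (rule poly_growth_rightI)
    fix s :: complex assume s: "Re s \<ge> \<sigma>"
    have "norm (f (s + of_nat j)) \<le> C * (1 + norm (s + of_nat j)) ^ k" by (rule 1) (use s in auto)
    also have "\<dots> \<le> \<bar>C\<bar> * (1 + norm (s + of_nat j)) ^ k" by (intro mult_right_mono) auto
    also have "\<dots> \<le> \<bar>C\<bar> * ((1 + real j) * (1 + norm s)) ^ k"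
    proof (intro mult_left_mono power_mono)
      have "1 + norm (s + of_nat j) \<le> 1 + norm s + real j" using norm_triangle_ineq[of s "of_nat j"] by simp
      also have "\<dots> \<le> (1 + real j) * (1 + norm s)" by (simp add: algebra_simps)
      finally show "1 + norm (s + of_nat j) \<le> (1 + real j) * (1 + norm s)" .
    qed auto
    finally show "norm (f (s + of_nat j)) \<le> (\<bar>C\<bar> * (1 + real j) ^ k) * (1 + norm s) ^ k"
      by (simp add: power_mult_distrib mult_ac)
  qed
qed

lemma poly_growth_right_ffact: "poly_growth_right (ffact i) \<sigma>"
proof (rule poly_growth_rightI)
  fix s
  have "norm (ffact i s) \<le> (real i + 1 + norm s) ^ i" by (rule norm_ffact_le)
  also have "\<dots> \<le> ((real i + 1) * (1 + norm s)) ^ i" by (intro power_mono) (auto simp: algebra_simps)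
  finally show "norm (ffact i s) \<le> (real i + 1) ^ i * (1 + norm s) ^ i" by (simp add: power_mult_distrib)
qed

lemma poly_growth_right_zeta_rem:
  assumes "\<sigma> > 1 - real M"
  shows "poly_growth_right (\<lambda>s. \<Sum>n. zeta_rem M (Suc n) s) \<sigma>"
proof -
  define D where "D = (\<Sum>n. real (Suc n) powr (- (\<sigma> + real M)))"
  obtain C k where 1: "\<And>s. Re s \<ge> \<sigma> \<Longrightarrow> norm (ffact (Suc M) s) \<le> C * (1 + norm s) ^ k"
    using poly_growth_right_ffact unfolding poly_growth_right_def by blast
  have D: "D \<ge> 0" unfolding D_def
    by (rule suminf_nonneg, subst summable_Suc_iff) (use assms in \<open>auto simp: summable_real_powr_iff\<close>)
  show ?thesis
  proof (rule poly_growth_rightI)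
    fix s :: complex assume s: "Re s \<ge> \<sigma>"
    have "norm (\<Sum>n. zeta_rem M (Suc n) s) \<le> (norm (ffact (Suc M) s) / fact M) * D"
      unfolding D_def by (rule norm_zeta_rem_sum_le) (use s assms in auto)
    also have "\<dots> \<le> (C * (1 + norm s) ^ k / fact M) * D"
      using D 1[OF s] by (intro mult_right_mono divide_right_mono) auto
    finally show "norm (\<Sum>n. zeta_rem M (Suc n) s) \<le> (C / fact M * D) * (1 + norm s) ^ k" by (simp add: mult_ac)
  qed
qed

text \<open>Each use of the recurrence extends \<open>(s - 1) * zeta(s)\<close> by one unit to the
  left. The value at 1 is claimed only for \<open>m > 0\<close>, since for \<open>m = 0\<close> the
  point 1 lies on the edge of the domain.\<close>

lemma zeta_continuation_strip:
  "\<exists>\<Phi>. \<Phi> holomorphic_on {s. Re s > 1 - real m} \<and> (\<forall>s. Re s > 1 \<longrightarrow> \<Phi> s = (s - 1) * dirichlet_zeta s) \<and>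
     (\<forall>\<sigma>>1 - real m. poly_growth_right \<Phi> \<sigma>) \<and> (m > 0 \<longrightarrow> \<Phi> 1 = 1)"
proof (induction m)
  case 0
  show ?case
  proof (intro exI conjI allI impI)
    have "(\<lambda>s. \<Sum>k. of_nat (Suc k) powr (-s)) holomorphic_on {s. Re s > (1::real)}"
      by (rule summable_on_halfplane_bound[of _ 1 0 "\<lambda>_. 1"])
        (auto intro!: holomorphic_intros simp: norm_of_nat_powr simp del: of_nat_Suc)
    then have "dirichlet_zeta holomorphic_on {s. Re s > 1 - real 0}"
      by (simp add: dirichlet_zeta_def[abs_def])
    then show "(\<lambda>s. (s - 1) * dirichlet_zeta s) holomorphic_on {s. Re s > 1 - real 0}"
      by (intro holomorphic_intros)
    show "poly_growth_right (\<lambda>s. (s - 1) * dirichlet_zeta s) \<sigma>" if "\<sigma> > 1 - real 0" for \<sigma>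
    proof (rule poly_growth_right_mult)
      show "poly_growth_right (\<lambda>s. s - 1) \<sigma>"
        by (rule poly_growth_rightI[of _ _ 1 1]) (simp, metis norm_triangle_ineq4 norm_one add.commute)
      show "poly_growth_right dirichlet_zeta \<sigma>"
        by (rule poly_growth_rightI[of _ _ _ 0]) (use that norm_dirichlet_zeta_le in auto)
    qed
  qed auto
next
  case (Suc m)
  then obtain \<Phi> where \<Phi>: "\<Phi> holomorphic_on {s. Re s > 1 - real m}"
    "\<And>s. Re s > 1 \<Longrightarrow> \<Phi> s = (s - 1) * dirichlet_zeta s" "\<And>\<sigma>. \<sigma> > 1 - real m \<Longrightarrow> poly_growth_right \<Phi> \<sigma>"
    by blast
  \<comment> \<open>With this order the remainder series converges for
    \<open>Re s > - 1 - m\<close>, and for \<open>Re s > - m\<close> every \<open>s + j\<close> with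
    \<open>j \<ge> 1\<close> lies in the half-plane already reached.\<close>
  define M where "M = Suc m"
  define \<Psi> where "\<Psi> = (\<lambda>s. 1 + (\<Sum>j\<in>{1..M}. (- 1 / fact (Suc j)) * (ffact j s * \<Phi> (s + of_nat j))) + (\<Sum>n. zeta_rem (Suc M) (Suc n) s))"
  show ?case
  proof (rule exI[of _ \<Psi>], intro conjI allI impI)
    have "(\<lambda>s. \<Phi> (s + of_nat j)) holomorphic_on {s. Re s > 1 - real (Suc m)}" if "j \<in> {1..M}" for j
      using that
      by (intro holomorphic_on_compose_gen[OF _ \<Phi>(1), unfolded o_def]) (auto intro!: holomorphic_intros)
    moreover have "(\<lambda>s. \<Sum>n. zeta_rem (Suc M) (Suc n) s) holomorphic_on {s. Re s > 1 - real (Suc m)}"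
      by (rule holomorphic_on_subset[OF holomorphic_zeta_rem_sum]) (auto simp: M_def)
    ultimately show "\<Psi> holomorphic_on {s. Re s > 1 - real (Suc m)}"
      unfolding \<Psi>_def by (intro holomorphic_intros) auto
    show "\<Psi> s = (s - 1) * dirichlet_zeta s" if "Re s > 1" for s
      unfolding \<Psi>_def dirichlet_zeta_recurrence[OF that, of M]
      using that \<Phi>(2) by (simp add: sum_negf[symmetric])
    show "poly_growth_right \<Psi> \<sigma>" if "\<sigma> > 1 - real (Suc m)" for \<sigma>
      unfolding \<Psi>_def using that
      by (intro poly_growth_right_add poly_growth_right_sum poly_growth_right_cmult poly_growth_right_mult
        poly_growth_right_const poly_growth_right_ffact poly_growth_right_shift \<Phi> poly_growth_right_zeta_rem)
        (auto simp: M_def)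
    have "ffact j 1 = 0" if "j \<in> {1..M}" for j using that by (auto simp: ffact_def)
    then show "\<Psi> 1 = 1" unfolding \<Psi>_def by (simp add: zeta_rem_1)
  qed
qed

lemma connected_halfplane_Re: "connected {s::complex. Re s > c}"
  by (intro convex_connected convex_halfspace_Re_gt)

lemma zeta_continuation_ex:
  "\<exists>\<Phi>. \<Phi> holomorphic_on UNIV \<and> (\<forall>s. Re s > 1 \<longrightarrow> \<Phi> s = (s - 1) * dirichlet_zeta s) \<and>
     (\<forall>\<sigma>. poly_growth_right \<Phi> \<sigma>) \<and> \<Phi> 1 = 1"
proof -
  obtain F where F: "\<And>m. F m holomorphic_on {s. Re s > 1 - real m}"
    "\<And>m s. Re s > 1 \<Longrightarrow> F m s = (s - 1) * dirichlet_zeta s"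
    "\<And>m \<sigma>. \<sigma> > 1 - real m \<Longrightarrow> poly_growth_right (F m) \<sigma>" "\<And>m. m > 0 \<Longrightarrow> F m 1 = 1"
    using zeta_continuation_strip by metis
  have eq: "F m s = F k s" if "m \<le> k" "Re s > 1 - real m" for m k s
  proof (rule analytic_continuation_open[of "{s. Re s > 1}" "{s. Re s > 1 - real m}" "F m" "F k"])
    show "open {s. Re s > 1}" "open {s. Re s > 1 - real m}" by (rule open_halfspace_Re_gt)+
    show "{s. Re s > 1} \<noteq> {}" by (metis (mono_tags) Collect_empty_eq complex.sel(1) less_numeral_extra(4) lt_ex gt_ex)
    show "connected {s. Re s > 1 - real m}" by (rule connected_halfplane_Re)
    show "F k holomorphic_on {s. Re s > 1 - real m}" by (rule holomorphic_on_subset[OF F(1)]) (use that in auto)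
  qed (use F that in auto)
  \<comment> \<open>The index is chosen so that \<open>s\<close> lies inside its half-plane; by the
    identity theorem any other admissible index gives the same value.\<close>
  define \<Phi> where "\<Phi> = (\<lambda>s. F (Suc (nat \<lceil>1 - Re s\<rceil>)) s)"
  have \<Phi>: "\<Phi> s = F m s" if "Re s > 1 - real m" for s m
  proof -
    have *: "Re s > 1 - real (Suc (nat \<lceil>1 - Re s\<rceil>))" by linarith
    show ?thesis unfolding \<Phi>_def using eq[OF _ that] eq[OF _ *] by (metis nle_le)
  qed
  show ?thesis
  proof (intro exI[of _ \<Phi>] conjI allI impI)
    show "\<Phi> holomorphic_on UNIV"
    proof -
      have "\<Phi> holomorphic_on {s. Re s > 1 - real m}" for m
        by (rule holomorphic_transform[OF F(1)]) (use \<Phi> in auto)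
      then have "\<Phi> field_differentiable (at s)" for s
      proof -
        obtain m where "real m > 1 - Re s" using reals_Archimedean2 by blast
        then have "s \<in> {s. Re s > 1 - real m}" by simp
        with \<open>\<Phi> holomorphic_on {s. Re s > 1 - real m}\<close> show ?thesis
          using holomorphic_on_imp_differentiable_at open_halfspace_Re_gt by blast
      qed
      then show ?thesis by (simp add: holomorphic_on_def)
    qed
    show "\<Phi> s = (s - 1) * dirichlet_zeta s" if "Re s > 1" for s
      using \<Phi>[of 0 s] F(2)[of s 0] that by simp
    show "poly_growth_right \<Phi> \<sigma>" for \<sigma>
    proof -
      obtain m where m: "real m > 1 - \<sigma>" using reals_Archimedean2 by blast
      then obtain C k where "\<And>s. Re s \<ge> \<sigma> \<Longrightarrow> norm (F m s) \<le> C * (1 + norm s) ^ k"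
        using F(3)[of m \<sigma>] unfolding poly_growth_right_def by auto
      then show ?thesis using \<Phi>[of m] m by (intro poly_growth_rightI[of _ _ C k]) auto
    qed
    show "\<Phi> 1 = 1" using \<Phi>[of 1 1] F(4)[of 1] by simp
  qed
qed

text \<open>The entire function \<open>(s - 1) * zeta(s)\<close>, which confines the pole of zeta to
  an explicit denominator.\<close>

definition zeta_num :: "complex \<Rightarrow> complex" where
  "zeta_num = (SOME \<Phi>. \<Phi> holomorphic_on UNIV \<and> (\<forall>s. Re s > 1 \<longrightarrow> \<Phi> s = (s - 1) * dirichlet_zeta s) \<and>
     (\<forall>\<sigma>. poly_growth_right \<Phi> \<sigma>) \<and> \<Phi> 1 = 1)"

lemma zeta_num_holomorphic: "zeta_num holomorphic_on UNIV"
  and zeta_num_eq: "Re s > 1 \<Longrightarrow> zeta_num s = (s - 1) * dirichlet_zeta s"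
  and zeta_num_growth: "poly_growth_right zeta_num \<sigma>"
  and zeta_num_1: "zeta_num 1 = 1"
  using someI_ex[OF zeta_continuation_ex, folded zeta_num_def] by auto

lemma zeta_num_analytic: "zeta_num analytic_on A"
  using zeta_num_holomorphic analytic_on_open analytic_on_subset by blast

lemma zeta_quotient_nicely_meromorphic: "(\<lambda>s. zeta_num s / (s - 1)) nicely_meromorphic_on UNIV"
proof -
  have mero: "(\<lambda>s. zeta_num s / (s - 1)) meromorphic_on UNIV"
    by (intro meromorphic_intros analytic_on_imp_meromorphic_on zeta_num_analytic)
  show ?thesis unfolding nicely_meromorphic_on_def
  proof (intro conjI ballI mero)
    fix z :: complex
    show "(is_pole (\<lambda>s. zeta_num s / (s - 1)) z \<and> zeta_num z / (z - 1) = 0) \<or>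
      (\<lambda>s. zeta_num s / (s - 1)) \<midarrow>z\<rightarrow> zeta_num z / (z - 1)"
    proof (cases "z = 1")
      case True
      have "is_pole (\<lambda>s. zeta_num s / (s - 1)) 1"
      proof (rule is_pole_divide)
        show "isCont zeta_num 1" by (simp add: analytic_at_imp_isCont zeta_num_analytic)
        show "filterlim (\<lambda>s. s - 1) (at 0) (at (1::complex))"
          unfolding filterlim_at by (auto intro!: tendsto_eq_intros simp: eventually_at_filter)
      qed (simp add: zeta_num_1)
      then show ?thesis using True by simp
    next
      case False
      have "isCont (\<lambda>s. zeta_num s / (s - 1)) z"
        using False by (intro continuous_intros analytic_at_imp_isCont zeta_num_analytic) auto
      then show ?thesis by (simp add: isCont_def)
    qed
  qed
qed

section \<open>Identity theorems for meromorphic functions and the function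
  \<open>riemann_zeta\<close>\<close>

lemma meromorphic_eq_cosparse:
  assumes "f meromorphic_on A" "g meromorphic_on A" "open A" "connected A" "z \<in> A"
    and "eventually (\<lambda>w. f w = g w) (at z)"
  shows "\<forall>\<^sub>\<approx>w\<in>A. f w = g w"
proof -
  have "(\<lambda>w. f w - g w) meromorphic_on A" using assms by (intro meromorphic_intros)
  then consider "\<forall>\<^sub>\<approx>w\<in>A. f w - g w = 0" | "\<forall>\<^sub>\<approx>w\<in>A. f w - g w \<noteq> 0"
    using meromorphic_imp_constant_or_avoid assms by blast
  then show ?thesis
  proof cases
    case 2
    then have "eventually (\<lambda>w. f w - g w \<noteq> 0) (at z)"
      using assms by (simp add: eventually_cosparse_open_eq)
    with assms(6) have "eventually (\<lambda>w. False) (at z)" by eventually_elim auto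
    then show ?thesis by simp
  qed simp
qed

text \<open>The value of a nicely meromorphic function at a point is determined by the punctured
  neighbourhood: it is the limit there, or 0 at a pole.\<close>

lemma nicely_meromorphic_eq_at:
  assumes "f nicely_meromorphic_on {z}" "g nicely_meromorphic_on {z}" "eventually (\<lambda>w. f w = g w) (at z)"
  shows "f z = g z"
proof -
  have f: "(is_pole f z \<and> f z = 0) \<or> f \<midarrow>z\<rightarrow> f z" and g: "(is_pole g z \<and> g z = 0) \<or> g \<midarrow>z\<rightarrow> g z"
    using assms unfolding nicely_meromorphic_on_def by auto
  have "is_pole f z = is_pole g z" by (rule is_pole_cong[OF assms(3)]) simp
  moreover have "f \<midarrow>z\<rightarrow> c \<longleftrightarrow> g \<midarrow>z\<rightarrow> c" for c by (rule tendsto_cong[OF assms(3)])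
  ultimately show ?thesis using f g
    by (metis LIM_unique not_tendsto_and_filterlim_at_infinity is_pole_def trivial_limit_at)
qed

lemma nicely_meromorphic_eq:
  assumes "f nicely_meromorphic_on A" "g nicely_meromorphic_on A" "open A" "connected A" "z \<in> A" "w \<in> A"
    and "eventually (\<lambda>w. f w = g w) (at z)"
  shows "f w = g w"
proof (rule nicely_meromorphic_eq_at[of f w g])
  have "\<forall>\<^sub>\<approx>w\<in>A. f w = g w"
    by (rule meromorphic_eq_cosparse[of _ _ _ z]) (use assms in \<open>auto simp: nicely_meromorphic_on_def\<close>)
  then show "eventually (\<lambda>w. f w = g w) (at w)" using assms by (simp add: eventually_cosparse_open_eq)
qed (use assms in \<open>auto intro: nicely_meromorphic_on_subset\<close>)

text \<open>At \<open>s = 1\<close> both sides are \<open>0\<close>: the left one by the normalisation at poles, the right one by division by zero.\<close>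

lemma riemann_zeta_eq: "riemann_zeta s = zeta_num s / (s - 1)"
proof -
  have "riemann_zeta = (\<lambda>s. zeta_num s / (s - 1))"
    unfolding riemann_zeta_def
  proof (rule the_equality)
    show "(\<lambda>s. zeta_num s / (s - 1)) nicely_meromorphic_on UNIV \<and>
      (\<forall>s. Re s > 1 \<longrightarrow> (\<lambda>k. of_nat (Suc k) powr (- s)) sums (zeta_num s / (s - 1)))"
    proof (intro conjI allI impI zeta_quotient_nicely_meromorphic)
      fix s :: complex assume "Re s > 1"
      then show "(\<lambda>k. of_nat (Suc k) powr (- s)) sums (zeta_num s / (s - 1))"
        using dirichlet_zeta_sums[of s] by (auto simp: zeta_num_eq)
    qed
  next
    fix f assume f: "f nicely_meromorphic_on UNIV \<and> (\<forall>s. Re s > 1 \<longrightarrow> (\<lambda>k. of_nat (Suc k) powr (- s)) sums f s)"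
    show "f = (\<lambda>s. zeta_num s / (s - 1))"
    proof (rule ext, rule nicely_meromorphic_eq[of f UNIV "\<lambda>s. zeta_num s / (s - 1)" 2])
      have "eventually (\<lambda>s. s \<in> {s. Re s > 1}) (at (2::complex))"
        by (rule eventually_at_in_open'[OF open_halfspace_Re_gt]) auto
      then show "eventually (\<lambda>s. f s = zeta_num s / (s - 1)) (at 2)"
      proof eventually_elim
        case (elim s)
        then have s: "Re s > 1" by simp
        then have "f s = dirichlet_zeta s" using f dirichlet_zeta_sums sums_unique2 by blast
        then show "f s = zeta_num s / (s - 1)" using s by (auto simp: zeta_num_eq)
      qed
    qed (use f zeta_quotient_nicely_meromorphic in auto)
  qed
  then show ?thesis by (rule fun_cong)
qed

lemma riemann_zeta_eq_dirichlet: "Re s > 1 \<Longrightarrow> riemann_zeta s = dirichlet_zeta s"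
  by (auto simp: riemann_zeta_eq zeta_num_eq)

section \<open>The Euler product and primes in trigonometric sums\<close>

definition rough_numbers :: "nat \<Rightarrow> nat set" where
  "rough_numbers N = {n. n > 0 \<and> (\<forall>p<N. prime p \<longrightarrow> \<not> p dvd n)}"

definition zeta_factor :: "complex \<Rightarrow> nat \<Rightarrow> complex" where
  "zeta_factor s p = (if prime p then 1 - of_nat p powr (-s) else 1)"

lemma of_nat_mult_powr: "of_nat (p * m) powr (z::complex) = of_nat p powr z * of_nat m powr z"
  by (simp add: powr_times_real)

text \<open>The sieve of Eratosthenes: multiplying by \<open>1 - q powr (-s)\<close> deletes the
  multiples of the prime \<open>q\<close> from the sum.\<close>

lemma has_sum_rough_numbers:
  assumes "Re s > 1"
  shows "((\<lambda>n. of_nat n powr (-s)) has_sum ((\<Prod>p<N. zeta_factor s p) * dirichlet_zeta s)) (rough_numbers N)"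
proof (induction N)
  case 0
  have "((\<lambda>k. of_nat (Suc k) powr (-s)) has_sum dirichlet_zeta s) UNIV"
    by (rule norm_summable_imp_has_sum[OF Dirichlet_summable dirichlet_zeta_sums]) (use assms in auto)
  then have "((\<lambda>n. of_nat n powr (-s)) has_sum dirichlet_zeta s) (Suc ` UNIV)"
    by (subst has_sum_reindex) (auto simp: o_def)
  moreover have "rough_numbers 0 = Suc ` UNIV"
    by (auto simp: rough_numbers_def image_iff gr0_conv_Suc)
  ultimately show ?case by simp
next
  case (Suc q)
  show ?case
  proof (cases "prime q")
    case False
    then have "rough_numbers (Suc q) = rough_numbers q" by (auto simp: rough_numbers_def less_Suc_eq)
    then show ?thesis using Suc False by (simp add: zeta_factor_def)
  next
    case True
    let ?S = "(\<Prod>p<q. zeta_factor s p) * dirichlet_zeta s"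
    have q: "q > 0" using True prime_gt_0_nat by blast
    have sub: "(*) q ` rough_numbers q \<subseteq> rough_numbers q"
    proof
      fix n assume "n \<in> (*) q ` rough_numbers q"
      then obtain m where m: "n = q * m" "m \<in> rough_numbers q" by auto
      have "\<not> p dvd q * m" if "p < q" "prime p" for p
        using m that True prime_dvd_mult_iff[of p q m] primes_dvd_imp_eq[of p q] by (auto simp: rough_numbers_def)
      then show "n \<in> rough_numbers q" using m q by (auto simp: rough_numbers_def)
    qed
    have "((\<lambda>n. of_nat q powr (-s) * of_nat n powr (-s)) has_sum (of_nat q powr (-s) * ?S)) (rough_numbers q)"
      by (rule has_sum_cmult_right[OF Suc])
    then have 1: "((\<lambda>n. of_nat n powr (-s)) has_sum (of_nat q powr (-s) * ?S)) ((*) q ` rough_numbers q)"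
      using q by (subst has_sum_reindex) (auto simp: o_def of_nat_mult_powr inj_on_def simp del: of_nat_mult)
    \<comment> \<open>The multiples of \<open>q\<close> without prime factor below \<open>q\<close>
      are exactly \<open>q\<close> times the numbers without such a factor.\<close>
    have eq: "rough_numbers (Suc q) = rough_numbers q - (*) q ` rough_numbers q"
    proof (rule set_eqI)
      fix n
      have "n \<in> (*) q ` rough_numbers q" if n: "n \<in> rough_numbers q" and dv: "q dvd n"
      proof -
        obtain m where m: "n = q * m" using dv by (rule dvdE)
        then have "m \<in> rough_numbers q" using n by (auto simp: rough_numbers_def)
        then show ?thesis using m by auto
      qed
      moreover have "q dvd n" if "n \<in> (*) q ` rough_numbers q" using that by auto
      moreover have "n \<in> rough_numbers (Suc q) \<longleftrightarrow> n \<in> rough_numbers q \<and> \<not> q dvd n"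
        using True by (auto simp: rough_numbers_def less_Suc_eq)
      ultimately show "n \<in> rough_numbers (Suc q) \<longleftrightarrow> n \<in> rough_numbers q - (*) q ` rough_numbers q" by blast
    qed
    have "((\<lambda>n. of_nat n powr (-s)) has_sum (?S - of_nat q powr (-s) * ?S)) (rough_numbers (Suc q))"
      unfolding eq by (rule has_sum_Diff[OF Suc 1 sub])
    then show ?thesis using True by (simp add: zeta_factor_def algebra_simps)
  qed
qed

lemma summable_prime_powr:
  assumes "\<sigma> > 1"
  shows "summable (\<lambda>p. real p powr (-\<sigma>))"
  using assms by (simp add: summable_real_powr_iff)

text \<open>Apart from 1, every number without prime factors below \<open>N\<close> is at least
  \<open>N\<close>, so the sieved sum differs from 1 by no more than a tail of an absolutely
  convergent series.\<close>

lemma Euler_product_tendsto: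
  assumes "Re s > 1"
  shows "(\<lambda>N. (\<Prod>p<N. zeta_factor s p) * dirichlet_zeta s) \<longlonglongrightarrow> 1"
proof (rule LIMSEQ_I)
  fix e :: real assume "e > 0"
  have sm: "summable (\<lambda>n. real n powr (-Re s))" by (rule summable_prime_powr[OF assms])
  then obtain N0 where N0: "\<And>N. N \<ge> N0 \<Longrightarrow> norm (\<Sum>i. real (i + N) powr (-Re s)) < e"
    using suminf_exist_split[OF \<open>e > 0\<close> sm] by blast
  show "\<exists>no. \<forall>N\<ge>no. norm ((\<Prod>p<N. zeta_factor s p) * dirichlet_zeta s - 1) < e"
  proof (intro exI allI impI)
    fix N assume N: "N \<ge> max 2 N0"
    let ?S = "(\<Prod>p<N. zeta_factor s p) * dirichlet_zeta s"
    define F where "F = (\<lambda>n. if n \<in> rough_numbers N - {1} then of_nat n powr (-s) else 0)"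
    have "1 \<in> rough_numbers N" by (auto simp: rough_numbers_def)
    moreover have "((\<lambda>n. of_nat n powr (-s)) has_sum 1) {1}"
      using has_sum_finite[of "{1::nat}" "\<lambda>n. of_nat n powr (-s)"] by simp
    ultimately have "((\<lambda>n. of_nat n powr (-s)) has_sum (?S - 1)) (rough_numbers N - {1})"
      by (intro has_sum_Diff has_sum_rough_numbers assms) auto
    then have "(F has_sum (?S - 1)) UNIV"
      by (rule has_sum_cong_neutral[THEN iffD1, rotated 3]) (auto simp: F_def)
    then have "F sums (?S - 1)" by (rule has_sum_imp_sums)
    moreover have F0: "F n = 0" if "n < N" for n
    proof -
      have "n \<notin> rough_numbers N - {1}"
      proof
        assume n: "n \<in> rough_numbers N - {1}"
        then obtain p where "prime p" "p dvd n" using prime_factor_nat[of n] by auto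
        moreover have "p \<le> n" using n \<open>p dvd n\<close> by (auto simp: rough_numbers_def dvd_imp_le)
        ultimately show False using n that by (auto simp: rough_numbers_def)
      qed
      then show ?thesis unfolding F_def by (rule if_not_P)
    qed
    ultimately have "(\<lambda>i. F (i + N)) sums (?S - 1)"
      using sums_iff_shift[of F N "?S - 1"] by simp
    then have "?S - 1 = (\<Sum>i. F (i + N))" by (simp add: sums_iff)
    moreover have "norm (\<Sum>i. F (i + N)) \<le> (\<Sum>i. real (i + N) powr (-Re s))"
    proof (rule norm_suminf_le)
      show "norm (F (i + N)) \<le> real (i + N) powr (-Re s)" for i
        using N by (cases "i + N = 0") (auto simp: F_def norm_of_nat_powr simp del: of_nat_add)
      show "summable (\<lambda>i. real (i + N) powr (-Re s))" by (rule summable_ignore_initial_segment[OF sm])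
    qed
    ultimately show "norm (?S - 1) < e" using N0[of N] N by fastforce
  qed
qed

lemma convergent_prod_prime_type:
  fixes f :: "nat \<Rightarrow> complex"
  assumes "\<sigma> > 1" and "\<And>p. prime p \<Longrightarrow> norm (f p - 1) \<le> C * real p powr (-\<sigma>)" and "\<And>p. \<not> prime p \<Longrightarrow> f p = 1"
  shows "abs_convergent_prod f" "convergent_prod f"
proof -
  have "summable (\<lambda>p. norm (f p - 1))"
  proof (rule summable_comparison_test', rule summable_mult)
    show "summable (\<lambda>p. real p powr (-\<sigma>))" by (rule summable_prime_powr[OF assms(1)])
    show "norm (norm (f p - 1)) \<le> \<bar>C\<bar> * real p powr (-\<sigma>)" if "p \<ge> 0" for p
    proof (cases "prime p")
      case True
      have "C * real p powr (-\<sigma>) \<le> \<bar>C\<bar> * real p powr (-\<sigma>)" by (intro mult_right_mono) auto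
      then show ?thesis using assms(2)[OF True] by simp
    qed (use assms(3) in simp)
  qed
  then show "abs_convergent_prod f" by (rule summable_imp_abs_convergent_prod)
  then show "convergent_prod f" by (rule abs_convergent_prod_imp_convergent_prod)
qed

lemma zeta_factor_nonzero:
  assumes "Re s > 0" shows "zeta_factor s p \<noteq> 0"
proof (cases "prime p")
  case True
  have "norm (of_nat p powr (-s)) < 1"
    using assms prime_gt_1_nat[OF True] by (subst norm_of_nat_powr) (auto simp: powr_less_one)
  then show ?thesis using True by (auto simp: zeta_factor_def)
qed (simp add: zeta_factor_def)

lemma Euler_product:
  assumes "Re s > 1"
  shows "zeta_factor s has_prod inverse (dirichlet_zeta s)" and "dirichlet_zeta s \<noteq> 0"
proof -
  have conv: "convergent_prod (zeta_factor s)"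
  proof (rule convergent_prod_prime_type[OF assms])
    show "cmod (zeta_factor s p - 1) \<le> 1 * real p powr - Re s" if "prime p" for p
      using that prime_gt_0_nat[OF that] by (simp add: zeta_factor_def norm_of_nat_powr)
  qed (simp add: zeta_factor_def)
  have "(\<lambda>N. \<Prod>p<N. zeta_factor s p) \<longlonglongrightarrow> prodinf (zeta_factor s)"
    using conv by (intro has_prod_imp_tendsto' convergent_prod_has_prod)
  then have "(\<lambda>N. (\<Prod>p<N. zeta_factor s p) * dirichlet_zeta s) \<longlonglongrightarrow> prodinf (zeta_factor s) * dirichlet_zeta s"
    by (intro tendsto_intros)
  then have eq: "prodinf (zeta_factor s) * dirichlet_zeta s = 1"
    using Euler_product_tendsto[OF assms] LIMSEQ_unique by blast
  then show "dirichlet_zeta s \<noteq> 0" by auto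
  with eq have "prodinf (zeta_factor s) = inverse (dirichlet_zeta s)" by (simp add: field_simps)
  then show "zeta_factor s has_prod inverse (dirichlet_zeta s)"
    using convergent_prod_has_prod[OF conv] by simp
qed

section \<open>Cosine sums over primes and the non-vanishing of zeta on the line Re s = 1\<close>

abbreviation cos_term :: "real \<Rightarrow> real \<Rightarrow> nat \<Rightarrow> real" where
  "cos_term \<sigma> t p \<equiv> if prime p then real p powr (-\<sigma>) * cos (t * ln (real p)) else 0"

text \<open>For \<open>\<sigma> > 1\<close>, the real part of the prime zeta function at
  \<open>\<sigma> + i t\<close>.\<close>

definition prime_cos_sum :: "real \<Rightarrow> real \<Rightarrow> real" where
  "prime_cos_sum \<sigma> t = (\<Sum>p. cos_term \<sigma> t p)"

lemma summable_prime_bounded: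
  assumes "\<sigma> > 1" "\<And>p. prime p \<Longrightarrow> \<bar>g p\<bar> \<le> C"
  shows "summable (\<lambda>p. if prime p then real p powr (-\<sigma>) * (g p :: real) else 0)"
proof (rule summable_comparison_test', rule summable_mult)
  show "summable (\<lambda>p. real p powr (-\<sigma>))" by (rule summable_prime_powr[OF assms(1)])
  show "norm (if prime p then real p powr (-\<sigma>) * g p else 0) \<le> \<bar>C\<bar> * real p powr (-\<sigma>)" if "p \<ge> 0" for p
    using assms(2)[of p] by (auto simp: abs_mult intro!: mult_left_mono simp: mult.commute[of "\<bar>C\<bar>"])
qed

lemma prime_cos_sum_sums:
  assumes "\<sigma> > 1"
  shows "cos_term \<sigma> t sums prime_cos_sum \<sigma> t"
  unfolding prime_cos_sum_def
  by (rule summable_sums, rule summable_prime_bounded[of _ _ 1]) (use assms in auto)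

lemma ln_norm_one_minus:
  fixes x :: complex
  assumes "norm x \<le> 1/2"
  shows "\<bar>ln (norm (1 - x)) + Re x\<bar> \<le> 2 * (norm x)\<^sup>2"
proof -
  have "norm (Ln (1 - x) + x) \<le> (norm x)\<^sup>2 / (1 - norm x)"
    using Ln_approx_linear[of "-x"] assms by simp
  also have "\<dots> \<le> (norm x)\<^sup>2 / (1/2)" using assms by (intro divide_left_mono) auto
  finally have "norm (Ln (1 - x) + x) \<le> 2 * (norm x)\<^sup>2" by simp
  moreover have "\<bar>Re (Ln (1 - x) + x)\<bar> \<le> norm (Ln (1 - x) + x)" by (rule abs_Re_le_cmod)
  moreover have "1 - x \<noteq> 0" using assms by auto
  ultimately show ?thesis by (simp add: Re_Ln)
qed

abbreviation abs_zeta :: "real \<Rightarrow> real \<Rightarrow> real" where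
  "abs_zeta \<sigma> t \<equiv> norm (dirichlet_zeta (Complex \<sigma> t))"

text \<open>In the logarithm of the Euler product the linear terms form
  \<open>prime_cos_sum\<close>; the rest is at most \<open>2 * p powr (-2)\<close> at each prime,
  uniformly in both variables.\<close>

lemma ln_norm_dirichlet_zeta:
  assumes "\<sigma> > 1"
  shows "\<bar>ln (abs_zeta \<sigma> t) - prime_cos_sum \<sigma> t\<bar> \<le> 2 * (\<Sum>n. real n powr (-2))"
proof -
  let ?s = "Complex \<sigma> t"
  define x where "x = (\<lambda>p::nat. of_nat p powr (- ?s))"
  have "(\<lambda>p. norm (zeta_factor ?s p)) has_prod norm (inverse (dirichlet_zeta ?s))"
    by (rule has_prod_norm, rule Euler_product) (use assms in auto)
  then have a: "(\<lambda>p. ln (norm (zeta_factor ?s p))) sums ln (norm (inverse (dirichlet_zeta ?s)))"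
    by (rule has_prod_imp_sums_ln_real') (use zeta_factor_nonzero[of ?s] assms in auto)
  have b: "ln (norm (inverse (dirichlet_zeta ?s))) = - ln (norm (dirichlet_zeta ?s))"
    using Euler_product(2)[of ?s] assms by (simp add: norm_inverse ln_inverse)
  have "(\<lambda>p. ln (norm (zeta_factor ?s p)) + cos_term \<sigma> t p)
     sums (- ln (norm (dirichlet_zeta ?s)) + prime_cos_sum \<sigma> t)"
    by (rule sums_add[OF a[unfolded b] prime_cos_sum_sums[OF assms]])
  then have 1: "- ln (norm (dirichlet_zeta ?s)) + prime_cos_sum \<sigma> t =
     (\<Sum>p. ln (norm (zeta_factor ?s p)) + cos_term \<sigma> t p)"
    by (simp add: sums_iff)
  have sm: "summable (\<lambda>n. real n powr (-2))" by (simp add: summable_real_powr_iff)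
  have "norm (\<Sum>p. ln (norm (zeta_factor ?s p)) + cos_term \<sigma> t p)
    \<le> (\<Sum>p. 2 * real p powr (-2))"
  proof (rule norm_suminf_le[OF _ summable_mult[OF sm]])
    fix p
    show "norm (ln (norm (zeta_factor ?s p)) + cos_term \<sigma> t p) \<le> 2 * real p powr (-2)"
    proof (cases "prime p")
      case True
      then have p: "p \<ge> 2" by (rule prime_ge_2_nat)
      have nx: "norm (x p) = real p powr (-\<sigma>)" using p unfolding x_def by (subst norm_of_nat_powr) auto
      have "Ln (of_nat p) = of_real (ln (real p))" using Ln_of_real[of "real p"] p by simp
      then have "x p = exp (- ?s * of_real (ln p))"
        using p by (simp add: x_def powr_def)
      then have rx: "Re (x p) = real p powr (-\<sigma>) * cos (t * ln p)"
        using p by (simp add: Re_exp powr_def mult.commute)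
      have le1: "real p powr (-\<sigma>) \<le> real p powr (-1)" using p assms by (intro powr_mono) auto
      also have "\<dots> \<le> 1 / 2" using p by (simp add: powr_minus field_simps)
      finally have "norm (x p) \<le> 1/2" using nx by simp
      from ln_norm_one_minus[OF this]
      have "\<bar>ln (norm (1 - x p)) + Re (x p)\<bar> \<le> 2 * (real p powr (-\<sigma>))\<^sup>2" using nx by simp
      also have "\<dots> \<le> 2 * (real p powr (-1))\<^sup>2" using le1 by (intro mult_left_mono power_mono) auto
      also have "(real p powr (-1))\<^sup>2 = real p powr (-2)" using powr_add[of "real p" "-1" "-1"] p by (simp add: power2_eq_square)
      finally show ?thesis using True rx by (simp add: zeta_factor_def x_def)
    qed (simp add: zeta_factor_def)
  qed
  also have "\<dots> = 2 * (\<Sum>p. real p powr (-2))" by (rule suminf_mult[OF sm])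
  finally show ?thesis unfolding 1[symmetric] by (simp add: abs_if split: if_splits)
qed

text \<open>Termwise this is \<open>3 + 4 * cos x + cos (2 * x) = 2 * (1 + cos x)^2\<close>.\<close>

lemma prime_cos_sum_341:
  assumes "\<sigma> > 1"
  shows "3 * prime_cos_sum \<sigma> 0 + 4 * prime_cos_sum \<sigma> t + prime_cos_sum \<sigma> (2 * t) \<ge> 0"
proof -
  note s = prime_cos_sum_sums[OF assms]
  have "(\<lambda>p. (3 * cos_term \<sigma> 0 p + 4 * cos_term \<sigma> t p)
      + cos_term \<sigma> (2 * t) p) sums
     ((3 * prime_cos_sum \<sigma> 0 + 4 * prime_cos_sum \<sigma> t) + prime_cos_sum \<sigma> (2 * t))"
    by (intro sums_add sums_mult s)
  moreover have "0 \<le> (3 * cos_term \<sigma> 0 p + 4 * cos_term \<sigma> t p)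
      + cos_term \<sigma> (2 * t) p" for p
  proof -
    have "0 \<le> 2 * (1 + cos (t * ln p))\<^sup>2" by simp
    also have "\<dots> = 3 + 4 * cos (t * ln p) + cos (2 * t * ln p)"
      using cos_double_cos[of "t * ln p"] by (simp add: power2_eq_square algebra_simps)
    finally have "0 \<le> real p powr (-\<sigma>) * (3 + 4 * cos (t * ln p) + cos (2 * t * ln p))" by simp
    then show ?thesis by (simp add: algebra_simps)
  qed
  ultimately show ?thesis by (rule sums_le[OF _ sums_zero, rotated])
qed

lemma bounded_on_vertical_strip:
  assumes "continuous_on UNIV f"
  shows "\<exists>M>0. \<forall>\<sigma>\<in>{1..2}. norm (f (Complex \<sigma> t) :: complex) \<le> M"
proof -
  have "continuous_on {1..2} (\<lambda>\<sigma>. f (Complex \<sigma> t))"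
    by (intro continuous_on_compose2[OF assms] continuous_intros) auto
  then have "bounded ((\<lambda>\<sigma>. f (Complex \<sigma> t)) ` {1..2})"
    by (intro compact_imp_bounded compact_continuous_image) auto
  then obtain M where M: "M > 0" "\<forall>x\<in>(\<lambda>\<sigma>. f (Complex \<sigma> t)) ` {1..2}. norm x \<le> M"
    unfolding bounded_pos by blast
  show ?thesis
    by (intro exI[of _ M] conjI ballI) (use M in auto)
qed

lemma continuous_zeta_num: "continuous_on A zeta_num"
  using holomorphic_on_imp_continuous_on[OF zeta_num_holomorphic] continuous_on_subset by blast

lemma norm_dirichlet_zeta_eq:
  assumes "\<sigma> > 1"
  shows "abs_zeta \<sigma> t = norm (zeta_num (Complex \<sigma> t)) / norm (Complex (\<sigma> - 1) t)"
proof -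
  have "Complex \<sigma> t - 1 = Complex (\<sigma> - 1) t" by (simp add: complex_eq_iff)
  moreover have "Complex (\<sigma> - 1) t \<noteq> 0" using assms by (simp add: complex_eq_iff)
  ultimately show ?thesis using assms by (simp add: zeta_num_eq norm_mult)
qed

text \<open>Mertens' argument: as \<open>\<sigma>\<close> tends to 1, the pole at 1 contributes
  \<open>- 3 * ln (\<sigma> - 1)\<close> to the 3-4-1 sum while a zero at \<open>1 + i t\<close>
  contributes at most \<open>4 * ln (\<sigma> - 1)\<close> up to a constant. The total tends to
  minus infinity, against the lower bound 0.\<close>

lemma zeta_num_Re1_nonzero: "zeta_num (Complex 1 t) \<noteq> 0"
proof
  assume 0: "zeta_num (Complex 1 t) = 0"
  have t: "t \<noteq> 0"
  proof
    assume "t = 0"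
    then have "Complex 1 t = 1" by (simp add: complex_eq_iff)
    then show False using 0 zeta_num_1 by simp
  qed
  let ?w = "Complex 1 t"
  \<comment> \<open>The difference quotient at the supposed zero; its bound \<open>L\<close> shows
    that \<open>zeta_num\<close> vanishes there at least to first order in
    \<open>\<sigma> - 1\<close>.\<close>
  define g where "g = (\<lambda>z. if z = ?w then deriv zeta_num ?w else (zeta_num z - zeta_num ?w) / (z - ?w))"
  have g: "g holomorphic_on UNIV" unfolding g_def by (rule pole_lemma_open[OF zeta_num_holomorphic]) auto
  obtain L where L: "L > 0" "\<And>\<sigma>. \<sigma> \<in> {1..2} \<Longrightarrow> norm (g (Complex \<sigma> t)) \<le> L"
    using bounded_on_vertical_strip[OF holomorphic_on_imp_continuous_on[OF g], of t] by blast
  obtain M where M: "M > 0" "\<And>\<sigma>. \<sigma> \<in> {1..2} \<Longrightarrow> norm (zeta_num (Complex \<sigma> 0)) \<le> M"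
    using bounded_on_vertical_strip[OF continuous_zeta_num, of 0] by blast
  obtain N where N: "N > 0" "\<And>\<sigma>. \<sigma> \<in> {1..2} \<Longrightarrow> norm (zeta_num (Complex \<sigma> (2 * t))) \<le> N"
    using bounded_on_vertical_strip[OF continuous_zeta_num, of "2 * t"] by blast
  define B where "B = 2 * (\<Sum>n. real n powr (-2))"
  \<comment> \<open>\<open>M\<close>, \<open>L / \<bar>t\<bar>\<close> and
    \<open>N / (2 * \<bar>t\<bar>)\<close> bound zeta near 1, \<open>1 + i t\<close> and
    \<open>1 + 2 i t\<close> up to the powers of \<open>\<sigma> - 1\<close>; the term
    \<open>8 * B\<close> is the error \<open>B\<close> with weights 3 + 4 + 1.\<close>
  define C where "C = 3 * ln M + 4 * ln (L / \<bar>t\<bar>) + ln (N / (2 * \<bar>t\<bar>)) + 8 * B"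
  have main: "0 \<le> C + ln (\<sigma> - 1)" if \<sigma>: "1 < \<sigma>" "\<sigma> \<le> 2" for \<sigma>
  proof -
    have nz: "abs_zeta \<sigma> u > 0" for u using Euler_product(2)[of "Complex \<sigma> u"] \<sigma> by simp
    have c: "prime_cos_sum \<sigma> u \<le> ln (abs_zeta \<sigma> u) + B" for u
      using ln_norm_dirichlet_zeta[OF \<sigma>(1), of u] unfolding B_def by linarith
    have nge: "norm (Complex (\<sigma> - 1) u) \<ge> \<bar>u\<bar>" for u using abs_Im_le_cmod[of "Complex (\<sigma> - 1) u"] by simp
    have "abs_zeta \<sigma> 0 \<le> M / (\<sigma> - 1)"
      using M(2)[of \<sigma>] \<sigma> by (simp add: norm_dirichlet_zeta_eq complex_norm divide_right_mono)
    then have "ln (abs_zeta \<sigma> 0) \<le> ln (M / (\<sigma> - 1))" using nz by (intro ln_mono) auto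
    then have 1: "ln (abs_zeta \<sigma> 0) \<le> ln M - ln (\<sigma> - 1)" using M \<sigma> by (simp add: ln_div)
    have "zeta_num (Complex \<sigma> t) = (Complex \<sigma> t - ?w) * g (Complex \<sigma> t)"
      using \<sigma> 0 by (simp add: g_def complex_eq_iff)
    moreover have "norm (Complex \<sigma> t - ?w) = \<sigma> - 1" using \<sigma> by (simp add: complex_norm complex_diff)
    ultimately have "norm (zeta_num (Complex \<sigma> t)) \<le> (\<sigma> - 1) * L"
      using L(2)[of \<sigma>] \<sigma> by (simp add: norm_mult)
    then have "abs_zeta \<sigma> t \<le> ((\<sigma> - 1) * L) / \<bar>t\<bar>"
      unfolding norm_dirichlet_zeta_eq[OF \<sigma>(1)] using nge[of t] t \<sigma> L(1) by (intro frac_le) auto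
    then have "ln (abs_zeta \<sigma> t) \<le> ln ((\<sigma> - 1) * (L / \<bar>t\<bar>))" using nz by (intro ln_mono) auto
    then have 2: "ln (abs_zeta \<sigma> t) \<le> ln (\<sigma> - 1) + ln (L / \<bar>t\<bar>)"
      using \<sigma> L t by (subst (asm) ln_mult) auto
    have "abs_zeta \<sigma> (2 * t) \<le> N / (2 * \<bar>t\<bar>)"
      unfolding norm_dirichlet_zeta_eq[OF \<sigma>(1)] using nge[of "2 * t"] t N(2)[of \<sigma>] \<sigma> N(1) by (intro frac_le) (auto simp: abs_mult)
    then have 3: "ln (abs_zeta \<sigma> (2 * t)) \<le> ln (N / (2 * \<bar>t\<bar>))" using nz by (intro ln_mono) auto
    show ?thesis
      using prime_cos_sum_341[OF \<sigma>(1), of t] c[of 0] c[of t] c[of "2 * t"] 1 2 3 unfolding C_def by linarith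
  qed
  define \<epsilon> where "\<epsilon> = min 1 (exp (- C - 1))"
  have "\<epsilon> > 0" "\<epsilon> \<le> 1" by (auto simp: \<epsilon>_def)
  then have "ln \<epsilon> \<le> ln (exp (- C - 1))" by (subst ln_le_cancel_iff) (auto simp: \<epsilon>_def)
  moreover have "0 \<le> C + ln \<epsilon>" using main[of "1 + \<epsilon>"] \<open>\<epsilon> > 0\<close> \<open>\<epsilon> \<le> 1\<close> by simp
  ultimately show False by simp
qed

text \<open>\<open>zeta_num\<close> has no zeros on the compact segment from \<open>1 + i t\<close>
  to \<open>2 + i t\<close>, so its logarithm is bounded and only the factor \<open>s - 1\<close>
  remains. This covers both the divergence for \<open>t = 0\<close> and the boundedness for other
  \<open>t\<close>.\<close>

lemma prime_cos_sum_asymp: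
  "\<exists>C. \<forall>\<sigma>\<in>{1<..2}. \<bar>prime_cos_sum \<sigma> t + ln (norm (Complex (\<sigma> - 1) t))\<bar> \<le> C"
proof -
  have nz: "zeta_num (Complex \<sigma> t) \<noteq> 0" if "\<sigma> \<in> {1..2}" for \<sigma>
  proof (cases "\<sigma> = 1")
    case False
    then have "Re (Complex \<sigma> t) > 1" using that by simp
    moreover from this have "Complex \<sigma> t - 1 \<noteq> 0" by (auto simp: complex_eq_iff)
    ultimately show ?thesis using Euler_product(2)[of "Complex \<sigma> t"] by (simp add: zeta_num_eq)
  qed (use zeta_num_Re1_nonzero in simp)
  have "continuous_on {1..2} (\<lambda>\<sigma>. ln (norm (zeta_num (Complex \<sigma> t))))"
    by (intro continuous_intros continuous_on_compose2[OF continuous_zeta_num[of UNIV]]) (use nz in auto)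
  then have "bounded ((\<lambda>\<sigma>. ln (norm (zeta_num (Complex \<sigma> t)))) ` {1..2})"
    by (intro compact_imp_bounded compact_continuous_image) auto
  then obtain M where "\<forall>y\<in>(\<lambda>\<sigma>. ln (norm (zeta_num (Complex \<sigma> t)))) ` {1..2}. norm y \<le> M"
    unfolding bounded_iff by blast
  then have M: "\<bar>ln (norm (zeta_num (Complex \<sigma> t)))\<bar> \<le> M" if "\<sigma> \<in> {1..2}" for \<sigma>
    using that by (simp only: real_norm_def ball_simps(9))
  show ?thesis
  proof (intro exI ballI)
    fix \<sigma> :: real assume \<sigma>: "\<sigma> \<in> {1<..2}"
    have "ln (abs_zeta \<sigma> t) = ln (norm (zeta_num (Complex \<sigma> t))) - ln (norm (Complex (\<sigma> - 1) t))"
      using \<sigma> nz[of \<sigma>] by (simp add: norm_dirichlet_zeta_eq ln_div complex_eq_iff)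
    then show "\<bar>prime_cos_sum \<sigma> t + ln (norm (Complex (\<sigma> - 1) t))\<bar> \<le> M + 2 * (\<Sum>n. real n powr (-2))"
      using M[of \<sigma>] ln_norm_dirichlet_zeta[of \<sigma> t] \<sigma> by simp
  qed
qed

lemma prime_cos_sum_bounded:
  assumes "t \<noteq> 0"
  shows "\<exists>C. \<forall>\<sigma>\<in>{1<..2}. \<bar>prime_cos_sum \<sigma> t\<bar> \<le> C"
proof -
  obtain C where C: "\<And>\<sigma>. \<sigma> \<in> {1<..2} \<Longrightarrow> \<bar>prime_cos_sum \<sigma> t + ln (norm (Complex (\<sigma> - 1) t))\<bar> \<le> C"
    using prime_cos_sum_asymp by blast
  show ?thesis
  proof (intro exI ballI)
    fix \<sigma> :: real assume \<sigma>: "\<sigma> \<in> {1<..2}"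
    have "norm (Complex (\<sigma> - 1) t) \<ge> \<bar>t\<bar>" using abs_Im_le_cmod[of "Complex (\<sigma> - 1) t"] by simp
    then have 1: "ln (norm (Complex (\<sigma> - 1) t)) \<ge> ln \<bar>t\<bar>" using assms by (intro ln_mono) auto
    have "norm (Complex (\<sigma> - 1) t) \<le> 1 + \<bar>t\<bar>" using cmod_le[of "Complex (\<sigma> - 1) t"] \<sigma> by simp
    moreover have "norm (Complex (\<sigma> - 1) t) > 0" using assms by (simp add: complex_eq_iff)
    ultimately have 2: "ln (norm (Complex (\<sigma> - 1) t)) \<le> ln (1 + \<bar>t\<bar>)" by (intro ln_mono) auto
    show "\<bar>prime_cos_sum \<sigma> t\<bar> \<le> C + \<bar>ln \<bar>t\<bar>\<bar> + \<bar>ln (1 + \<bar>t\<bar>)\<bar>"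
      using C[OF \<sigma>] 1 2 by linarith
  qed
qed

lemma prime_cos_sum_0_unbounded: "\<exists>\<sigma>\<in>{1<..2}. prime_cos_sum \<sigma> 0 > B"
proof -
  obtain C where C: "\<And>\<sigma>. \<sigma> \<in> {1<..2} \<Longrightarrow> \<bar>prime_cos_sum \<sigma> 0 + ln (norm (Complex (\<sigma> - 1) 0))\<bar> \<le> C"
    using prime_cos_sum_asymp by blast
  define \<epsilon> where "\<epsilon> = min 1 (exp (- B - C - 1))"
  have \<epsilon>: "\<epsilon> > 0" "\<epsilon> \<le> 1" by (auto simp: \<epsilon>_def)
  then have "ln \<epsilon> \<le> ln (exp (- B - C - 1))" by (subst ln_le_cancel_iff) (auto simp: \<epsilon>_def)
  moreover have "\<bar>prime_cos_sum (1 + \<epsilon>) 0 + ln \<epsilon>\<bar> \<le> C" using C[of "1 + \<epsilon>"] \<epsilon> by (simp add: complex_norm)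
  ultimately have "prime_cos_sum (1 + \<epsilon>) 0 > B" by simp
  then show ?thesis using \<epsilon> by (intro bexI[of _ "1 + \<epsilon>"]) auto
qed

lemma prime_powr_sum_le_reciprocal_sum:
  fixes G :: "nat \<Rightarrow> bool"
  assumes "summable (\<lambda>p. if prime p \<and> G p then 1 / real p else 0)" "\<sigma> > 1"
  shows "(\<Sum>p. if prime p \<and> G p then real p powr (-\<sigma>) else 0) \<le> (\<Sum>p. if prime p \<and> G p then 1 / real p else 0)"
proof (rule suminf_le[OF _ _ assms(1)])
  have le: "real p powr (-\<sigma>) \<le> 1 / real p" if "prime p" for p
  proof -
    have "real p powr (-\<sigma>) \<le> real p powr (-1)"
      using prime_ge_2_nat[OF that] assms by (intro powr_mono) auto
    then show ?thesis using prime_gt_0_nat[OF that] by (simp add: powr_minus_divide)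
  qed
  then show "(if prime p \<and> G p then real p powr (-\<sigma>) else 0) \<le> (if prime p \<and> G p then 1 / real p else 0)" for p
    by auto
  show "summable (\<lambda>p. if prime p \<and> G p then real p powr (-\<sigma>) else 0)"
    by (rule summable_comparison_test'[OF assms(1), of 0]) (use le in auto)
qed

section \<open>Trigonometric polynomials at logarithms of primes\<close>

lemma square_norm_trig_sum:
  fixes c l :: "'a \<Rightarrow> real"
  shows "(norm (\<Sum>i\<in>I. of_real (c i) * exp (\<i> * of_real (l i * u))))\<^sup>2 = (\<Sum>i\<in>I. \<Sum>j\<in>I. c i * c j * cos ((l i - l j) * u))"
proof -
  have *: "of_real (c i) * exp (\<i> * of_real (l i * u)) = Complex (c i * cos (l i * u)) (c i * sin (l i * u))" for i
    by (simp add: complex_eq_iff Re_exp Im_exp)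
  have "(norm (\<Sum>i\<in>I. of_real (c i) * exp (\<i> * of_real (l i * u))))\<^sup>2 =
      (\<Sum>i\<in>I. c i * cos (l i * u))\<^sup>2 + (\<Sum>i\<in>I. c i * sin (l i * u))\<^sup>2"
    unfolding cmod_power2 * by simp
  also have "\<dots> = (\<Sum>i\<in>I. \<Sum>j\<in>I. c i * cos (l i * u) * (c j * cos (l j * u)) + c i * sin (l i * u) * (c j * sin (l j * u)))"
    by (simp only: power2_eq_square sum_product sum.distrib)
  also have "\<dots> = (\<Sum>i\<in>I. \<Sum>j\<in>I. c i * c j * cos ((l i - l j) * u))"
    by (intro sum.cong refl) (simp add: cos_diff left_diff_distrib algebra_simps)
  finally show ?thesis .
qed

abbreviation dense_primes :: "(nat \<Rightarrow> bool) \<Rightarrow> bool" where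
  "dense_primes G \<equiv> \<not> summable (\<lambda>p. if prime p \<and> G p then 1 / real p else 0)"

text \<open>Weighted by \<open>p powr (-\<sigma>)\<close>, the values of \<open>F\<close> at the
  logarithms of primes sum to \<open>c0\<close> times the full prime sum, up to a bounded error. If
  the primes with large \<open>E\<close> had a convergent reciprocal sum, the same quantity would be
  at most half of that plus a constant, impossible as \<open>\<sigma>\<close> tends to 1.\<close>

lemma primes_trig_sum_large:
  fixes c l :: "'a \<Rightarrow> real"
  assumes fin: "finite I"
    and nz: "(\<Sum>i\<in>I. of_real (c i) * exp (\<i> * of_real (l i * u0))) \<noteq> (0::complex)"
  defines "E \<equiv> \<lambda>u::real. \<Sum>i\<in>I. of_real (c i) * exp (\<i> * of_real (l i * u))"
  shows "\<exists>\<delta>>0. \<not> summable (\<lambda>p. if prime p \<and> norm (E (ln p)) \<ge> \<delta> then 1 / real p else 0)"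
proof -
  define F where "F = (\<lambda>u. (norm (E u))\<^sup>2)"
  have F: "F u = (\<Sum>i\<in>I. \<Sum>j\<in>I. c i * c j * cos ((l i - l j) * u))" for u
    unfolding F_def E_def by (rule square_norm_trig_sum)
  \<comment> \<open>\<open>c0\<close> is the mean value of \<open>F\<close>; the other frequencies contribute bounded prime sums.\<close>
  define c0 where "c0 = (\<Sum>i\<in>I. \<Sum>j\<in>I. if l i = l j then c i * c j else 0)"
  have c0: "c0 > 0"
  proof -
    \<comment> \<open>\<open>S x\<close> collects the coefficients of the frequency
      \<open>x\<close>. Parseval gives \<open>c0\<close> as the sum of their squares, so
      \<open>c0 = 0\<close> would make \<open>E\<close> vanish identically, contrary to
      \<open>nz\<close>.\<close>
    define S where "S = (\<lambda>x. \<Sum>i\<in>{i\<in>I. l i = x}. c i)"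
    have "c0 = (\<Sum>i\<in>I. c i * S (l i))"
      unfolding c0_def S_def by (auto simp: sum.inter_filter[OF fin] sum_distrib_left if_distrib eq_commute intro!: sum.cong)
    also have "\<dots> = (\<Sum>x\<in>l ` I. \<Sum>i\<in>{i\<in>I. l i = x}. c i * S (l i))"
      by (rule sum.image_gen[OF fin])
    also have "\<dots> = (\<Sum>x\<in>l ` I. (S x)\<^sup>2)"
      by (intro sum.cong refl) (simp add: S_def power2_eq_square sum_distrib_right)
    finally have eq: "c0 = (\<Sum>x\<in>l ` I. (S x)\<^sup>2)" .
    then have "c0 \<ge> 0" by (simp add: sum_nonneg)
    moreover have "c0 \<noteq> 0"
    proof
      assume "c0 = 0"
      then have "(\<Sum>x\<in>l ` I. (S x)\<^sup>2) = 0" using eq by simp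
      then have "\<forall>x\<in>l ` I. (S x)\<^sup>2 = 0" by (subst (asm) sum_nonneg_eq_0_iff) (use fin in auto)
      then have S0: "S x = 0" if "x \<in> l ` I" for x
        using that by (metis zero_eq_power2)
      have "E u0 = (\<Sum>x\<in>l ` I. \<Sum>i\<in>{i\<in>I. l i = x}. of_real (c i) * exp (\<i> * of_real (l i * u0)))"
        unfolding E_def by (rule sum.image_gen[OF fin])
      also have "\<dots> = (\<Sum>x\<in>l ` I. of_real (S x) * exp (\<i> * of_real (x * u0)))"
        by (intro sum.cong refl) (simp add: S_def sum_distrib_right)
      also have "\<dots> = 0" by (intro sum.neutral) (simp add: S0)
      finally show False using nz by (simp add: E_def)
    qed
    ultimately show ?thesis by linarith
  qed
  \<comment> \<open>Primes with \<open>norm (E (ln p)) < \<delta>\<close> then account for at most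
    half of the mean.\<close>
  define \<delta> where "\<delta> = sqrt (c0 / 2)"
  have \<delta>: "\<delta> > 0" "\<delta>\<^sup>2 = c0 / 2" using c0 by (auto simp: \<delta>_def)
  show ?thesis
  proof (intro exI conjI notI)
    show "\<delta> > 0" by fact
  next
    assume sm: "summable (\<lambda>p. if prime p \<and> norm (E (ln p)) \<ge> \<delta> then 1 / real p else 0)"
    define B where "B = (\<Sum>p. if prime p \<and> norm (E (ln p)) \<ge> \<delta> then 1 / real p else 0)"
    define Fmax where "Fmax = (\<Sum>i\<in>I. \<Sum>j\<in>I. \<bar>c i * c j\<bar>)"
    have Fmax: "F u \<le> Fmax" "Fmax \<ge> 0" for u
    proof -
      have "c i * c j * cos ((l i - l j) * u) \<le> \<bar>c i * c j\<bar>" for i j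
      proof -
        have "\<bar>c i * c j * cos ((l i - l j) * u)\<bar> \<le> \<bar>c i * c j\<bar> * 1"
          unfolding abs_mult[of "c i * c j"] by (intro mult_left_mono) auto
        then show ?thesis by linarith
      qed
      then show "F u \<le> Fmax" unfolding F Fmax_def by (intro sum_mono)
      show "Fmax \<ge> 0" unfolding Fmax_def by (intro sum_nonneg) auto
    qed
    have ex: "\<exists>C. \<forall>\<sigma>\<in>{1<..2}. \<bar>if l i = l j then 0 else c i * c j * prime_cos_sum \<sigma> (l i - l j)\<bar> \<le> C" for i j
    proof (cases "l i = l j")
      case False
      then have "l i - l j \<noteq> 0" by simp
      from prime_cos_sum_bounded[OF this]
      obtain C where C: "\<And>\<sigma>. \<sigma> \<in> {1<..2} \<Longrightarrow> \<bar>prime_cos_sum \<sigma> (l i - l j)\<bar> \<le> C"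
        by blast
      then have "\<bar>c i * c j * prime_cos_sum \<sigma> (l i - l j)\<bar> \<le> \<bar>c i * c j\<bar> * C" if "\<sigma> \<in> {1<..2}" for \<sigma>
        unfolding abs_mult[of "c i * c j"] using that by (intro mult_left_mono) auto
      then have "\<forall>\<sigma>\<in>{1<..2}. \<bar>if l i = l j then 0 else c i * c j * prime_cos_sum \<sigma> (l i - l j)\<bar> \<le> \<bar>c i * c j\<bar> * C"
        using False by simp
      then show ?thesis by (rule exI)
    qed auto
    define D where "D = (\<lambda>i j. SOME C. \<forall>\<sigma>\<in>{1<..2}. \<bar>if l i = l j then 0 else c i * c j * prime_cos_sum \<sigma> (l i - l j)\<bar> \<le> C)"
    have D: "\<bar>if l i = l j then 0 else c i * c j * prime_cos_sum \<sigma> (l i - l j)\<bar> \<le> D i j" if "\<sigma> \<in> {1<..2}" for i j \<sigma>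
      using someI_ex[OF ex[of i j]] that unfolding D_def by blast
    define D' where "D' = (\<Sum>i\<in>I. \<Sum>j\<in>I. D i j)"
    \<comment> \<open>The left side bounds the weighted prime sum of \<open>F\<close> from below
      through its frequencies. The right side bounds it from above, using \<open>Fmax\<close> at the
      primes with large \<open>E\<close> and \<open>c0 / 2\<close> at the others.\<close>
    have main: "c0 * prime_cos_sum \<sigma> 0 - D' \<le> Fmax * B + c0 / 2 * prime_cos_sum \<sigma> 0" if \<sigma>: "\<sigma> \<in> {1<..2}" for \<sigma>
    proof -
      have s1: "\<sigma> > 1" using \<sigma> by simp
      have "(\<lambda>p. \<Sum>i\<in>I. \<Sum>j\<in>I. c i * c j * cos_term \<sigma> (l i - l j) p) sums
         (\<Sum>i\<in>I. \<Sum>j\<in>I. c i * c j * prime_cos_sum \<sigma> (l i - l j))"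
        by (intro sums_sum sums_mult prime_cos_sum_sums s1)
      also have "(\<lambda>p. \<Sum>i\<in>I. \<Sum>j\<in>I. c i * c j * cos_term \<sigma> (l i - l j) p) =
        (\<lambda>p. if prime p then real p powr (-\<sigma>) * F (ln p) else 0)"
        unfolding F by (auto simp: sum_distrib_left mult_ac)
      finally have FS: "(\<lambda>p. if prime p then real p powr (-\<sigma>) * F (ln p) else 0) sums
         (\<Sum>i\<in>I. \<Sum>j\<in>I. c i * c j * prime_cos_sum \<sigma> (l i - l j))" .
      have "c0 * prime_cos_sum \<sigma> 0 - D' = (\<Sum>i\<in>I. \<Sum>j\<in>I. (if l i = l j then c i * c j else 0) * prime_cos_sum \<sigma> 0 - D i j)"
        by (simp add: c0_def D'_def sum_subtractf sum_distrib_right)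
      also have "\<dots> \<le> (\<Sum>i\<in>I. \<Sum>j\<in>I. c i * c j * prime_cos_sum \<sigma> (l i - l j))"
      proof (intro sum_mono)
        fix i j
        show "(if l i = l j then c i * c j else 0) * prime_cos_sum \<sigma> 0 - D i j \<le> c i * c j * prime_cos_sum \<sigma> (l i - l j)"
          using D[OF \<sigma>, of i j] by (auto split: if_splits)
      qed
      finally have lower: "c0 * prime_cos_sum \<sigma> 0 - D' \<le> (\<Sum>i\<in>I. \<Sum>j\<in>I. c i * c j * prime_cos_sum \<sigma> (l i - l j))" .
      define G where "G = (\<lambda>p. if prime p \<and> norm (E (ln (real p))) \<ge> \<delta> then real p powr (-\<sigma>) else 0)"
      have Gs: "summable G"
        unfolding G_def
        by (rule summable_comparison_test'[OF summable_prime_powr[OF s1], of 0]) auto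
      have upper: "(\<lambda>p. Fmax * G p + c0 / 2 * cos_term \<sigma> 0 p) sums
         (Fmax * suminf G + c0 / 2 * prime_cos_sum \<sigma> 0)"
        by (intro sums_add sums_mult prime_cos_sum_sums s1 summable_sums Gs)
      have "(\<Sum>i\<in>I. \<Sum>j\<in>I. c i * c j * prime_cos_sum \<sigma> (l i - l j)) \<le> Fmax * suminf G + c0 / 2 * prime_cos_sum \<sigma> 0"
      proof (rule sums_le[OF _ FS upper])
        fix p
        show "(if prime p then real p powr (-\<sigma>) * F (ln p) else 0) \<le>
          Fmax * G p + c0 / 2 * cos_term \<sigma> 0 p"
        proof (cases "prime p")
          case True
          show ?thesis
          proof (cases "norm (E (ln (real p))) \<ge> \<delta>")
            case good: True
            have "real p powr (-\<sigma>) * F (ln p) \<le> real p powr (-\<sigma>) * Fmax" using Fmax by (intro mult_left_mono) auto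
            moreover have "0 \<le> c0 / 2 * real p powr (-\<sigma>)" using c0 by simp
            ultimately have "real p powr (-\<sigma>) * F (ln p) \<le> Fmax * real p powr (-\<sigma>) + c0 / 2 * real p powr (-\<sigma>)"
              by argo
            then show ?thesis using True good by (simp add: G_def)
          next
            case False
            then have "F (ln p) \<le> \<delta>\<^sup>2" unfolding F_def by (intro power_mono) auto
            then have "real p powr (-\<sigma>) * F (ln p) \<le> real p powr (-\<sigma>) * (c0 / 2)" using \<delta> by (intro mult_left_mono) auto
            then have "real p powr (-\<sigma>) * F (ln p) \<le> c0 / 2 * real p powr (-\<sigma>)" by argo
            then show ?thesis using True False by (simp add: G_def)
          qed
        qed (simp add: G_def)
      qed
      moreover have "suminf G \<le> B" unfolding G_def B_def by (rule prime_powr_sum_le_reciprocal_sum[OF sm s1])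
      then have "Fmax * suminf G \<le> Fmax * B" using Fmax by (intro mult_left_mono) auto
      ultimately show ?thesis using lower by linarith
    qed
    obtain \<sigma> where \<sigma>: "\<sigma> \<in> {1<..2}" "prime_cos_sum \<sigma> 0 > (Fmax * B + D') / (c0 / 2)"
      using prime_cos_sum_0_unbounded by blast
    then have "c0 / 2 * prime_cos_sum \<sigma> 0 > Fmax * B + D'" using c0 by (simp add: field_simps)
    then show False using main[OF \<sigma>(1)] by linarith
  qed
qed

section \<open>Euler products of prime polynomials\<close>

text \<open>A triple \<open>(e, k, c)\<close> with \<open>e = \<plusminus>1\<close> encodes the term \<open>e * p powr (c - k * s)\<close>.\<close>

type_synonym pterm = "complex \<times> nat \<times> complex"

definition pdegree :: "pterm \<Rightarrow> nat" where "pdegree x = fst (snd x)"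

abbreviation term_freq :: "pterm \<Rightarrow> complex \<Rightarrow> complex" where
  "term_freq x s \<equiv> snd (snd x) - of_nat (pdegree x) * s"

definition prime_term :: "pterm \<Rightarrow> nat \<Rightarrow> complex \<Rightarrow> complex" where
  "prime_term x p s = fst x * of_nat p powr term_freq x s"

definition prime_poly :: "pterm list \<Rightarrow> nat \<Rightarrow> complex \<Rightarrow> complex" where
  "prime_poly L p s = 1 + (\<Sum>x\<leftarrow>L. prime_term x p s)"

text \<open>The sign is built in because multiplying by \<open>1 - x\<close> creates only negated
  products.\<close>

definition neg_mult :: "pterm \<Rightarrow> pterm \<Rightarrow> pterm" where
  "neg_mult x y = (- (fst x * fst y), pdegree x + pdegree y, snd (snd x) + snd (snd y))"

text \<open>Coefficients of modulus 1 with real sign are what makes each eliminating factor a zeta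
  quotient. The set \<open>W\<close> records which pairs of degree and exponent may occur; its size
  later bounds the number of zeta functions involved.\<close>

definition admissible_term :: "(nat \<times> complex) set \<Rightarrow> nat \<Rightarrow> pterm \<Rightarrow> bool" where
  "admissible_term W d x \<longleftrightarrow> (fst x = 1 \<or> fst x = -1) \<and> d \<le> pdegree x \<and> snd x \<in> W"

abbreviation admissible :: "(nat \<times> complex) set \<Rightarrow> nat \<Rightarrow> pterm list \<Rightarrow> bool" where
  "admissible W d L \<equiv> (\<forall>x\<in>set L. admissible_term W d x)"

definition add_closed :: "(nat \<times> complex) set \<Rightarrow> bool" where
  "add_closed W \<longleftrightarrow> (\<forall>x\<in>W. \<forall>y\<in>W. (fst x + fst y, snd x + snd y) \<in> W)"

lemma prime_term_neg_mult:
  assumes "p > 0" shows "prime_term (neg_mult x y) p s = - (prime_term x p s * prime_term y p s)"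
proof -
  have eq: "snd (snd x) + snd (snd y) - of_nat (pdegree x + pdegree y) * s =
    term_freq x s + (snd (snd y) - of_nat (pdegree y) * s)"
    by (simp add: algebra_simps)
  have "prime_term (neg_mult x y) p s =
    - (fst x * fst y) * of_nat p powr (snd (snd x) + snd (snd y) - of_nat (pdegree x + pdegree y) * s)"
    by (simp add: prime_term_def neg_mult_def pdegree_def)
  then show ?thesis unfolding eq powr_add prime_term_def by simp
qed

text \<open>
  The identity is \<open>(1 + x + B) * (1 - x) = 1 - x\<^sup>2 + B - x * B\<close>: a term \<open>x\<close> of degree \<open>d\<close> is traded for
  terms of degree at least \<open>2 * d\<close>, and no coefficient other than \<open>\<plusminus>1\<close> arises.
\<close>

lemma prime_poly_times:
  assumes "p > 0"
  shows "prime_poly (A @ x # B) p s * (1 - prime_term x p s) =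
    prime_poly (A @ B @ neg_mult x x # map (neg_mult x) (A @ B)) p s"
proof -
  have "(\<Sum>y\<leftarrow>map (neg_mult x) C. prime_term y p s) = - prime_term x p s * (\<Sum>y\<leftarrow>C. prime_term y p s)" for C
    by (induction C) (simp_all add: prime_term_neg_mult[OF assms] algebra_simps)
  then show ?thesis by (simp add: prime_poly_def prime_term_neg_mult[OF assms] algebra_simps)
qed

lemma admissible_term_mono: "admissible_term W d x \<Longrightarrow> d' \<le> d \<Longrightarrow> admissible_term W d' x"
  by (simp add: admissible_term_def)

lemma admissible_neg_mult:
  assumes "add_closed W" "admissible_term W d x" "admissible_term W d y"
  shows "admissible_term W (2 * d) (neg_mult x y)"
  using assms unfolding admissible_term_def add_closed_def neg_mult_def pdegree_def by auto

abbreviation elim_factor :: "pterm list \<Rightarrow> nat \<Rightarrow> complex \<Rightarrow> complex" where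
  "elim_factor J p s \<equiv> (\<Prod>x\<leftarrow>J. 1 - prime_term x p s)"

text \<open>Each multiplication by \<open>1 - x\<close> removes one term of degree \<open>d\<close>
  and adds terms of degree at least \<open>2 * d\<close>, which exceeds \<open>d\<close>. Hence the
  number of terms of degree \<open>d\<close> drops by one per step.\<close>

lemma eliminate_degree:
  assumes W: "add_closed W" and "d > 0" and "admissible W d L"
  shows "\<exists>J M. admissible W d J \<and> (\<forall>x\<in>set J. pdegree x = d) \<and> admissible W (Suc d) M \<and>
    (\<forall>p>0. \<forall>s. prime_poly L p s * elim_factor J p s = prime_poly M p s)"
  using assms(3)
proof (induction "length (filter (\<lambda>x. pdegree x = d) L)" arbitrary: L)
  case 0
  then have "pdegree x \<noteq> d" if "x \<in> set L" for x using that by (auto simp: filter_empty_conv)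
  then have "admissible W (Suc d) L" using 0(2) by (auto simp: admissible_term_def le_Suc_eq Suc_le_eq order.strict_iff_order)
  then show ?case by (intro exI[of _ "[]"] exI[of _ L]) auto
next
  case (Suc m)
  then have "filter (\<lambda>x. pdegree x = d) L \<noteq> []" by (metis length_0_conv nat.distinct(1))
  then obtain x where "x \<in> set L" "pdegree x = d" by (auto simp: filter_empty_conv)
  then obtain A B where L: "L = A @ x # B" using split_list by metis
  let ?L = "A @ B @ neg_mult x x # map (neg_mult x) (A @ B)"
  have x: "admissible_term W d x" "admissible W d (A @ B)"
    using Suc.prems by (auto simp: L)
  have new: "admissible W (2 * d) (map (neg_mult x) (x # A @ B))"
    using admissible_neg_mult[OF W x(1)] x by auto
  have "2 * d > d" using \<open>d > 0\<close> by simp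
  have "filter (\<lambda>x. pdegree x = d) (map (neg_mult x) (x # A @ B)) = []"
    unfolding filter_empty_conv using new \<open>2 * d > d\<close> by (metis admissible_term_def not_less)
  then have "m = length (filter (\<lambda>x. pdegree x = d) ?L)"
    using Suc.hyps(2) \<open>pdegree x = d\<close> by (simp add: L split: if_splits)
  moreover have "admissible W d ?L"
  proof
    fix y assume "y \<in> set ?L"
    then have "y \<in> set (A @ B) \<or> y \<in> set (map (neg_mult x) (x # A @ B))" by auto
    then show "admissible_term W d y"
      using x(2) new admissible_term_mono[of W "2 * d" y d] \<open>2 * d > d\<close> by (metis less_imp_le)
  qed
  ultimately obtain J M where J: "admissible W d J" "\<forall>x\<in>set J. pdegree x = d" "admissible W (Suc d) M"
    "\<forall>p>0. \<forall>s. prime_poly ?L p s * elim_factor J p s = prime_poly M p s"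
    using Suc.hyps(1) by blast
  have "prime_poly L p s * elim_factor (x # J) p s = prime_poly M p s" if "p > 0" for p s
  proof -
    have "prime_poly L p s * elim_factor (x # J) p s =
      prime_poly ?L p s * elim_factor J p s"
      unfolding L prime_poly_times[OF that, symmetric] by (simp add: mult.assoc)
    also have "\<dots> = prime_poly M p s" using J(4) that by blast
    finally show ?thesis .
  qed
  moreover have "admissible W d (x # J)" using x J by simp
  ultimately show ?case using J \<open>pdegree x = d\<close> by (intro exI[of _ "x # J"] exI[of _ M]) auto
qed

lemma eliminate_up_to:
  assumes W: "add_closed W" and "admissible W 1 L"
  shows "\<exists>J M. admissible W 1 J \<and> (\<forall>x\<in>set J. pdegree x \<le> K) \<and> admissible W (Suc K) M \<and>
    (\<forall>p>0. \<forall>s. prime_poly L p s * elim_factor J p s = prime_poly M p s)"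
proof (induction K)
  case 0
  show ?case using assms by (intro exI[of _ "[]"] exI[of _ L]) auto
next
  case (Suc K)
  then obtain J M where J: "admissible W 1 J" "\<forall>x\<in>set J. pdegree x \<le> K" "admissible W (Suc K) M"
    "\<forall>p>0. \<forall>s. prime_poly L p s * elim_factor J p s = prime_poly M p s" by blast
  obtain J' M' where J': "admissible W (Suc K) J'" "\<forall>x\<in>set J'. pdegree x = Suc K" "admissible W (Suc (Suc K)) M'"
    "\<forall>p>0. \<forall>s. prime_poly M p s * elim_factor J' p s = prime_poly M' p s"
    using eliminate_degree[OF W _ J(3)] by blast
  have "prime_poly L p s * elim_factor (J @ J') p s = prime_poly M' p s" if "p > 0" for p s
    using J(4) J'(4) that by (simp add: mult.assoc[symmetric])
  moreover have "admissible W 1 (J @ J')" using J J'(1) admissible_term_mono[of W "Suc K" _ 1] by auto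
  ultimately show ?case using J J' by (intro exI[of _ "J @ J'"] exI[of _ M']) (auto simp: le_SucI)
qed

abbreviation prime_zeros :: "pterm list \<Rightarrow> complex \<Rightarrow> nat set" where
  "prime_zeros L s \<equiv> {p. prime p \<and> prime_poly L p s = 0}"

abbreviation euler_term :: "pterm list \<Rightarrow> complex \<Rightarrow> nat \<Rightarrow> complex" where
  "euler_term L s p \<equiv> if prime p then prime_poly L p s else 1"

definition euler_prod :: "pterm list \<Rightarrow> complex \<Rightarrow> complex" where
  "euler_prod L s = (\<Prod>p. euler_term L s p)"

definition imaginary_exponents :: "(nat \<times> complex) set \<Rightarrow> bool" where
  "imaginary_exponents W \<longleftrightarrow> (\<forall>x\<in>W. Re (snd x) = 0)"

lemma norm_prime_term:
  assumes "p > 0" "admissible_term W d x" "imaginary_exponents W"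
  shows "norm (prime_term x p s) = real p powr (- (real (pdegree x) * Re s))"
proof -
  have "norm (fst x) = 1" "Re (snd (snd x)) = 0"
    using assms(2,3) by (auto simp: admissible_term_def imaginary_exponents_def)
  then show ?thesis using assms by (simp add: prime_term_def norm_mult norm_of_nat_powr)
qed

lemma norm_prime_term_le:
  assumes "p > 0" "admissible_term W d x" "imaginary_exponents W" "Re s \<ge> 0"
  shows "norm (prime_term x p s) \<le> real p powr (- (real d * Re s))"
  unfolding norm_prime_term[OF assms(1-3)]
  using assms by (intro powr_mono) (auto intro: mult_right_mono simp: admissible_term_def)

lemma norm_prime_poly_minus_1:
  assumes "p > 0" "admissible W d L" "imaginary_exponents W" "Re s \<ge> 0"
  shows "norm (prime_poly L p s - 1) \<le> real (length L) * real p powr (- (real d * Re s))"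
proof -
  have "norm (prime_poly L p s - 1) = norm (\<Sum>x\<leftarrow>L. prime_term x p s)" by (simp add: prime_poly_def)
  also have "\<dots> \<le> (\<Sum>x\<leftarrow>L. norm (prime_term x p s))"
    by (induction L) (auto intro: order_trans[OF norm_triangle_ineq])
  also have "\<dots> \<le> (\<Sum>x\<leftarrow>L. real p powr (- (real d * Re s)))"
    by (intro sum_list_mono norm_prime_term_le[OF assms(1) _ assms(3)]) (use assms in auto)
  finally show ?thesis by (simp add: sum_list_triv)
qed

lemma prime_term_holomorphic: "p > 0 \<Longrightarrow> prime_term x p holomorphic_on A"
  unfolding prime_term_def by (auto intro!: holomorphic_intros)

lemma prime_poly_holomorphic: "p > 0 \<Longrightarrow> prime_poly L p holomorphic_on A"
proof -
  assume p: "p > 0"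
  have "(\<lambda>s. \<Sum>x\<leftarrow>L. prime_term x p s) holomorphic_on A"
    by (induction L) (auto intro!: holomorphic_intros prime_term_holomorphic[OF p])
  then show ?thesis unfolding prime_poly_def[abs_def] by (intro holomorphic_intros)
qed

lemma convergent_prime_poly:
  assumes "admissible W d L" "imaginary_exponents W" "real d * Re s > 1"
  shows "abs_convergent_prod (euler_term L s)"
    "convergent_prod (euler_term L s)"
proof -
  have s: "Re s \<ge> 0" using assms(3) by (smt (verit) mult_nonneg_nonpos of_nat_0_le_iff)
  have "norm (euler_term L s p - 1) \<le> real (length L) * real p powr (- (real d * Re s))"
    if "prime p" for p
    using norm_prime_poly_minus_1[OF _ assms(1,2) s] prime_gt_0_nat[OF that] that by simp
  from convergent_prod_prime_type[OF assms(3) this]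
  show "abs_convergent_prod (euler_term L s)"
    "convergent_prod (euler_term L s)" by auto
qed

lemma euler_prod_holomorphic:
  assumes "admissible W d L" "imaginary_exponents W" "d > 0"
  shows "euler_prod L holomorphic_on {s. Re s > 1 / real d}"
  unfolding euler_prod_def[abs_def]
proof (rule holomorphic_on_prodinf[OF open_halfspace_Re_gt])
  show "(\<lambda>s. euler_term L s p) holomorphic_on {s. Re s > 1 / real d}" for p
    by (cases "prime p") (auto intro: prime_poly_holomorphic prime_gt_0_nat)
  fix x assume "x \<in> {s. Re s > 1 / real d}"
  then obtain \<sigma> where \<sigma>: "1 / real d < \<sigma>" "\<sigma> < Re x" using dense by auto
  then have \<sigma>1: "real d * \<sigma> > 1" using assms(3) by (simp add: field_simps)
  have "\<sigma> > 0" using \<sigma>(1) assms(3) by (smt (verit) divide_pos_pos of_nat_0_less_iff)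
  show "\<exists>U M. open U \<and> x \<in> U \<and> summable M \<and> (\<forall>p. \<forall>s\<in>U \<inter> {s. Re s > 1 / real d}.
      norm (euler_term L s p - 1) \<le> M p)"
  proof (intro exI conjI allI ballI)
    show "open {s. Re s > \<sigma>}" by (rule open_halfspace_Re_gt)
    show "x \<in> {s. Re s > \<sigma>}" using \<sigma> by simp
    show "summable (\<lambda>p. real (length L) * real p powr (- (real d * \<sigma>)))"
      by (intro summable_mult summable_prime_powr \<sigma>1)
    fix p s assume s: "s \<in> {s. Re s > \<sigma>} \<inter> {s. Re s > 1 / real d}"
    show "norm (euler_term L s p - 1) \<le> real (length L) * real p powr (- (real d * \<sigma>))"
    proof (cases "prime p")
      case True
      then have p: "p > 0" by (rule prime_gt_0_nat)
      have "norm (prime_poly L p s - 1) \<le> real (length L) * real p powr (- (real d * Re s))"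
        by (rule norm_prime_poly_minus_1[OF p assms(1,2)]) (use s \<open>\<sigma> > 0\<close> in auto)
      also have "\<dots> \<le> real (length L) * real p powr (- (real d * \<sigma>))"
        using s p by (intro mult_left_mono powr_mono) (auto intro: mult_left_mono)
      finally show ?thesis using True by simp
    qed simp
  qed
qed

lemma prime_poly_nonzero:
  assumes "p > 0" "admissible W d L" "imaginary_exponents W" "Re s \<ge> 0"
    and "real (length L) * real p powr (- (real d * Re s)) < 1"
  shows "prime_poly L p s \<noteq> 0"
  using norm_prime_poly_minus_1[OF assms(1-4)] assms(5) by auto

lemma euler_prod_eq_0_iff:
  assumes "admissible W d L" "imaginary_exponents W" "real d * Re s > 1"
  shows "euler_prod L s = 0 \<longleftrightarrow> (\<exists>p. prime p \<and> prime_poly L p s = 0)"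
proof -
  have "(euler_term L s) has_prod euler_prod L s"
    unfolding euler_prod_def using convergent_prime_poly(2)[OF assms] by (rule convergent_prod_has_prod)
  from has_prod_eq_0_iff[OF this] show ?thesis by auto
qed

text \<open>Guarantees that the product is not identically zero, so that its zeros in a denominator
  are isolated and produce poles.\<close>

lemma euler_prod_nonzero_ex:
  assumes "admissible W d L" "imaginary_exponents W" "d > 0"
  shows "\<exists>s. Re s > 1 / real d \<and> euler_prod L s \<noteq> 0"
proof -
  define N where "N = real (length L) + 2"
  have N: "N \<ge> 2" by (simp add: N_def)
  \<comment> \<open>Chosen so that \<open>2 powr (-\<sigma>) = exp (-N)\<close>; since
    \<open>N * exp (-N) < 1\<close>, no local polynomial can vanish at
    \<open>\<sigma>\<close>.\<close>
  define \<sigma> where "\<sigma> = N / ln 2"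
  have l2: "ln (2::real) > 0" "ln (2::real) < 1" using ln_2_less_1 by auto
  have "2 * ln 2 \<le> N" using N l2 by linarith
  then have \<sigma>: "\<sigma> \<ge> 2" using l2 by (simp add: \<sigma>_def pos_le_divide_eq)
  have d1: "1 / real d \<le> 1" "real d \<ge> 1" using assms(3) by auto
  have "real d * \<sigma> \<ge> 1 * 2" using \<sigma> d1 by (intro mult_mono) auto
  then have d\<sigma>: "real d * Re (of_real \<sigma>) > 1" by simp
  have "prime_poly L p (of_real \<sigma>) \<noteq> 0" if "prime p" for p
  proof (rule prime_poly_nonzero[OF _ assms(1,2)])
    have p: "p \<ge> 2" using prime_ge_2_nat[OF that] .
    have "real p powr (- (real d * Re (of_real \<sigma>))) \<le> real p powr (- \<sigma>)"
      using p d1 \<sigma> by (intro powr_mono) auto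
    also have "\<dots> \<le> 2 powr (- \<sigma>)" using p \<sigma> by (intro powr_mono2') auto
    also have "\<dots> = exp (- N)" using l2 by (simp add: powr_def \<sigma>_def)
    finally have *: "real p powr (- (real d * Re (of_real \<sigma>))) \<le> exp (- N)" .
    have "N < exp N" using exp_ge_add_one_self[of N] by linarith
    then have "N * exp (- N) < 1" by (simp add: exp_minus field_simps)
    moreover have "real (length L) * real p powr (- (real d * Re (of_real \<sigma>))) \<le> N * exp (- N)"
      using * by (intro mult_mono) (auto simp: N_def)
    ultimately show "real (length L) * real p powr (- (real d * Re (of_real \<sigma>))) < 1" by linarith
    show "p > 0" using p by simp
    show "0 \<le> Re (complex_of_real \<sigma>)" using \<sigma> by simp
  qed
  then have "euler_prod L (of_real \<sigma>) \<noteq> 0" using euler_prod_eq_0_iff[OF assms(1,2) d\<sigma>] by auto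
  moreover have "1 / real d < \<sigma>" using d1(1) \<sigma> by linarith
  then have "Re (of_real \<sigma>) > 1 / real d" by simp
  ultimately show ?thesis by blast
qed

section \<open>Zeta quotients for the eliminating factors and the continuation to Re s > 0\<close>

definition term_arg :: "nat \<times> complex \<Rightarrow> complex \<Rightarrow> complex" where
  "term_arg y s = of_nat (fst y) * s - snd y"

text \<open>With \<open>w = term_arg (snd x) s\<close> these are the products over all primes of
  \<open>1 - p powr (-w)\<close> and \<open>1 + p powr (-w)\<close>, the latter from
  \<open>1 + T = (1 - T^2) / (1 - T)\<close>.\<close>

definition term_factor :: "pterm \<Rightarrow> complex \<Rightarrow> complex" where
  "term_factor x s = (if fst x = 1 then inverse (riemann_zeta (term_arg (snd x) s))
     else riemann_zeta (term_arg (snd x) s) / riemann_zeta (2 * term_arg (snd x) s))"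

lemma prime_term_eq: "prime_term x p s = fst x * of_nat p powr (- term_arg (snd x) s)"
  by (simp add: prime_term_def term_arg_def pdegree_def)

lemma term_factor_has_prod:
  assumes "admissible_term W 1 x" "imaginary_exponents W" "Re s > 1"
  shows "(\<lambda>p. if prime p then 1 - prime_term x p s else 1) has_prod term_factor x s" "term_factor x s \<noteq> 0"
proof -
  let ?w = "term_arg (snd x) s"
  have k: "pdegree x \<ge> 1" "Re (snd (snd x)) = 0" "fst x = 1 \<or> fst x = -1"
    using assms by (auto simp: admissible_term_def imaginary_exponents_def)
  have "real (pdegree x) * Re s \<ge> 1 * Re s" using k(1) assms by (intro mult_right_mono) auto
  then have "real (pdegree x) * Re s > 1" using assms(3) by linarith
  moreover have "Re ?w = real (pdegree x) * Re s" using k(2) by (simp add: term_arg_def pdegree_def)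
  ultimately have w: "Re ?w > 1" "Re (2 * ?w) > 1" by simp_all
  have z: "zeta_factor ?w has_prod inverse (riemann_zeta ?w)" "riemann_zeta ?w \<noteq> 0"
    "zeta_factor (2 * ?w) has_prod inverse (riemann_zeta (2 * ?w))" "riemann_zeta (2 * ?w) \<noteq> 0"
    using Euler_product[OF w(1)] Euler_product[OF w(2)] w by (auto simp: riemann_zeta_eq_dirichlet)
  then show "term_factor x s \<noteq> 0" by (auto simp: term_factor_def)
  show "(\<lambda>p. if prime p then 1 - prime_term x p s else 1) has_prod term_factor x s"
  proof (cases "fst x = 1")
    case True
    have "(\<lambda>p. if prime p then 1 - prime_term x p s else 1) = zeta_factor ?w"
      by (auto simp: prime_term_eq True zeta_factor_def)
    then show ?thesis using z True by (simp add: term_factor_def)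
  next
    case False
    then have e: "fst x = -1" using k by auto
    have "(if prime p then 1 - prime_term x p s else 1) = zeta_factor (2 * ?w) p / zeta_factor ?w p" for p
    proof -
      have "zeta_factor ?w p \<noteq> 0" using w(1) by (intro zeta_factor_nonzero) auto
      moreover have "of_nat p powr (- (2 * ?w)) = (of_nat p powr (- ?w))\<^sup>2"
        by (simp add: power2_eq_square powr_add[symmetric])
      then have "(1 + of_nat p powr (- ?w)) * (1 - of_nat p powr (- ?w)) = 1 - of_nat p powr (- (2 * ?w))"
        by (simp add: power2_eq_square algebra_simps)
      ultimately show ?thesis by (auto simp: prime_term_eq e zeta_factor_def eq_divide_eq)
    qed
    then show ?thesis using has_prod_divide[OF z(3) z(1)] False by (simp add: term_factor_def divide_inverse mult.commute)
  qed
qed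

definition zeta_regular :: "complex \<Rightarrow> bool" where
  "zeta_regular w \<longleftrightarrow> w \<noteq> 1 \<and> zeta_num w \<noteq> 0"

lemma zeta_compose_affine:
  fixes a c :: complex
  shows "(\<lambda>s. riemann_zeta (a * s - c)) meromorphic_on A"
    and "zeta_regular (a * s0 - c) \<Longrightarrow> (\<lambda>s. riemann_zeta (a * s - c)) analytic_on {s0}"
    and "zeta_regular w \<Longrightarrow> riemann_zeta w \<noteq> 0"
proof -
  have "(zeta_num \<circ> (\<lambda>s. a * s - c)) holomorphic_on UNIV"
    by (intro holomorphic_on_compose holomorphic_on_subset[OF zeta_num_holomorphic] holomorphic_intros) auto
  then have "(\<lambda>s. zeta_num (a * s - c)) holomorphic_on UNIV" by (simp add: o_def)
  then have an: "(\<lambda>s. zeta_num (a * s - c)) analytic_on B" for B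
    using analytic_on_open analytic_on_subset open_UNIV subset_UNIV by blast
  show "(\<lambda>s. riemann_zeta (a * s - c)) meromorphic_on A"
    unfolding riemann_zeta_eq by (intro meromorphic_intros analytic_on_imp_meromorphic_on[OF an])
  show "(\<lambda>s. riemann_zeta (a * s - c)) analytic_on {s0}" if "zeta_regular (a * s0 - c)"
    unfolding riemann_zeta_eq using that by (intro analytic_intros an) (auto simp: zeta_regular_def)
  show "riemann_zeta w \<noteq> 0" if "zeta_regular w" using that by (simp add: zeta_regular_def riemann_zeta_eq)
qed

lemma term_factor_meromorphic: "term_factor x meromorphic_on A"
proof -
  have 1: "(\<lambda>s. riemann_zeta (term_arg (snd x) s)) meromorphic_on A"
    unfolding term_arg_def by (rule zeta_compose_affine)
  have 2: "(\<lambda>s. riemann_zeta (2 * term_arg (snd x) s)) meromorphic_on A"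
    using zeta_compose_affine(1)[of "2 * of_nat (fst (snd x))" "2 * snd (snd x)" A]
    by (simp add: term_arg_def algebra_simps)
  show ?thesis unfolding term_factor_def[abs_def]
    by (cases "fst x = 1") (auto intro!: meromorphic_intros 1 2)
qed

lemma term_factor_regular:
  assumes "zeta_regular (term_arg (snd x) s)" "zeta_regular (2 * term_arg (snd x) s)"
  shows "term_factor x analytic_on {s}" "term_factor x s \<noteq> 0"
proof -
  have 1: "(\<lambda>s. riemann_zeta (term_arg (snd x) s)) analytic_on {s}"
    unfolding term_arg_def by (rule zeta_compose_affine(2)) (use assms in \<open>simp add: term_arg_def\<close>)
  have 2: "(\<lambda>s. riemann_zeta (2 * term_arg (snd x) s)) analytic_on {s}"
    using zeta_compose_affine(2)[of "2 * of_nat (fst (snd x))" s "2 * snd (snd x)"] assms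
    by (simp add: term_arg_def algebra_simps)
  note nz = assms[THEN zeta_compose_affine(3)]
  show "term_factor x s \<noteq> 0" using nz by (simp add: term_factor_def)
  show "term_factor x analytic_on {s}" unfolding term_factor_def[abs_def]
    by (cases "fst x = 1") (auto intro!: analytic_intros 1 2 nz)
qed

lemma has_prod_prod_list:
  fixes f :: "'a \<Rightarrow> nat \<Rightarrow> complex"
  assumes "\<And>x. x \<in> set J \<Longrightarrow> f x has_prod v x"
  shows "(\<lambda>p. \<Prod>x\<leftarrow>J. f x p) has_prod (\<Prod>x\<leftarrow>J. v x)"
  using assms by (induction J) (auto intro!: has_prod_mult)

text \<open>The left-hand side remains meaningful as long as the product for \<open>M\<close>
  converges. Beyond \<open>Re s > 1\<close> it becomes the definition of the continuation.\<close>

lemma euler_prod_factorization: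
  assumes L: "admissible W 1 L" "imaginary_exponents W" and J: "admissible W 1 J" and "Re s > 1"
    and eq: "\<And>p. p > 0 \<Longrightarrow> prime_poly L p s * elim_factor J p s = prime_poly M p s"
  shows "(\<Prod>x\<leftarrow>J. term_factor x s) / euler_prod M s = inverse (euler_prod L s)"
proof -
  have conv: "convergent_prod (euler_term L s)"
    using convergent_prime_poly(2)[OF L] assms by simp
  have P: "(\<lambda>p. \<Prod>x\<leftarrow>J. if prime p then 1 - prime_term x p s else 1) has_prod (\<Prod>x\<leftarrow>J. term_factor x s)"
    by (rule has_prod_prod_list, rule term_factor_has_prod(1)[OF _ L(2)]) (use assms in auto)
  have "(\<lambda>p. euler_term L s p * (\<Prod>x\<leftarrow>J. if prime p then 1 - prime_term x p s else 1))
     has_prod (euler_prod L s * (\<Prod>x\<leftarrow>J. term_factor x s))"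
    unfolding euler_prod_def by (intro has_prod_mult P convergent_prod_has_prod conv)
  also have "(\<lambda>p. euler_term L s p * (\<Prod>x\<leftarrow>J. if prime p then 1 - prime_term x p s else 1)) =
     euler_term M s"
    by (auto simp: fun_eq_iff eq prime_gt_0_nat map_replicate_const)
  finally have "euler_prod M s = euler_prod L s * (\<Prod>x\<leftarrow>J. term_factor x s)"
    unfolding euler_prod_def[of M] by (rule has_prod_unique[symmetric])
  moreover have "(\<Prod>x\<leftarrow>J. term_factor x s) \<noteq> 0"
    using term_factor_has_prod(2)[OF _ L(2) \<open>Re s > 1\<close>] J by (auto simp: prod_list_zero_iff)
  ultimately show ?thesis by (simp add: field_simps)
qed

lemma is_pole_divide_zero:
  assumes "f analytic_on {z}" "f z \<noteq> 0" "open S" "connected S" "z \<in> S" "h holomorphic_on S" "h z = 0" "\<exists>w\<in>S. h w \<noteq> 0"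
  shows "is_pole (\<lambda>s. f s / h s) z"
proof (rule is_pole_divide)
  show "isCont f z" by (rule analytic_at_imp_isCont) fact
  have "isCont h z" using assms holomorphic_on_imp_continuous_on continuous_on_eq_continuous_at by blast
  then have "(h \<longlongrightarrow> 0) (at z)" using assms by (simp add: isCont_def)
  moreover have "eventually (\<lambda>w. h w \<noteq> 0) (at z)"
    using non_zero_neighbour_alt[of h S z] assms by (metis (mono_tags, lifting) eventually_mono)
  ultimately show "filterlim h (at 0) (at z)" by (simp add: filterlim_at)
qed (use assms in auto)

lemma analytic_on_prod_list:
  fixes f :: "'a \<Rightarrow> complex \<Rightarrow> complex"
  assumes "\<And>x. x \<in> set J \<Longrightarrow> f x analytic_on A"
  shows "(\<lambda>s. \<Prod>x\<leftarrow>J. f x s) analytic_on A"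
  using assms by (induction J) (auto intro!: analytic_intros)

text \<open>The doubled argument comes from the denominator of
  \<open>zeta(w) / zeta(2 w)\<close>.\<close>

abbreviation regular_at :: "nat \<times> complex \<Rightarrow> complex \<Rightarrow> bool" where
  "regular_at y s \<equiv> zeta_regular (term_arg y s) \<and> zeta_regular (2 * term_arg y s)"

text \<open>Regularity is asked for every pair in \<open>W\<close> of degree at most
  \<open>K\<close>, not just for the pairs that the elimination really produces. The statement thus
  does not mention the eliminating factors, and only \<open>W\<close> has to be counted.\<close>

definition poles_at_prime_zeros :: "(nat \<times> complex) set \<Rightarrow> pterm list \<Rightarrow> (complex \<Rightarrow> complex) \<Rightarrow> bool" where
  "poles_at_prime_zeros W L g \<longleftrightarrow> (\<forall>K p s. Re s > 1 / real (Suc K) \<longrightarrow> prime p \<longrightarrow> prime_poly L p s = 0 \<longrightarrow>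
     (\<forall>y\<in>W. 1 \<le> fst y \<longrightarrow> fst y \<le> K \<longrightarrow> regular_at y s) \<longrightarrow>
     is_pole g s)"

lemma euler_prod_continuation:
  assumes W: "add_closed W" "imaginary_exponents W" and L: "admissible W 1 L"
  obtains g where "g meromorphic_on {s. Re s > 0}"
    and "\<forall>\<^sub>\<approx>s\<in>{s. Re s > 1}. g s = inverse (euler_prod L s)"
    and "poles_at_prime_zeros W L g"
proof -
  obtain J M where JM: "\<And>K. admissible W 1 (J K)" "\<And>K x. x \<in> set (J K) \<Longrightarrow> pdegree x \<le> K" "\<And>K. admissible W (Suc K) (M K)"
    "\<And>K p s. p > 0 \<Longrightarrow> prime_poly L p s * elim_factor (J K) p s = prime_poly (M K) p s"
    using eliminate_up_to[OF W(1) L] by metis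
  define H where "H = (\<lambda>K. {s. Re s > 1 / real (Suc K)})"
  have H: "open (H K)" "connected (H K)" for K
    unfolding H_def by (rule open_halfspace_Re_gt, rule connected_halfplane_Re)
  have le1: "1 / real (Suc K) \<le> 1" for K by simp
  have in_H: "s \<in> H K" if "Re s > 1" for s K
    unfolding H_def using le_less_trans[OF le1[of K] that] by blast
  have hol: "euler_prod (M K) holomorphic_on H K" for K
    unfolding H_def by (rule euler_prod_holomorphic[OF JM(3) W(2)]) auto
  define G where "G = (\<lambda>K s. (\<Prod>x\<leftarrow>J K. term_factor x s) / euler_prod (M K) s)"
  have numer: "(\<lambda>s. \<Prod>x\<leftarrow>J K. term_factor x s) meromorphic_on A" for K A
    by (intro meromorphic_intros term_factor_meromorphic)
  have mero: "G K meromorphic_on H K" for K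
    unfolding G_def
    by (intro meromorphic_intros numer analytic_on_imp_meromorphic_on) (simp add: analytic_on_open H hol)
  have eq1: "G K s = inverse (euler_prod L s)" if "Re s > 1" for K s
    unfolding G_def by (rule euler_prod_factorization[OF L W(2) JM(1) that]) (use JM(4) in blast)
  \<comment> \<open>The quotients \<open>G K\<close> for different \<open>K\<close> agree only
    outside discrete sets. Normalising the values makes them agree everywhere, so they can be glued
    pointwise.\<close>
  define N where "N = (\<lambda>K. remove_sings (G K))"
  have N: "N K nicely_meromorphic_on H K" for K unfolding N_def by (rule remove_sings_nicely_meromorphic[OF mero])
  have NG: "eventually (\<lambda>s. N K s = G K s) (at z)" if "z \<in> H K" for K z
    using eventually_remove_sings_eq[OF mero, of K] H(1) that by (simp add: N_def eventually_cosparse_open_eq)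
  have NN: "N K s = N K' s" if "K \<le> K'" "s \<in> H K" for K K' s
  proof (rule nicely_meromorphic_eq[of "N K" "H K" "N K'" 2])
    have "1 / real (Suc K') \<le> 1 / real (Suc K)" using that(1) by (intro divide_left_mono) auto
    then have sub: "H K \<subseteq> H K'" unfolding H_def by (blast intro: le_less_trans)
    show "N K' nicely_meromorphic_on H K" by (rule nicely_meromorphic_on_subset[OF N sub])
    have "eventually (\<lambda>s. s \<in> {s. Re s > 1}) (at (2::complex))"
      by (rule eventually_at_in_open'[OF open_halfspace_Re_gt]) auto
    moreover have "eventually (\<lambda>s. N K s = G K s) (at 2)" "eventually (\<lambda>s. N K' s = G K' s) (at 2)"
      by (intro NG in_H; simp)+
    ultimately show "eventually (\<lambda>s. N K s = N K' s) (at 2)"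
      by eventually_elim (simp add: eq1)
    show "2 \<in> H K" by (rule in_H) simp
  qed (use that H N in auto)
  \<comment> \<open>The index is just large enough for \<open>s\<close> to lie in its half-plane
    \<open>H\<close>.\<close>
  define g where "g = (\<lambda>s. N (nat \<lceil>1 / Re s\<rceil>) s)"
  have gN: "g s = N K s" if "s \<in> H K" for s K
  proof -
    have "0 < 1 / real (Suc K)" by simp
    moreover have "1 / real (Suc K) < Re s" using that unfolding H_def by blast
    ultimately have "Re s > 0" by (rule less_trans)
    moreover have "1 / Re s < real (Suc (nat \<lceil>1 / Re s\<rceil>))" by linarith
    ultimately have "s \<in> H (nat \<lceil>1 / Re s\<rceil>)"
      unfolding H_def by (simp add: field_simps del: of_nat_Suc)
    then show ?thesis unfolding g_def using NN that by (metis nle_le)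
  qed
  have gG: "eventually (\<lambda>s. g s = G K s) (at z)" if "z \<in> H K" for K z
  proof -
    have "eventually (\<lambda>s. s \<in> H K) (at z)" by (rule eventually_at_in_open'[OF H(1) that])
    with NG[OF that] show ?thesis by eventually_elim (simp add: gN)
  qed
  have cover: "\<exists>K. z \<in> H K" if "Re z > 0" for z
  proof -
    obtain K where "real K > 1 / Re z" using reals_Archimedean2 by blast
    then have "1 / Re z < real (Suc K)" by simp
    then show ?thesis using that by (intro exI[of _ K]) (simp add: H_def field_simps del: of_nat_Suc)
  qed
  show thesis
  proof
    show "g meromorphic_on {s. Re s > 0}"
    proof (subst meromorphic_on_meromorphic_at, intro ballI)
      fix z assume "z \<in> {s. Re s > 0}"
      then obtain K where K: "z \<in> H K" using cover by auto
      have "G K meromorphic_on {z}" by (rule meromorphic_on_subset[OF mero]) (use K in auto)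
      then show "g meromorphic_on {z}"
        by (subst meromorphic_on_cong[of "{z}" g "G K" "{z}"]) (use gG[OF K] in auto)
    qed
    show "\<forall>\<^sub>\<approx>s\<in>{s. Re s > 1}. g s = inverse (euler_prod L s)"
    proof (subst eventually_cosparse_open_eq[OF open_halfspace_Re_gt], intro ballI)
      fix z :: complex assume z: "z \<in> {s. Re s > 1}"
      have "eventually (\<lambda>s. s \<in> {s. Re s > 1}) (at z)" by (rule eventually_at_in_open'[OF open_halfspace_Re_gt z])
      moreover have "eventually (\<lambda>s. g s = G 0 s) (at z)" by (rule gG[OF in_H]) (use z in auto)
      ultimately show "eventually (\<lambda>s. g s = inverse (euler_prod L s)) (at z)"
        by eventually_elim (simp add: eq1)
    qed
    show "poles_at_prime_zeros W L g"
      unfolding poles_at_prime_zeros_def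
    proof (intro allI impI)
      fix K p s
      assume s: "Re s > 1 / real (Suc K)" "prime p" "prime_poly L p s = 0"
        and reg: "\<forall>y\<in>W. 1 \<le> fst y \<longrightarrow> fst y \<le> K \<longrightarrow> regular_at y s"
      have sH: "s \<in> H K" using s by (simp add: H_def)
      \<comment> \<open>Only pairs of degree at most \<open>K\<close> were eliminated, so regularity
        keeps the numerator of \<open>G K\<close> finite and nonzero at \<open>s\<close>, while the
        local zero at \<open>p\<close> passes from \<open>L\<close> to \<open>M K\<close> and makes
        the denominator vanish.\<close>
      have reg': "zeta_regular (term_arg (snd x) s)" "zeta_regular (2 * term_arg (snd x) s)" if "x \<in> set (J K)" for x
        using reg JM(1)[of K] JM(2)[OF that] that by (auto simp: admissible_term_def pdegree_def)
      have "is_pole (G K) s" unfolding G_def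
      proof (rule is_pole_divide_zero[OF _ _ H(1) H(2) sH hol])
        show "(\<lambda>s. \<Prod>x\<leftarrow>J K. term_factor x s) analytic_on {s}"
          by (rule analytic_on_prod_list, rule term_factor_regular(1)[OF reg'])
        show "(\<Prod>x\<leftarrow>J K. term_factor x s) \<noteq> 0"
          using term_factor_regular(2)[OF reg'] by (auto simp: prod_list_zero_iff)
        have Ks: "real (Suc K) * Re s > 1" using s(1) by (simp add: field_simps)
        have "prime_poly (M K) p s = 0" using JM(4)[OF prime_gt_0_nat[OF s(2)], of s K] s(3) by simp
        then show "euler_prod (M K) s = 0" using euler_prod_eq_0_iff[OF JM(3) W(2) Ks] s(2) by auto
        show "\<exists>w\<in>H K. euler_prod (M K) w \<noteq> 0"
          using euler_prod_nonzero_ex[OF JM(3) W(2), of K] unfolding H_def by auto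
      qed
      then show "is_pole g s" using is_pole_cong[OF gG[OF sH] refl] by simp
    qed
  qed
qed

section \<open>Counting zeros\<close>

text \<open>Provides the lower bound at the centres of the Jensen discs. The constant
  \<open>3 * B\<close> is \<open>B\<close> for the prime sum plus \<open>2 * B\<close> for the error
  of the logarithm.\<close>

lemma zeta_num_lower_bound: "\<exists>m>0. \<forall>t. norm (zeta_num (Complex 2 t)) \<ge> m"
proof -
  define B where "B = (\<Sum>n. real n powr (-2))"
  have sm: "summable (\<lambda>n. real n powr (-2))" by (simp add: summable_real_powr_iff)
  show ?thesis
  proof (intro exI conjI allI)
    show "exp (- (3 * B)) > 0" by simp
    fix t
    have "norm (prime_cos_sum 2 t) \<le> B"
      unfolding prime_cos_sum_def B_def
    proof (rule norm_suminf_le[OF _ sm])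
      show "norm (if prime p then real p powr - 2 * cos (t * ln (real p)) else 0) \<le> real p powr - 2" for p
        using mult_left_mono[OF abs_cos_le_one, of "real p powr -2" "t * ln (real p)"] by (simp add: abs_mult)
    qed
    then have "ln (abs_zeta 2 t) \<ge> - (3 * B)"
      using ln_norm_dirichlet_zeta[of 2 t] unfolding B_def by simp
    moreover have "abs_zeta 2 t > 0" using Euler_product(2)[of "Complex 2 t"] by simp
    ultimately have "abs_zeta 2 t \<ge> exp (- (3 * B))" by (simp add: ln_ge_iff)
    also have "abs_zeta 2 t \<le> norm (zeta_num (Complex 2 t))"
    proof -
      have "norm (Complex 1 t) \<ge> 1" using abs_Re_le_cmod[of "Complex 1 t"] by simp
      moreover have "abs_zeta 2 t = norm (zeta_num (Complex 2 t)) / norm (Complex 1 t)"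
        using norm_dirichlet_zeta_eq[of 2 t] by simp
      moreover have "norm (zeta_num (Complex 2 t)) / norm (Complex 1 t) \<le> norm (zeta_num (Complex 2 t)) / 1"
        using \<open>norm (Complex 1 t) \<ge> 1\<close> by (intro divide_left_mono) auto
      ultimately show ?thesis by simp
    qed
    finally show "exp (- (3 * B)) \<le> norm (zeta_num (Complex 2 t))" .
  qed
qed

text \<open>The radius exceeds \<open>sqrt 5\<close>, so the disc covers the part of the strip
  \<open>0 \<le> Re v \<le> 1\<close> within height 1 of \<open>t\<close>. It is less than 3, the
  radius at which the growth bound for \<open>Re s \<ge> -1\<close> still applies.\<close>

abbreviation zeta_zeros :: "real \<Rightarrow> complex set" where
  "zeta_zeros t \<equiv> {v \<in> cball (Complex 2 t) (9/4). zeta_num v = 0}"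

lemma zeta_num_zeros_disc:
  "\<exists>C. \<forall>t. finite (zeta_zeros t) \<and>
     real (card (zeta_zeros t)) \<le> C * (1 + \<bar>t\<bar>)"
proof -
  obtain m where m: "m > 0" "\<And>t. norm (zeta_num (Complex 2 t)) \<ge> m" using zeta_num_lower_bound by blast
  obtain C0 k where C0: "\<And>s. Re s \<ge> -1 \<Longrightarrow> norm (zeta_num s) \<le> C0 * (1 + norm s) ^ k"
    using zeta_num_growth[of "-1"] unfolding poly_growth_right_def by blast
  define C where "C = \<bar>C0\<bar> + 1"
  have C: "C > 0" "norm (zeta_num s) \<le> C * (1 + norm s) ^ k" if "Re s \<ge> -1" for s
  proof -
    have "C0 * (1 + norm s) ^ k \<le> C * (1 + norm s) ^ k" by (intro mult_right_mono) (auto simp: C_def)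
    then show "norm (zeta_num s) \<le> C * (1 + norm s) ^ k" using C0[OF that] by linarith
  qed (simp add: C_def)
  have Cpos: "C > 0" by (simp add: C_def)
  define D where "D = (\<bar>ln (C / m)\<bar> + real k * 6) / ln (4/3)"
  have l: "ln (4/3 :: real) > 0" by simp
  show ?thesis
  proof (intro exI[of _ D] allI)
    fix t :: real
    let ?c = "Complex 2 t" and ?M = "C * (6 + \<bar>t\<bar>) ^ k"
    have cn: "norm ?c \<le> 2 + \<bar>t\<bar>" using cmod_le[of ?c] by simp
    have bound: "norm (zeta_num z) \<le> ?M" if z: "norm (z - ?c) = 3" for z
    proof -
      have "\<bar>Re (z - ?c)\<bar> \<le> 3" using abs_Re_le_cmod[of "z - ?c"] z by simp
      then have "Re z \<ge> -1" by simp
      then have "norm (zeta_num z) \<le> C * (1 + norm z) ^ k" by (rule C)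
      also have "\<dots> \<le> ?M"
      proof (intro mult_left_mono power_mono)
        have "norm z \<le> norm (z - ?c) + norm ?c" using norm_triangle_ineq[of "z - ?c" ?c] by simp
        then show "1 + norm z \<le> 6 + \<bar>t\<bar>" using z cn by simp
      qed (use Cpos in auto)
      finally show ?thesis .
    qed
    have nz: "zeta_num ?c \<noteq> 0" using m(1) m(2)[of t] by auto
    have J: "finite (zeta_zeros t)"
      "real (card (zeta_zeros t)) \<le> ln (?M / norm (zeta_num ?c)) / ln (3 / (9/4))"
      by (rule Jensen_zeros[OF zeta_num_holomorphic, where R = 3 and M = ?M]; use bound nz in simp)+
    have "ln (?M / norm (zeta_num ?c)) \<le> ln (?M / m)"
    proof (rule ln_mono)
      show "?M / norm (zeta_num ?c) \<le> ?M / m" using m(2)[of t] m(1) Cpos nz by (intro divide_left_mono) auto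
      show "0 < ?M / norm (zeta_num ?c)" using Cpos nz by simp
    qed
    also have "?M / m = (C / m) * (6 + \<bar>t\<bar>) ^ k" by simp
    also have "ln \<dots> = ln (C / m) + real k * ln (6 + \<bar>t\<bar>)"
      using Cpos m(1) by (subst ln_mult) (auto simp: ln_realpow)
    also have "\<dots> \<le> \<bar>ln (C / m)\<bar> * (1 + \<bar>t\<bar>) + real k * (6 * (1 + \<bar>t\<bar>))"
    proof (intro add_mono mult_left_mono)
      have "\<bar>ln (C / m)\<bar> * 1 \<le> \<bar>ln (C / m)\<bar> * (1 + \<bar>t\<bar>)" by (intro mult_left_mono) auto
      then show "ln (C / m) \<le> \<bar>ln (C / m)\<bar> * (1 + \<bar>t\<bar>)" by linarith
      \<comment> \<open>A linear bound in place of the logarithm is enough for polynomial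
        counts.\<close>
      have "ln (6 + \<bar>t\<bar>) \<le> (6 + \<bar>t\<bar>) - 1" by (rule ln_le_minus_one) simp
      then show "ln (6 + \<bar>t\<bar>) \<le> 6 * (1 + \<bar>t\<bar>)" by simp
    qed simp
    also have "\<dots> = (\<bar>ln (C / m)\<bar> + real k * 6) * (1 + \<bar>t\<bar>)" by (simp add: algebra_simps)
    finally have "ln (?M / norm (zeta_num ?c)) / ln (4/3) \<le> D * (1 + \<bar>t\<bar>)"
      using l by (simp add: D_def divide_right_mono)
    then show "finite (zeta_zeros t) \<and>
      real (card (zeta_zeros t)) \<le> D * (1 + \<bar>t\<bar>)"
      using J by simp
  qed
qed

abbreviation zeta_irregular :: "real \<Rightarrow> complex set" where
  "zeta_irregular V \<equiv> {v. Re v \<ge> 0 \<and> \<bar>Im v\<bar> \<le> V \<and> \<not> zeta_regular v}"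

text \<open>By the Euler product no zeros have real part above 1, so discs at integer heights cover
  all zeros in question; the extra point 1 is the pole.\<close>

lemma zeta_irregular_count:
  "\<exists>C\<ge>0. \<forall>V\<ge>0. finite (zeta_irregular V) \<and>
     real (card (zeta_irregular V)) \<le> C * (1 + V)\<^sup>2"
proof -
  obtain C where C: "\<And>t. finite (zeta_zeros t)" "\<And>t. real (card (zeta_zeros t)) \<le> C * (1 + \<bar>t\<bar>)"
    using zeta_num_zeros_disc by blast
  have "0 \<le> C" using order_trans[OF of_nat_0_le_iff C(2)[of 0]] by simp
  show ?thesis
  proof (intro exI[of _ "1 + 15 * C"] conjI allI impI)
    show "0 \<le> 1 + 15 * C" using \<open>0 \<le> C\<close> by simp
    fix V :: real assume V: "V \<ge> 0"
    let ?S = "zeta_irregular V"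
    \<comment> \<open>The values of the floor of \<open>Im v\<close> for
      \<open>\<bar>Im v\<bar> \<le> V\<close>; rounding down can reach one below the negative of the
      floor of \<open>V\<close>.\<close>
    define I where "I = {- \<lfloor>V\<rfloor> - 1..\<lfloor>V\<rfloor>}"
    have sub: "?S \<subseteq> insert 1 (\<Union>j\<in>I. zeta_zeros (of_int j))"
    proof
      fix v assume v: "v \<in> ?S"
      show "v \<in> insert 1 (\<Union>j\<in>I. zeta_zeros (of_int j))"
      proof (cases "v = 1")
        case False
        then have zv: "zeta_num v = 0" using v by (simp add: zeta_regular_def)
        have "Re v \<le> 1"
        proof (rule ccontr)
          assume "\<not> Re v \<le> 1"
          then show False using zv Euler_product(2)[of v] False by (simp add: zeta_num_eq)
        qed
        moreover have "Re v \<ge> 0" using v by simp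
        ultimately have "(2 - Re v)\<^sup>2 \<le> 2\<^sup>2" by (intro power_mono) auto
        moreover define j where "j = \<lfloor>Im v\<rfloor>"
        have "(of_int j - Im v)\<^sup>2 \<le> 1" unfolding j_def abs_square_le_1 by linarith
        ultimately have "norm (Complex 2 (of_int j) - v) \<le> sqrt 5" by (simp add: cmod_def)
        also have "\<dots> \<le> 9/4" by (rule real_le_lsqrt) (auto simp: power2_eq_square)
        finally have "v \<in> cball (Complex 2 (of_int j)) (9/4)" by (simp add: dist_norm)
        moreover have "j \<in> I" using v unfolding I_def j_def by (auto; linarith)
        ultimately show ?thesis using zv by blast
      qed simp
    qed
    have fin: "finite (insert 1 (\<Union>j\<in>I. zeta_zeros (of_int j)))" using C(1) by (auto simp: I_def)
    show "finite ?S" by (rule finite_subset[OF sub fin])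
    have "real (card ?S) \<le> real (card (insert 1 (\<Union>j\<in>I. zeta_zeros (of_int j))))"
      by (intro of_nat_mono card_mono fin sub)
    also have "\<dots> \<le> 1 + real (card (\<Union>j\<in>I. zeta_zeros (of_int j)))"
      using fin by (subst card_insert_if) auto
    also have "\<dots> \<le> 1 + (\<Sum>j\<in>I. real (card (zeta_zeros (of_int j))))"
      using card_UN_le[of I "\<lambda>j. zeta_zeros (of_int j)"] by (simp add: I_def flip: of_nat_sum)
    also have "\<dots> \<le> 1 + (\<Sum>j\<in>I. C * (3 * (1 + V)))"
    proof (intro add_left_mono sum_mono)
      fix j assume "j \<in> I"
      then have "\<bar>of_int j\<bar> \<le> 1 + V" unfolding I_def by (auto; linarith)
      then have "C * (1 + \<bar>of_int j\<bar>) \<le> C * (3 * (1 + V))" using \<open>0 \<le> C\<close> V by (intro mult_left_mono) auto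
      then show "real (card (zeta_zeros (of_int j))) \<le> C * (3 * (1 + V))" using C(2)[of "of_int j"] by linarith
    qed
    also have "\<dots> = 1 + real (card I) * (C * (3 * (1 + V)))" by simp
    also have "\<dots> \<le> 1 + (5 * (1 + V)) * (C * (3 * (1 + V)))"
    proof (intro add_left_mono mult_right_mono)
      show "real (card I) \<le> 5 * (1 + V)" unfolding I_def using V by (simp; linarith)
    qed (use \<open>0 \<le> C\<close> V in auto)
    also have "\<dots> = 1 + 15 * C * (1 + V)\<^sup>2" by (simp add: power2_eq_square algebra_simps)
    also have "\<dots> \<le> (1 + V)\<^sup>2 + 15 * C * (1 + V)\<^sup>2"
      using V by (intro add_right_mono one_le_power) auto
    finally show "real (card ?S) \<le> (1 + 15 * C) * (1 + V)\<^sup>2" by (simp add: algebra_simps)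
  qed
qed

lemma prime_term_exp:
  assumes "p > 0"
  shows "prime_term x p s = fst x * exp (of_real (ln (real p)) * term_freq x s)"
proof -
  have "Ln (of_nat p) = of_real (ln (real p))" using Ln_of_real[of "real p"] assms by simp
  then show ?thesis using assms by (simp add: prime_term_def powr_def mult.commute)
qed

text \<open>
  For fixed \<open>s\<close> the value of the prime polynomial at \<open>p\<close> is \<open>f (ln p)\<close> for an entire function \<open>f\<close> of
  exponential type with \<open>f u \<longlongrightarrow> 1\<close> as \<open>u \<longlongrightarrow> \<infinity>\<close>. Jensen's inequality is applied on a disc centred at
  a point \<open>u1\<close>, proportional to \<open>K + 1\<close>, beyond which \<open>f\<close> has no zeros.
\<close>

lemma prime_poly_common_zeros:
  assumes W: "admissible W 1 L" "imaginary_exponents W"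
  shows "\<exists>D\<ge>0. \<forall>K s. norm s \<le> R \<longrightarrow> Re s \<ge> 1 / real (Suc K) \<longrightarrow>
    finite (prime_zeros L s) \<and> real (card (prime_zeros L s)) \<le> D * real (Suc K)"
proof -
  define N where "N = real (length L)"
  \<comment> \<open>For \<open>u \<ge> l * (K + 1)\<close> each of the \<open>N\<close> exponential
    terms is at most \<open>exp (- l)\<close>, so together they stay below 1/2 and
    \<open>f u\<close> is nonzero.\<close>
  define l where "l = ln (2 * N + 2)"
  define B where "B = (\<Sum>x\<leftarrow>L. norm (snd (snd x)) + real (pdegree x) * \<bar>R\<bar>)"
  have l: "l > 0" unfolding l_def N_def by simp
  have B: "norm (snd (snd x)) + real (pdegree x) * \<bar>R\<bar> \<le> B" if "x \<in> set L" for x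
    unfolding B_def by (rule member_le_sum_list) (use that in auto)
  have "B \<ge> 0" unfolding B_def by (rule sum_list_nonneg) auto
  \<comment> \<open>Jensen's bound for radii \<open>u1\<close> and \<open>2 * u1\<close>: the outer
    circle lies in \<open>norm u \<le> 3 * u1\<close>, where \<open>B\<close> bounds the exponential
    rate, and the ratio of the radii gives \<open>ln 2\<close>.\<close>
  define D where "D = l * (1 + 3 * B) / ln 2"
  show ?thesis
  proof (intro exI[of _ D] conjI allI impI)
    show "0 \<le> D" using l \<open>B \<ge> 0\<close> by (simp add: D_def)
    fix K s assume s: "norm s \<le> R" "Re s \<ge> 1 / real (Suc K)"
    have e1: "norm (fst x) = 1" "Re (snd (snd x)) = 0" "pdegree x \<ge> 1" if "x \<in> set L" for x
      using W that by (auto simp: admissible_term_def imaginary_exponents_def)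
    define u1 where "u1 = l * real (Suc K)"
    have u1: "u1 > 0" using l by (simp add: u1_def)
    define f where "f = (\<lambda>u. 1 + (\<Sum>x\<leftarrow>L. fst x * exp (u * term_freq x s)))"
    have fp: "prime_poly L p s = f (of_real (ln (real p)))" if "p > 0" for p
      unfolding prime_poly_def f_def using prime_term_exp[OF that] by simp
    have hol: "f holomorphic_on UNIV"
    proof -
      have "(\<lambda>u. \<Sum>x\<leftarrow>L'. fst x * exp (u * term_freq x s)) holomorphic_on UNIV" for L' :: "pterm list"
        by (induction L') (auto intro!: holomorphic_intros)
      then show ?thesis unfolding f_def by (intro holomorphic_intros)
    qed
    have sum_bound: "norm (f u - 1) \<le> N * X"
      if "\<And>x. x \<in> set L \<Longrightarrow> norm (exp (u * term_freq x s)) \<le> X" for u X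
    proof -
      have "norm (f u - 1) \<le> (\<Sum>x\<leftarrow>L. norm (fst x * exp (u * term_freq x s)))"
        unfolding f_def by (induction L) (auto intro: order_trans[OF norm_triangle_ineq])
      also have "\<dots> \<le> (\<Sum>x\<leftarrow>L. X)" by (rule sum_list_mono) (use that e1 in \<open>auto simp: norm_mult\<close>)
      finally show ?thesis by (simp add: N_def sum_list_triv)
    qed
    have "0 < 1 / real (Suc K)" by simp
    then have Res: "Re s > 0" using s(2) by linarith
    have far: "norm (f (of_real u) - 1) \<le> 1/2" if "u \<ge> u1" for u
    proof -
      have "norm (f (of_real u) - 1) \<le> N * (1 / (2 * N + 2))"
      proof (rule sum_bound)
        fix x assume x: "x \<in> set L"
        have "norm (exp (of_real u * term_freq x s)) = exp (- (u * (real (pdegree x) * Re s)))"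
          using e1[OF x] by simp
        also have "\<dots> \<le> exp (- l)"
        proof -
          have "1 / real (Suc K) \<le> 1 * Re s" using s(2) by simp
          also have "\<dots> \<le> real (pdegree x) * Re s" using e1(3)[OF x] Res by (intro mult_right_mono) auto
          finally have "u1 * (1 / real (Suc K)) \<le> u * (real (pdegree x) * Re s)"
            using that u1 by (intro mult_mono) auto
          then show ?thesis by (simp add: u1_def)
        qed
        also have "\<dots> = 1 / (2 * N + 2)" unfolding l_def by (simp add: exp_minus N_def inverse_eq_divide)
        finally show "norm (exp (of_real u * term_freq x s)) \<le> 1 / (2 * N + 2)" .
      qed
      also have "\<dots> \<le> 1/2" by (simp add: N_def field_simps)
      finally show ?thesis .
    qed
    have half: "norm (f (of_real u1)) \<ge> 1/2"
      using far[of u1] norm_triangle_ineq2[of 1 "1 - f (of_real u1)"] by (simp add: norm_minus_commute)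
    define M where "M = (N + 1) * exp (3 * u1 * B)"
    have bound: "norm (f u) \<le> M" if "norm (u - of_real u1) = 2 * u1" for u
    proof -
      have "norm u \<le> norm (u - of_real u1) + norm (of_real u1 :: complex)"
        using norm_triangle_ineq[of "u - of_real u1" "of_real u1"] by simp
      then have nu: "norm u \<le> 3 * u1" using that u1 by simp
      have "norm (f u - 1) \<le> N * exp (3 * u1 * B)"
      proof (rule sum_bound)
        fix x assume x: "x \<in> set L"
        have "norm (term_freq x s) \<le> norm (snd (snd x)) + norm (of_nat (pdegree x) * s)"
          by (rule norm_triangle_ineq4)
        also have "\<dots> \<le> norm (snd (snd x)) + real (pdegree x) * \<bar>R\<bar>"
          using s(1) by (auto simp: norm_mult intro!: mult_left_mono)
        also have "\<dots> \<le> B" by (rule B[OF x])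
        finally have "norm (u * term_freq x s) \<le> 3 * u1 * B"
          unfolding norm_mult using nu u1 by (intro mult_mono) auto
        then show "norm (exp (u * term_freq x s)) \<le> exp (3 * u1 * B)"
          using norm_exp[of "u * term_freq x s"] by (meson exp_le_cancel_iff order_trans)
      qed
      moreover have "1 \<le> exp (3 * u1 * B)" using u1 \<open>B \<ge> 0\<close> by simp
      moreover have "norm (f u) \<le> norm (f u - 1) + 1" using norm_triangle_ineq[of "f u - 1" 1] by simp
      ultimately show ?thesis unfolding M_def distrib_right by linarith
    qed
    have fnz: "f (of_real u1) \<noteq> 0" using half by auto
    \<comment> \<open>This disc contains the real interval from 0 to \<open>u1\<close>, hence
      \<open>ln p\<close> for every prime \<open>p\<close> with a zero at \<open>s\<close>.\<close>
    let ?Z = "{u \<in> cball (of_real u1) u1. f u = 0}"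
    have finZ: "finite ?Z" and "real (card ?Z) \<le> ln (M / norm (f (of_real u1))) / ln (2 * u1 / u1)"
      by (rule Jensen_zeros[OF hol, where R = "2 * u1" and M = M]; use u1 bound fnz in simp)+
    note this(2)
    also have "2 * u1 / u1 = 2" using u1 by simp
    also have "ln (M / norm (f (of_real u1))) \<le> ln ((2 * N + 2) * exp (3 * u1 * B))"
    proof (rule ln_mono)
      have "M / norm (f (of_real u1)) \<le> M / (1/2)"
        using half fnz by (intro divide_left_mono) (auto simp: M_def N_def)
      then show "M / norm (f (of_real u1)) \<le> (2 * N + 2) * exp (3 * u1 * B)" by (simp add: M_def algebra_simps)
      show "0 < M / norm (f (of_real u1))" using fnz by (simp add: M_def N_def add_nonneg_pos)
    qed
    also have "\<dots> = l + 3 * u1 * B" unfolding l_def N_def by (subst ln_mult) auto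
    also have "\<dots> \<le> l * real (Suc K) + 3 * u1 * B" using l by simp
    also have "\<dots> = l * (1 + 3 * B) * real (Suc K)" by (simp add: u1_def algebra_simps)
    finally have cardZ: "real (card ?Z) \<le> D * real (Suc K)"
      by (simp add: D_def divide_right_mono mult_right_mono)
    let ?P = "prime_zeros L s"
    let ?i = "\<lambda>p::nat. complex_of_real (ln (real p))"
    have inj: "inj_on ?i ?P"
    proof (rule inj_onI)
      fix p q assume "p \<in> ?P" "q \<in> ?P" "?i p = ?i q"
      then show "p = q" using prime_gt_0_nat[of p] prime_gt_0_nat[of q] by simp
    qed
    have img: "?i ` ?P \<subseteq> ?Z"
    proof
      fix v assume "v \<in> ?i ` ?P"
      then obtain p where p: "prime p" "prime_poly L p s = 0" "v = ?i p" by auto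
      have f0: "f v = 0" using fp[OF prime_gt_0_nat[OF p(1)]] p by simp
      have "ln (real p) < u1"
      proof (rule ccontr)
        assume "\<not> ln (real p) < u1"
        then show False using far[of "ln (real p)"] f0 p(3) by simp
      qed
      moreover have "ln (real p) \<ge> 0" using prime_ge_1_nat[OF p(1)] by simp
      moreover have "dist (of_real u1) v = \<bar>u1 - ln (real p)\<bar>"
        unfolding p(3) dist_norm of_real_diff[symmetric] norm_of_real ..
      ultimately show "v \<in> ?Z" using f0 by simp
    qed
    show "finite ?P" using finite_imageD[OF finite_subset[OF img finZ] inj] .
    have "card ?P = card (?i ` ?P)" using inj by (rule card_image[symmetric])
    also have "\<dots> \<le> card ?Z" by (rule card_mono[OF finZ img])
    finally show "real (card ?P) \<le> D * real (Suc K)" using cardZ by linarith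
  qed
qed

section \<open>Convergent reciprocal sums from polynomial counts\<close>

lemma power_le_exp:
  assumes "\<eta> > 0"
  shows "\<exists>A\<ge>0. \<forall>k::nat. real (Suc k) ^ q \<le> A * exp (\<eta> * real k / 2)"
proof -
  \<comment> \<open>Raising \<open>x \<le> exp x\<close> at \<open>x = c * (k + 1)\<close> to the
    power \<open>q + 1\<close> then costs exactly \<open>\<eta> * k / 2\<close> in the exponent, up
    to a constant.\<close>
  define c where "c = \<eta> / (2 * real (Suc q))"
  have c: "c > 0" using assms by (simp add: c_def)
  show ?thesis
  proof (intro exI[of _ "(exp c / c) ^ Suc q"] conjI allI)
    fix k
    have "c * real (Suc k) \<le> exp (c * real (Suc k))" using exp_ge_add_one_self[of "c * real (Suc k)"] by linarith
    then have "real (Suc k) \<le> exp (c * real (Suc k)) / c" using c by (simp add: field_simps)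
    also have "\<dots> = exp c / c * exp (c * real k)" by (simp add: algebra_simps exp_add)
    finally have "real (Suc k) ^ Suc q \<le> (exp c / c * exp (c * real k)) ^ Suc q" by (intro power_mono) auto
    also have "\<dots> = (exp c / c) ^ Suc q * exp (real (Suc q) * (c * real k))"
      unfolding power_mult_distrib exp_of_nat_mult by simp
    also have "real (Suc q) * (c * real k) = \<eta> * real k / 2" unfolding c_def by (simp del: of_nat_Suc)
    finally have "real (Suc k) ^ Suc q \<le> (exp c / c) ^ Suc q * exp (\<eta> * real k / 2)" .
    moreover have "real (Suc k) ^ q \<le> real (Suc k) ^ Suc q" by (rule power_increasing) auto
    ultimately show "real (Suc k) ^ q \<le> (exp c / c) ^ Suc q * exp (\<eta> * real k / 2)" by linarith
  qed (use c in simp)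
qed

text \<open>Blocks \<open>\<eta> * k \<le> ln p < \<eta> * (k + 1)\<close> contribute at most
  \<open>C * (k + 1)^q * exp (- \<eta> * k)\<close>. Half of the exponential absorbs the polynomial,
  and the rest is geometric.\<close>

lemma summable_reciprocals_sparse:
  fixes G :: "nat \<Rightarrow> bool"
  assumes "\<eta> > 0" "p0 > 0"
    and cnt: "\<And>K. real (card {p. G p \<and> p \<ge> p0 \<and> ln (real p) < \<eta> * real (Suc K)}) \<le> C * real (Suc K) ^ q"
    and fin: "\<And>K. finite {p. G p \<and> p \<ge> p0 \<and> ln (real p) < \<eta> * real (Suc K)}"
  shows "summable (\<lambda>p. if G p then 1 / real p else 0)"
proof -
  obtain A where A: "A \<ge> 0" "\<And>k. real (Suc k) ^ q \<le> A * exp (\<eta> * real k / 2)" using power_le_exp[OF assms(1)] by blast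
  have C: "C \<ge> 0" using order_trans[OF of_nat_0_le_iff cnt[of 0]] by simp
  define S where "S = (\<Sum>k. C * A * exp (- \<eta> / 2) ^ k)"
  have sm: "summable (\<lambda>k. C * A * exp (- \<eta> / 2) ^ k)"
    by (intro summable_mult summable_geometric) (use assms(1) in auto)
  define \<kappa> where "\<kappa> = (\<lambda>p::nat. nat \<lfloor>ln (real p) / \<eta>\<rfloor>)"
  have \<kappa>: "\<eta> * real (\<kappa> p) \<le> ln (real p)" "ln (real p) < \<eta> * real (Suc (\<kappa> p))" if "p > 0" for p
  proof -
    have "ln (real p) / \<eta> \<ge> 0" using that assms(1) by simp
    then have "real (\<kappa> p) \<le> ln (real p) / \<eta>" "ln (real p) / \<eta> < real (Suc (\<kappa> p))"
      unfolding \<kappa>_def by linarith+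
    then show "\<eta> * real (\<kappa> p) \<le> ln (real p)" "ln (real p) < \<eta> * real (Suc (\<kappa> p))"
      using assms(1) by (auto simp: field_simps)
  qed
  have main: "(\<Sum>p\<in>F. 1 / real p) \<le> S" if F: "finite F" "\<And>p. p \<in> F \<Longrightarrow> G p \<and> p \<ge> p0" for F
  proof -
    have "(\<Sum>p\<in>F. 1 / real p) = (\<Sum>k\<in>\<kappa> ` F. \<Sum>p\<in>{p\<in>F. \<kappa> p = k}. 1 / real p)"
      by (rule sum.image_gen[OF F(1)])
    also have "\<dots> \<le> (\<Sum>k\<in>\<kappa> ` F. C * A * exp (- \<eta> / 2) ^ k)"
    proof (rule sum_mono)
      fix k
      have "(\<Sum>p\<in>{p\<in>F. \<kappa> p = k}. 1 / real p) \<le> (\<Sum>p\<in>{p\<in>F. \<kappa> p = k}. exp (- (\<eta> * real k)))"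
      proof (rule sum_mono)
        fix p assume p: "p \<in> {p\<in>F. \<kappa> p = k}"
        then have p0: "p > 0" using F(2)[of p] assms(2) by auto
        have "exp (\<eta> * real k) \<le> exp (ln (real p))" using \<kappa>(1)[OF p0] p by simp
        then have "exp (\<eta> * real k) \<le> real p" using p0 by simp
        then have "1 / real p \<le> 1 / exp (\<eta> * real k)" using p0 by (intro divide_left_mono) auto
        then show "1 / real p \<le> exp (- (\<eta> * real k))" by (simp add: exp_minus inverse_eq_divide)
      qed
      also have "\<dots> = real (card {p\<in>F. \<kappa> p = k}) * exp (- (\<eta> * real k))" by simp
      also have "\<dots> \<le> (C * real (Suc k) ^ q) * exp (- (\<eta> * real k))"
      proof (intro mult_right_mono)
        have "card {p\<in>F. \<kappa> p = k} \<le> card {p. G p \<and> p \<ge> p0 \<and> ln (real p) < \<eta> * real (Suc k)}"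
        proof (rule card_mono[OF fin], rule subsetI)
          fix p assume p: "p \<in> {p\<in>F. \<kappa> p = k}"
          then have "p > 0" using F(2)[of p] assms(2) by auto
          then show "p \<in> {p. G p \<and> p \<ge> p0 \<and> ln (real p) < \<eta> * real (Suc k)}"
            using p \<kappa>(2)[of p] F(2)[of p] by auto
        qed
        then show "real (card {p\<in>F. \<kappa> p = k}) \<le> C * real (Suc k) ^ q" using cnt[of k] by linarith
      qed simp
      also have "\<dots> \<le> (C * (A * exp (\<eta> * real k / 2))) * exp (- (\<eta> * real k))"
        using A(2)[of k] C by (intro mult_right_mono mult_left_mono) auto
      also have "\<dots> = C * A * (exp (\<eta> * real k / 2) * exp (- (\<eta> * real k)))" by simp
      also have "exp (\<eta> * real k / 2) * exp (- (\<eta> * real k)) = exp (real k * (- \<eta> / 2))"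
        unfolding exp_add[symmetric] by (simp add: field_simps)
      also have "\<dots> = exp (- \<eta> / 2) ^ k" by (rule exp_of_nat_mult)
      finally show "(\<Sum>p\<in>{p\<in>F. \<kappa> p = k}. 1 / real p) \<le> C * A * exp (- \<eta> / 2) ^ k" .
    qed
    also have "\<dots> \<le> S" unfolding S_def
      by (rule sum_le_suminf[OF sm]) (use F C A in auto)
    finally show ?thesis .
  qed
  show ?thesis
  proof (rule summableI_nonneg_bounded)
    fix n
    have "(\<Sum>p<n. if G p then 1 / real p else 0) \<le>
      (\<Sum>p<n. (if p < p0 then 1 else 0) + (if G p \<and> p \<ge> p0 then 1 / real p else 0))"
      by (rule sum_mono) (auto simp: divide_simps)
    also have "\<dots> = (\<Sum>p<n. if p < p0 then 1 else 0) + (\<Sum>p<n. if G p \<and> p \<ge> p0 then 1 / real p else 0)"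
      by (rule sum.distrib)
    also have "(\<Sum>p<n. if p < p0 then 1 else 0 :: real) \<le> real p0"
    proof -
      have "(\<Sum>p<n. if p < p0 then 1 else 0 :: real) = real (card {p. p < n \<and> p < p0})"
        by (simp add: sum.If_cases Int_def)
      also have "\<dots> \<le> real (card {..<p0})" by (intro of_nat_mono card_mono) auto
      finally show ?thesis by simp
    qed
    also have "(\<Sum>p<n. if G p \<and> p \<ge> p0 then 1 / real p else 0) = (\<Sum>p\<in>{p\<in>{..<n}. G p \<and> p \<ge> p0}. 1 / real p)"
      by (rule sum.inter_filter[symmetric]) simp
    also have "\<dots> \<le> S" by (rule main) auto
    finally show "(\<Sum>p<n. if G p then 1 / real p else 0) \<le> real p0 + S" by simp
  qed simp
qed

section \<open>Irregular points, and the contradiction with a continuation across the line\<close>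

lemma finite_poles_in_compact:
  assumes "h meromorphic_on A" "compact X" "X \<subseteq> A"
  shows "finite {s \<in> X. is_pole h s}"
proof -
  have "{w. \<not> h analytic_on {w}} sparse_in X"
    using meromorphic_on_imp_sparse_singularities[OF assms(1)] sparse_in_subset[OF _ assms(3)] by blast
  then have "finite (X \<inter> {w. \<not> h analytic_on {w}})" by (rule sparse_in_compact_finite) fact
  then show ?thesis by (rule finite_subset[rotated]) (use analytic_at_imp_no_pole in auto)
qed

text \<open>The points where a zero or pole of zeta may cancel the pole expected from a local
  zero.\<close>

definition irregular_points :: "(nat \<times> complex) set \<Rightarrow> real \<Rightarrow> nat \<Rightarrow> complex set" where
  "irregular_points W R K = {s. Re s \<ge> 0 \<and> norm s \<le> R \<and> (\<exists>y\<in>W. 1 \<le> fst y \<and> fst y \<le> K \<and>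
     \<not> (regular_at y s))}"

text \<open>There are at most \<open>(K + 1)^(m + 1)\<close> pairs of degree up to \<open>K\<close>.
  Each gives two injective affine maps under which irregular points are preimages of irregular
  points of zeta, and up to height \<open>O(K)\<close> there are \<open>O(K^2)\<close> of
  those.\<close>

lemma irregular_points_count:
  assumes W: "imaginary_exponents W"
    and fin: "\<And>k. finite {c. (k, c) \<in> W}" and card: "\<And>k. card {c. (k, c) \<in> W} \<le> Suc k ^ m"
    and B: "\<And>y. y \<in> W \<Longrightarrow> norm (snd y) \<le> B * real (fst y)" and "B \<ge> 0" "R \<ge> 0"
  shows "\<exists>C\<ge>0. \<forall>K. finite (irregular_points W R K) \<and> real (card (irregular_points W R K)) \<le> C * real (Suc K) ^ (m + 3)"
proof -
  obtain C where C: "C \<ge> 0" "\<And>V. V \<ge> 0 \<Longrightarrow> finite (zeta_irregular V)"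
    "\<And>V. V \<ge> 0 \<Longrightarrow> real (card (zeta_irregular V)) \<le> C * (1 + V)\<^sup>2"
    using zeta_irregular_count by blast
  define b where "b = 1 + 2 * (R + B)"
  show ?thesis
  proof (intro exI[of _ "2 * C * b\<^sup>2"] conjI allI)
    show "0 \<le> 2 * C * b\<^sup>2" using C(1) by simp
    fix K
    \<comment> \<open>The factor 2 accommodates the doubled arguments.\<close>
    define V where "V = 2 * real K * (R + B)"
    have V: "V \<ge> 0" using assms by (simp add: V_def)
    define S where "S = zeta_irregular V"
    have S: "finite S" "real (card S) \<le> C * (1 + V)\<^sup>2" using C V by (auto simp: S_def)
    define WK where "WK = {y\<in>W. 1 \<le> fst y \<and> fst y \<le> K}"
    have WKsub: "WK \<subseteq> (\<Union>k\<in>{1..K}. Pair k ` {c. (k, c) \<in> W})"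
    proof
      fix y assume "y \<in> WK"
      then have "y = (fst y, snd y)" "fst y \<in> {1..K}" "snd y \<in> {c. (fst y, c) \<in> W}" by (auto simp: WK_def)
      then show "y \<in> (\<Union>k\<in>{1..K}. Pair k ` {c. (k, c) \<in> W})" by blast
    qed
    have finU: "finite (\<Union>k\<in>{1..K}. Pair k ` {c. (k, c) \<in> W})" using fin by auto
    have finWK: "finite WK" by (rule finite_subset[OF WKsub finU])
    have "card WK \<le> card (\<Union>k\<in>{1..K}. Pair k ` {c. (k, c) \<in> W})" by (rule card_mono[OF finU WKsub])
    also have "\<dots> \<le> (\<Sum>k\<in>{1..K}. card (Pair k ` {c. (k, c) \<in> W}))" by (rule card_UN_le) simp
    also have "\<dots> \<le> (\<Sum>k\<in>{1..K}. Suc K ^ m)"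
    proof (rule sum_mono)
      fix k assume k: "k \<in> {1..K}"
      have "card (Pair k ` {c. (k, c) \<in> W}) \<le> card {c. (k, c) \<in> W}" by (rule card_image_le[OF fin])
      also have "\<dots> \<le> Suc k ^ m" by (rule card)
      also have "\<dots> \<le> Suc K ^ m" using k by (intro power_mono) auto
      finally show "card (Pair k ` {c. (k, c) \<in> W}) \<le> Suc K ^ m" .
    qed
    also have "\<dots> \<le> Suc K ^ (m + 1)" by simp
    finally have "real (card WK) \<le> real (Suc K ^ (m + 1))" by (rule of_nat_mono)
    then have cardWK: "real (card WK) \<le> real (Suc K) ^ (m + 1)" by (simp only: of_nat_power)
    define A where "A = (\<lambda>y. (\<lambda>s. term_arg y s) -` S \<union> (\<lambda>s. 2 * term_arg y s) -` S)"
    have sub: "irregular_points W R K \<subseteq> (\<Union>y\<in>WK. A y)"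
    proof
      fix s assume "s \<in> irregular_points W R K"
      then obtain y where s: "Re s \<ge> 0" "norm s \<le> R" and y: "y \<in> W" "1 \<le> fst y" "fst y \<le> K"
        and irr: "\<not> zeta_regular (term_arg y s) \<or> \<not> zeta_regular (2 * term_arg y s)"
        unfolding irregular_points_def by blast
      have re: "Re (term_arg y s) \<ge> 0" using W y s by (auto simp: term_arg_def imaginary_exponents_def)
      have "norm (term_arg y s) \<le> real (fst y) * norm s + norm (snd y)"
        unfolding term_arg_def by (rule order_trans[OF norm_triangle_ineq4]) (simp add: norm_mult)
      also have "\<dots> \<le> real (fst y) * R + B * real (fst y)" using s B[OF y(1)] by (intro add_mono mult_left_mono) auto
      also have "\<dots> = real (fst y) * (R + B)" by (simp add: algebra_simps)
      also have "\<dots> \<le> real K * (R + B)" using y assms by (intro mult_right_mono) auto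
      finally have "\<bar>Im (term_arg y s)\<bar> \<le> real K * (R + B)" using abs_Im_le_cmod order_trans by blast
      then have im: "\<bar>Im (term_arg y s)\<bar> \<le> V" "\<bar>Im (2 * term_arg y s)\<bar> \<le> V" unfolding V_def by auto
      have "s \<in> A y" using irr re im unfolding A_def S_def by auto
      moreover have "y \<in> WK" using y by (simp add: WK_def)
      ultimately show "s \<in> (\<Union>y\<in>WK. A y)" by blast
    qed
    have A: "finite (A y) \<and> card (A y) \<le> 2 * card S" if "y \<in> WK" for y
    proof -
      have y: "of_nat (fst y) \<noteq> (0::complex)" using that by (auto simp: WK_def)
      have inj: "inj (\<lambda>s. term_arg y s)" "inj (\<lambda>s. 2 * term_arg y s)"
        using y by (auto intro!: injI simp: term_arg_def)
      have "finite ((\<lambda>s. term_arg y s) -` S)" "finite ((\<lambda>s. 2 * term_arg y s) -` S)"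
        using finite_vimageI[OF S(1)] inj by blast+
      moreover have "card ((\<lambda>s. term_arg y s) -` S) \<le> card S" "card ((\<lambda>s. 2 * term_arg y s) -` S) \<le> card S"
        using card_vimage_inj_on_le[OF inj(1) S(1)] card_vimage_inj_on_le[OF inj(2) S(1)] by auto
      ultimately show ?thesis unfolding A_def
        using card_Un_le[of "(\<lambda>s. term_arg y s) -` S" "(\<lambda>s. 2 * term_arg y s) -` S"] by auto
    qed
    have finA: "finite (\<Union>y\<in>WK. A y)" using finWK A by blast
    then show "finite (irregular_points W R K)" using sub finite_subset by blast
    have "card (irregular_points W R K) \<le> card (\<Union>y\<in>WK. A y)" by (rule card_mono[OF finA sub])
    also have "\<dots> \<le> (\<Sum>y\<in>WK. card (A y))" by (rule card_UN_le[OF finWK])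
    also have "\<dots> \<le> (\<Sum>y\<in>WK. 2 * card S)" by (rule sum_mono) (use A in auto)
    finally have "card (irregular_points W R K) \<le> card WK * (2 * card S)" by simp
    then have "real (card (irregular_points W R K)) \<le> real (card WK) * (2 * real (card S))"
      by (metis of_nat_le_iff of_nat_mult of_nat_numeral)
    also have "\<dots> \<le> real (Suc K) ^ (m + 1) * (2 * (C * (b * real (Suc K))\<^sup>2))"
    proof (rule mult_mono[OF cardWK])
      have "1 + V \<le> b * real (Suc K)"
        using assms unfolding V_def b_def by (simp add: algebra_simps)
      then have "C * (1 + V)\<^sup>2 \<le> C * (b * real (Suc K))\<^sup>2" using C(1) V by (intro mult_left_mono power_mono) auto
      then show "2 * real (card S) \<le> 2 * (C * (b * real (Suc K))\<^sup>2)" using S(2) by linarith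
    qed auto
    also have "\<dots> = 2 * C * b\<^sup>2 * real (Suc K) ^ (m + 3)"
      by (simp add: power_mult_distrib power_add power2_eq_square power3_eq_cube)
    finally show "real (card (irregular_points W R K)) \<le> 2 * C * b\<^sup>2 * real (Suc K) ^ (m + 3)" .
  qed
qed

lemma prime_poly_periodic:
  assumes "p > 1"
  shows "prime_poly L p (s + of_real (2 * pi * of_int j / ln (real p)) * \<i>) = prime_poly L p s"
proof -
  have lnp: "ln (real p) \<noteq> 0" using assms by simp
  have "prime_term x p (s + of_real (2 * pi * of_int j / ln (real p)) * \<i>) = prime_term x p s" for x
  proof -
    have "of_real (ln (real p)) * (snd (snd x) - of_nat (pdegree x) * (s + of_real (2 * pi * of_int j / ln (real p)) * \<i>)) =
      of_real (ln (real p)) * term_freq x s + \<i> * (of_int (- (int (pdegree x) * j)) * (of_real pi * 2))"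
      using lnp by (simp add: field_simps)
    then show ?thesis using assms exp_plus_2pin[of "of_real (ln (real p)) * term_freq x s" "- (int (pdegree x) * j)"]
      by (simp add: prime_term_exp)
  qed
  then show ?thesis by (simp add: prime_poly_def)
qed

text \<open>Horizontally, a zero forces \<open>p powr Re w \<le> length L\<close>, so
  \<open>Re w = O(1 / ln p)\<close>. Vertically, a multiple of the period
  \<open>2 * pi / ln p\<close> brings it within one period of \<open>z\<close>. Zeros of all large
  primes that have one thus approach every boundary point.\<close>

lemma prime_poly_zero_near:
  assumes W: "admissible W 1 L" "imaginary_exponents W" and p: "prime p" and w: "prime_poly L p w = 0" "Re w \<ge> 0" and "Re z = 0"
  shows "\<exists>s. prime_poly L p s = 0 \<and> Re s = Re w \<and> norm (s - z) \<le> (ln (real (length L)) + 2 * pi) / ln (real p)"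
proof -
  have p1: "p > 1" using prime_gt_1_nat[OF p] .
  then have lnp: "ln (real p) > 0" by simp
  have "1 \<le> real (length L) * real p powr (- (real 1 * Re w))"
    using prime_poly_nonzero[OF _ W w(2), of p] w(1) p1 by linarith
  then have "real p powr Re w \<le> real (length L)" using p1 by (simp add: powr_minus field_simps)
  then have "ln (real p powr Re w) \<le> ln (real (length L))" using p1 by (intro ln_mono) auto
  then have upper: "Re w \<le> ln (real (length L)) / ln (real p)" using lnp p1 by (simp add: ln_powr field_simps)
  define d where "d = 2 * pi / ln (real p)"
  have d: "d > 0" using lnp by (simp add: d_def)
  define j where "j = \<lfloor>(Im z - Im w) / d\<rfloor>"
  have "of_int j \<le> (Im z - Im w) / d" "(Im z - Im w) / d < of_int j + 1" unfolding j_def by linarith+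
  then have j: "of_int j * d \<le> Im z - Im w" "Im z - Im w < of_int j * d + d" using d by (auto simp: field_simps)
  define s where "s = w + of_real (2 * pi * of_int j / ln (real p)) * \<i>"
  have im: "Im s = Im w + of_int j * d" by (simp add: s_def d_def)
  have "norm (s - z) \<le> \<bar>Re (s - z)\<bar> + \<bar>Im (s - z)\<bar>" by (rule cmod_le)
  also have "\<dots> \<le> ln (real (length L)) / ln (real p) + d"
    using upper w(2) j assms(6) by (intro add_mono) (auto simp: im, auto simp: s_def)
  also have "\<dots> = (ln (real (length L)) + 2 * pi) / ln (real p)" by (simp add: d_def add_divide_distrib)
  finally show ?thesis
    using prime_poly_periodic[OF p1, of L w j] w(1) by (intro exI[of _ s]) (auto simp: s_def)
qed

text \<open>Good primes with \<open>ln p < \<eta> * (K + 1)\<close> have zeros in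
  \<open>Zs K\<close>, a set of size \<open>O(K^(m + 3))\<close>, and each of its points serves
  \<open>O(K)\<close> primes. The resulting bound \<open>O(K^(m + 4))\<close> contradicts the
  divergence of the reciprocal sum.\<close>

lemma no_continuation_across:
  assumes W: "imaginary_exponents W" and L: "admissible W 1 L"
    and fin: "\<And>k. finite {c. (k, c) \<in> W}" and card: "\<And>k. card {c. (k, c) \<in> W} \<le> Suc k ^ m"
    and B: "\<And>y. y \<in> W \<Longrightarrow> norm (snd y) \<le> B * real (fst y)" "B \<ge> 0"
    and pole: "poles_at_prime_zeros W L g"
    and G: "dense_primes G" "\<eta> > 0"
      "\<And>p. prime p \<Longrightarrow> G p \<Longrightarrow> \<exists>w. prime_poly L p w = 0 \<and> Re w * ln (real p) \<ge> \<eta>"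
    and z: "Re z = 0" and r: "r > 0"
    and h: "h meromorphic_on ({s. Re s > 0} \<union> ball z r)" "\<forall>\<^sub>\<approx>s\<in>{s. Re s > 0}. h s = g s"
  shows False
proof -
  define R where "R = norm z + r"
  have "R \<ge> 0" using r by (simp add: R_def)
  obtain C where C: "C \<ge> 0" "\<And>K. finite (irregular_points W R K)"
    "\<And>K. real (card (irregular_points W R K)) \<le> C * real (Suc K) ^ (m + 3)"
    using irregular_points_count[OF W fin card B \<open>R \<ge> 0\<close>] by blast
  obtain D where D: "D \<ge> 0" "\<And>K s. norm s \<le> R \<Longrightarrow> Re s \<ge> 1 / real (Suc K) \<Longrightarrow> finite (prime_zeros L s)"
    "\<And>K s. norm s \<le> R \<Longrightarrow> Re s \<ge> 1 / real (Suc K) \<Longrightarrow> real (card (prime_zeros L s)) \<le> D * real (Suc K)"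
    using prime_poly_common_zeros[OF L W, of R] by blast
  \<comment> \<open>The assumed continuation enters here: the closed disc is compact inside its
    domain, so the number of poles does not grow with \<open>K\<close>.\<close>
  define P where "P = {s \<in> cball z (r / 2). is_pole h s}"
  have finP: "finite P" unfolding P_def by (rule finite_poles_in_compact[OF h(1)]) (use r in auto)
  define Zs where "Zs = (\<lambda>K. {s \<in> cball z (r / 2). Re s > 1 / real (Suc K) \<and> (\<exists>p. prime p \<and> prime_poly L p s = 0)})"
  have nR: "norm s \<le> R" if "s \<in> cball z (r / 2)" for s
    using that norm_triangle_ineq[of z "s - z"] r by (simp add: R_def dist_norm norm_minus_commute)
  have ReK: "Re s > 0" if "Re s > 1 / real (Suc K)" for s K
  proof -
    have "0 < 1 / real (Suc K)" by simp
    then show ?thesis using that by (rule less_trans)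
  qed
  have Zsub: "Zs K \<subseteq> irregular_points W R K \<union> P" for K
  proof
    fix s assume s: "s \<in> Zs K"
    have pos: "Re s > 0" using s ReK by (auto simp: Zs_def)
    show "s \<in> irregular_points W R K \<union> P"
    proof (cases "s \<in> irregular_points W R K")
      case False
      have "is_pole g s"
      proof -
        obtain p where "prime p" "prime_poly L p s = 0" using s by (auto simp: Zs_def)
        moreover have "\<forall>y\<in>W. 1 \<le> fst y \<longrightarrow> fst y \<le> K \<longrightarrow> regular_at y s"
          using s False nR pos by (auto simp: Zs_def irregular_points_def)
        moreover have "Re s > 1 / real (Suc K)" using s by (simp add: Zs_def)
        ultimately show ?thesis using pole unfolding poles_at_prime_zeros_def by blast
      qed
      moreover have "eventually (\<lambda>w. h w = g w) (at s)"
        using h(2) pos by (subst (asm) eventually_cosparse_open_eq[OF open_halfspace_Re_gt]) auto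
      ultimately have "is_pole h s" using is_pole_cong[of h g s s] by simp
      then show ?thesis using s by (simp add: P_def Zs_def)
    qed simp
  qed
  have finZ: "finite (Zs K)" for K using Zsub[of K] C(2) finP by (meson finite_UnI finite_subset)
  define C' where "C' = C + real (card P)"
  have cardZ: "real (card (Zs K)) \<le> C' * real (Suc K) ^ (m + 3)" for K
  proof -
    have "card (Zs K) \<le> card (irregular_points W R K \<union> P)" by (rule card_mono) (use C finP Zsub in auto)
    also have "\<dots> \<le> card (irregular_points W R K) + card P" by (rule card_Un_le)
    finally have "real (card (Zs K)) \<le> real (card (irregular_points W R K)) + real (card P) * 1" by simp
    also have "\<dots> \<le> C * real (Suc K) ^ (m + 3) + real (card P) * real (Suc K) ^ (m + 3)"
      by (intro add_mono C mult_left_mono one_le_power) auto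
    finally show ?thesis by (simp add: C'_def algebra_simps)
  qed
  define E where "E = ln (real (length L)) + 2 * pi"
  \<comment> \<open>From \<open>p0\<close> on, the distance \<open>E / ln p\<close> to the boundary
    point is at most \<open>r / 2\<close>.\<close>
  define p0 where "p0 = Suc (nat \<lceil>exp (2 * \<bar>E\<bar> / r)\<rceil>)"
  let ?Q = "\<lambda>K. {p. (prime p \<and> G p) \<and> p \<ge> p0 \<and> ln (real p) < \<eta> * real (Suc K)}"
  have Qsub: "?Q K \<subseteq> (\<Union>s\<in>Zs K. prime_zeros L s)" for K
  proof
    fix p assume "p \<in> ?Q K"
    then have p: "prime p" "G p" "p \<ge> p0" "ln (real p) < \<eta> * real (Suc K)" by auto
    have lnp: "ln (real p) > 0" using prime_gt_1_nat[OF p(1)] by simp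
    obtain w where w: "prime_poly L p w = 0" "Re w * ln (real p) \<ge> \<eta>" using G(3) p by blast
    have Rew: "Re w > 0" using w(2) G(2) lnp by (smt (verit) mult_nonpos_nonneg)
    obtain s where s: "prime_poly L p s = 0" "Re s = Re w" "norm (s - z) \<le> E / ln (real p)"
      using prime_poly_zero_near[OF L W p(1) w(1) _ z] Rew unfolding E_def by auto
    have "exp (2 * \<bar>E\<bar> / r) < real p0" unfolding p0_def by linarith
    also have "\<dots> \<le> real p" using p by simp
    finally have "exp (2 * \<bar>E\<bar> / r) < exp (ln (real p))" using prime_gt_0_nat[OF p(1)] by simp
    then have "2 * \<bar>E\<bar> / r < ln (real p)" by (simp only: exp_less_cancel_iff)
    then have "\<bar>E\<bar> / ln (real p) \<le> r / 2" using lnp r by (simp add: field_simps)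
    moreover have "E / ln (real p) \<le> \<bar>E\<bar> / ln (real p)" using lnp by (intro divide_right_mono) auto
    ultimately have "norm (s - z) \<le> r / 2" using s(3) by linarith
    then have "s \<in> cball z (r / 2)" by (simp add: dist_norm norm_minus_commute)
    \<comment> \<open>Compare \<open>ln p < \<eta> * (K + 1)\<close> with
      \<open>\<eta> \<le> Re w * ln p\<close> and cancel \<open>ln p\<close>.\<close>
    have "Re s > 1 / real (Suc K)"
    proof -
      have "ln (real p) < (Re w * ln (real p)) * real (Suc K)"
        using p(4) w(2) by (smt (verit) mult_right_mono of_nat_0_le_iff)
      then have "ln (real p) * 1 < ln (real p) * (Re w * real (Suc K))" by (simp add: mult_ac)
      then have "1 < Re w * real (Suc K)" using lnp by (simp only: mult_less_cancel_left_pos)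
      then show ?thesis unfolding s(2) by (simp add: field_simps)
    qed
    with \<open>s \<in> cball z (r / 2)\<close> have "s \<in> Zs K" using s(1) p(1) by (auto simp: Zs_def)
    then show "p \<in> (\<Union>s\<in>Zs K. prime_zeros L s)" using s(1) p(1) by blast
  qed
  have DZ: "finite (prime_zeros L s)" "real (card (prime_zeros L s)) \<le> D * real (Suc K)"
    if "s \<in> Zs K" for s K
    using D(2)[OF nR, of s K] D(3)[OF nR, of s K] that by (auto simp: Zs_def)
  have finU: "finite (\<Union>s\<in>Zs K. prime_zeros L s)" for K
    by (rule finite_UN_I[OF finZ DZ(1)])
  have finQ: "finite (?Q K)" for K
    by (rule finite_subset[OF Qsub finU])
  have cardQ: "real (card (?Q K)) \<le> (C' * D) * real (Suc K) ^ (m + 4)" for K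
  proof -
    have "card (?Q K) \<le> card (\<Union>s\<in>Zs K. prime_zeros L s)"
      by (rule card_mono[OF finU Qsub])
    also have "\<dots> \<le> (\<Sum>s\<in>Zs K. card (prime_zeros L s))" by (rule card_UN_le[OF finZ])
    finally have "real (card (?Q K)) \<le> real (\<Sum>s\<in>Zs K. card (prime_zeros L s))"
      by (rule of_nat_mono)
    also have "\<dots> = (\<Sum>s\<in>Zs K. real (card (prime_zeros L s)))" by (rule of_nat_sum)
    also have "\<dots> \<le> (\<Sum>s\<in>Zs K. D * real (Suc K))" by (rule sum_mono) (rule DZ(2))
    also have "\<dots> = real (card (Zs K)) * (D * real (Suc K))" by simp
    also have "\<dots> \<le> (C' * real (Suc K) ^ (m + 3)) * (D * real (Suc K))"
      using cardZ D(1) by (intro mult_right_mono) auto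
    also have "\<dots> = (C' * D) * real (Suc K) ^ (m + 4)" by (simp add: power_add eval_nat_numeral)
    finally show ?thesis .
  qed
  have "summable (\<lambda>p. if prime p \<and> G p then 1 / real p else 0)"
    by (rule summable_reciprocals_sparse[OF G(2) _ cardQ finQ]) (simp add: p0_def)
  then show False using G(1) by simp
qed

section \<open>Roots off the unit circle\<close>

definition root_poly :: "complex list \<Rightarrow> complex poly" where
  "root_poly xs = (\<Prod>x\<leftarrow>xs. [:- x, 1:])"

lemma root_poly_simps [simp]: "root_poly [] = 1" "root_poly (x # xs) = [:- x, 1:] * root_poly xs"
  by (simp_all add: root_poly_def)

lemma root_poly_coeffs:
  shows "coeff (root_poly xs) (length xs) = 1" "degree (root_poly xs) = length xs"
    "coeff (root_poly xs) 0 = (\<Prod>x\<leftarrow>xs. - x)"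
proof -
  show deg: "degree (root_poly xs) = length xs" and lc: "coeff (root_poly xs) (length xs) = 1"
  proof (induction xs)
    case (Cons x xs)
    have nz: "root_poly xs \<noteq> 0" using Cons by auto
    { case 1 show ?case using Cons nz by (simp add: degree_mult_eq del: mult_pCons_left) }
    { case 2 show ?case using Cons by (simp add: coeff_pCons coeff_eq_0) }
  qed auto
  show "coeff (root_poly xs) 0 = (\<Prod>x\<leftarrow>xs. - x)" by (induction xs) auto
qed

lemma root_poly_subleading: "xs \<noteq> [] \<Longrightarrow> coeff (root_poly xs) (length xs - 1) = - sum_list xs"
proof (induction xs)
  case (Cons x xs)
  show ?case
  proof (cases "xs = []")
    case False
    then obtain m where m: "length xs = Suc m" by (cases xs) auto
    have "coeff (root_poly xs) (Suc m) = 1" using root_poly_coeffs(1)[of xs] m by simp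
    moreover have "coeff (root_poly xs) m = - sum_list xs" using Cons.IH[OF False] m by simp
    ultimately show ?thesis using m by (simp add: coeff_pCons)
  qed simp
qed simp

lemma root_poly_linear:
  "0 \<notin> set xs \<Longrightarrow> coeff (root_poly xs) 1 = - ((\<Prod>x\<leftarrow>xs. - x) * (\<Sum>x\<leftarrow>xs. inverse x))"
proof (induction xs)
  case (Cons x xs)
  then have "coeff (root_poly xs) 1 = - ((\<Prod>x\<leftarrow>xs. - x) * (\<Sum>x\<leftarrow>xs. inverse x))" "x \<noteq> 0" by auto
  then show ?case using root_poly_coeffs(3)[of xs] by (simp add: field_simps)
qed simp

lemma prod_list_uminus: "(\<Prod>x\<leftarrow>xs. - (x::complex)) = (-1) ^ length xs * prod_list xs"
  by (induction xs) auto

text \<open>The other factors have product at least a power of \<open>\<rho>\<close>, which caps the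
  remaining one. Using the full length as exponent costs nothing since
  \<open>\<rho> \<le> 1\<close>.\<close>

lemma norm_le_of_prod_list_eq_1:
  fixes xs :: "complex list"
  assumes "norm (prod_list xs) = 1" "\<And>x. x \<in> set xs \<Longrightarrow> \<rho> \<le> norm x" "0 < \<rho>" "\<rho> \<le> 1" "x \<in> set xs"
  shows "norm x \<le> inverse (\<rho> ^ length xs)"
proof -
  obtain ys zs where xs: "xs = ys @ x # zs" using split_list[OF assms(5)] by blast
  have ge: "\<rho> ^ length us \<le> norm (prod_list us)" if "set us \<subseteq> set xs" for us
    using that
  proof (induction us)
    case (Cons u us)
    then have "\<rho> * \<rho> ^ length us \<le> norm u * norm (prod_list us)"
      using assms by (intro mult_mono) auto
    then show ?case by (simp add: norm_mult)
  qed simp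
  have "\<rho> ^ length xs \<le> \<rho> ^ length (ys @ zs)" using assms by (intro power_decreasing) (auto simp: xs)
  also have "\<dots> \<le> norm (prod_list (ys @ zs))" by (rule ge) (auto simp: xs)
  finally have 1: "\<rho> ^ length xs \<le> norm (prod_list (ys @ zs))" .
  have "norm x * norm (prod_list (ys @ zs)) = 1" using assms(1) by (simp add: xs norm_mult mult_ac)
  moreover have "norm x * \<rho> ^ length xs \<le> norm x * norm (prod_list (ys @ zs))" by (intro mult_left_mono 1) auto
  ultimately have "norm x * \<rho> ^ length xs \<le> 1" by simp
  then show ?thesis using assms(3) by (simp add: field_simps)
qed

text \<open>\<open>cnj (inverse x)\<close> is the reflection of \<open>x\<close> in the unit circle,
  on the same ray, so the distance is the difference of the moduli \<open>1 / norm x\<close> and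
  \<open>norm x\<close>.\<close>

lemma norm_cnj_inverse_diff:
  fixes x :: complex
  assumes "0 < q" "q \<le> 1" "q \<le> norm x" "norm x \<le> inverse q"
  shows "norm (cnj (inverse x) - x) \<le> inverse q - q"
proof -
  have x: "x \<noteq> 0" using assms by auto
  have "cnj (inverse x) = x / of_real ((norm x)\<^sup>2)"
    using x complex_norm_square[of x] by (simp add: field_simps)
  then have "cnj (inverse x) - x = x * of_real (1 / (norm x)\<^sup>2 - 1)" by (simp add: algebra_simps)
  then have "norm (cnj (inverse x) - x) = norm x * \<bar>1 / (norm x)\<^sup>2 - 1\<bar>" by (simp only: norm_mult norm_of_real)
  also have "\<dots> = \<bar>norm x * (1 / (norm x)\<^sup>2 - 1)\<bar>" by (simp add: abs_mult)
  also have "norm x * (1 / (norm x)\<^sup>2 - 1) = inverse (norm x) - norm x"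
    using x by (simp add: field_simps power2_eq_square)
  finally have "norm (cnj (inverse x) - x) = \<bar>inverse (norm x) - norm x\<bar>" .
  moreover have "inverse (norm x) \<le> inverse q" using assms by (intro le_imp_inverse_le) auto
  moreover have "inverse (inverse q) \<le> inverse (norm x)" using assms x by (intro le_imp_inverse_le) auto
  ultimately show ?thesis using assms by simp
qed

text \<open>
  If the roots of the perturbed polynomial are \<open>x\<^sub>1, \<dots>, x\<^sub>n\<close>, the linear and the subleading coefficients give
  \<open>\<Sum>1/x\<^sub>j = \<Sum>X\<^sub>i\<close> and \<open>Y * \<Sum>x\<^sub>j = (\<Prod>X\<^sub>i) * cnj (\<Sum>X\<^sub>i)\<close>, so that
  \<open>(Y - \<Prod>X\<^sub>i) * cnj (\<Sum>X\<^sub>i) = Y * \<Sum>(cnj (1/x\<^sub>j) - x\<^sub>j)\<close>. The right-hand side vanishes on the unit circle.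
\<close>

lemma polynomial_root_in_disc:
  fixes X :: "complex list" and Y :: complex
  assumes n: "length X = n" "n \<ge> 2" and X: "\<And>x. x \<in> set X \<Longrightarrow> norm x = 1" and Y: "norm Y = 1"
    and \<rho>: "0 < \<rho>" "\<rho> \<le> 1"
    and large: "real n * (inverse (\<rho> ^ n) - \<rho> ^ n) < norm (Y - prod_list X) * norm (sum_list X)"
  shows "\<exists>T. T \<noteq> 0 \<and> norm T < \<rho> \<and> (\<Prod>x\<leftarrow>X. 1 - x * T) + (-1) ^ n * (Y - prod_list X) * T ^ n = 0"
proof -
  define E where "E = prod_list X"
  have X0: "0 \<notin> set X" using X by fastforce
  define R where "R = (\<Prod>x\<leftarrow>X. [:1, - x:])"
  have R: "R = smult ((-1) ^ n * E) (root_poly (map inverse X))"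
  proof -
    have "(\<Prod>x\<leftarrow>X. [:1, - x:]) = smult (\<Prod>x\<leftarrow>X. - x) (root_poly (map inverse X))"
      using X0
    proof (induction X)
      case (Cons a X)
      then have "[:1, - a:] = smult (- a) [:- inverse a, 1:]" by simp
      then show ?case using Cons by (simp add: mult.commute[of a] del: mult_pCons_left smult_pCons)
    qed simp
    then show ?thesis by (simp add: R_def E_def n prod_list_uminus)
  qed
  \<comment> \<open>The perturbation touches only the coefficient of degree \<open>n\<close>. As
    \<open>n \<ge> 2\<close>, those of degree 0, 1 and \<open>n - 1\<close> are inherited from
    \<open>R\<close>; they determine the product, the sum of inverses and the sum of the
    roots.\<close>
  define P where "P = R + monom ((-1) ^ n * (Y - E)) n"
  have evalP: "poly P T = (\<Prod>x\<leftarrow>X. 1 - x * T) + (-1) ^ n * (Y - E) * T ^ n" for T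
  proof -
    have "poly (\<Prod>x\<leftarrow>X. [:1, - x:]) T = (\<Prod>x\<leftarrow>X. 1 - x * T)" by (induction X) (auto simp: algebra_simps)
    then show ?thesis by (simp add: P_def R_def poly_monom)
  qed
  note rc = root_poly_coeffs[of "map inverse X", simplified, unfolded n(1)]
  have Pn: "coeff P n = (-1) ^ n * Y" using rc(1) by (simp add: P_def R algebra_simps)
  have "degree P \<le> n" unfolding P_def R
    by (intro degree_add_le degree_monom_le order_trans[OF degree_smult_le]) (simp add: rc(2))
  moreover have "n \<le> degree P" using Pn Y by (intro le_degree) auto
  ultimately have degP: "degree P = n" by simp
  obtain xs where xs: "proots P = mset xs" using ex_mset[of "proots P"] by metis
  have len: "length xs = n" using size_proots_complex[of P] xs degP by simp
  have roots: "(\<Prod>x\<in>#proots P. [:- x, 1:]) = root_poly xs"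
    unfolding xs root_poly_def mset_map[symmetric] by (rule prod_mset_prod_list)
  have lead: "lead_coeff P = (-1) ^ n * Y" using degP Pn by simp
  have P: "P = smult ((-1) ^ n * Y) (root_poly xs)" by (rule complex_poly_decompose_multiset[of P, unfolded lead roots, symmetric])
  have "coeff P 0 = coeff R 0" using n by (simp add: P_def)
  also have "\<dots> = 1" unfolding R_def by (induction X) auto
  finally have "(-1) ^ n * Y * ((-1) ^ n * prod_list xs) = 1"
    unfolding P by (simp add: root_poly_coeffs(3) prod_list_uminus len)
  then have "((-1) ^ n * (-1) ^ n) * (Y * prod_list xs) = 1" by (simp only: mult_ac)
  then have prod: "Y * prod_list xs = 1" by (simp flip: power_mult_distrib)
  then have np: "norm (prod_list xs) = 1" using Y by (metis mult_1 norm_mult norm_one)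
  have "prod_list xs \<noteq> 0" using prod by auto
  then have xs0: "0 \<notin> set xs" by (simp add: prod_list_zero_iff)
  have sums: "(\<Sum>x\<leftarrow>xs. inverse x) = sum_list X"
  proof -
    have "coeff P 1 = coeff R 1" using n by (simp add: P_def)
    moreover have "coeff P 1 = - (((-1) ^ n * (-1) ^ n) * (Y * prod_list xs) * (\<Sum>x\<leftarrow>xs. inverse x))"
      unfolding P by (simp add: root_poly_linear[OF xs0, unfolded One_nat_def] prod_list_uminus len mult_ac)
    moreover have "coeff R 1 = - sum_list X"
      unfolding R_def by (induction X) (auto simp: coeff_0_prod_list o_def map_replicate_const)
    ultimately show ?thesis using prod by (simp flip: power_mult_distrib)
  qed
  have sub: "Y * sum_list xs = E * cnj (sum_list X)"
  proof -
    have "n \<noteq> n - 1" "xs \<noteq> []" "map inverse X \<noteq> []" using n len by auto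
    then have "coeff P (n - 1) = coeff R (n - 1)" by (simp add: P_def)
    moreover have "coeff P (n - 1) = - ((-1) ^ n * Y * sum_list xs)"
      unfolding P using root_poly_subleading[OF \<open>xs \<noteq> []\<close>] len by simp
    moreover have "coeff R (n - 1) = - ((-1) ^ n * E * sum_list (map inverse X))"
      unfolding R using root_poly_subleading[OF \<open>map inverse X \<noteq> []\<close>] n by simp
    moreover have "sum_list (map inverse X) = cnj (sum_list X)"
      using X
    proof (induction X)
      case (Cons x X)
      have "inverse x = cnj x" using Cons.prems[of x] complex_norm_square[of x] by (intro inverse_unique) auto
      then show ?case using Cons by simp
    qed simp
    ultimately show ?thesis by simp
  qed
  have "(Y - E) * cnj (sum_list X) = Y * (\<Sum>x\<leftarrow>xs. cnj (inverse x) - x)"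
  proof -
    have "cnj (sum_list X) = (\<Sum>x\<leftarrow>xs. cnj (inverse x))" unfolding sums[symmetric] by (induction xs) auto
    then have "(\<Sum>x\<leftarrow>xs. cnj (inverse x) - x) = cnj (sum_list X) - sum_list xs"
      using sum_list_subtractf[of "\<lambda>x. cnj (inverse x)" "\<lambda>x. x" xs] by simp
    then have "Y * (\<Sum>x\<leftarrow>xs. cnj (inverse x) - x) = Y * cnj (sum_list X) - Y * sum_list xs"
      by (simp only: right_diff_distrib)
    then show ?thesis unfolding sub by (simp only: left_diff_distrib)
  qed
  then have "norm (Y - E) * norm (sum_list X) = norm (\<Sum>x\<leftarrow>xs. cnj (inverse x) - x)"
    using Y by (metis complex_mod_cnj mult_1 norm_mult)
  also have "\<dots> \<le> (\<Sum>x\<leftarrow>xs. norm (cnj (inverse x) - x))"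
    by (induction xs) (auto intro: order_trans[OF norm_triangle_ineq])
  finally have le: "norm (Y - E) * norm (sum_list X) \<le> (\<Sum>x\<leftarrow>xs. norm (cnj (inverse x) - x))" .
  have "\<exists>x\<in>set xs. norm x < \<rho>"
  proof (rule ccontr)
    assume "\<not> (\<exists>x\<in>set xs. norm x < \<rho>)"
    then have ge: "\<rho> \<le> norm x" if "x \<in> set xs" for x using that by force
    have "(\<Sum>x\<leftarrow>xs. norm (cnj (inverse x) - x)) \<le> (\<Sum>x\<leftarrow>xs. inverse (\<rho> ^ n) - \<rho> ^ n)"
    proof (rule sum_list_mono, rule norm_cnj_inverse_diff)
      fix x assume x: "x \<in> set xs"
      show "0 < \<rho> ^ n" "\<rho> ^ n \<le> 1" using \<rho> by (auto intro: power_le_one)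
      \<comment> \<open>All roots are placed in the annulus between \<open>\<rho> ^ n\<close> and
        its inverse, which is symmetric under reflection in the unit circle.\<close>
      have "\<rho> ^ n \<le> \<rho> ^ 1" using \<rho> n by (intro power_decreasing) auto
      then show "\<rho> ^ n \<le> norm x" using ge[OF x] by simp
      show "norm x \<le> inverse (\<rho> ^ n)"
        using norm_le_of_prod_list_eq_1[OF np ge \<rho> x] len by simp
    qed
    also have "\<dots> = real n * (inverse (\<rho> ^ n) - \<rho> ^ n)" by (simp add: sum_list_triv len)
    finally show False using le large by (simp add: E_def)
  qed
  then obtain T where T: "T \<in> set xs" "norm T < \<rho>" by blast
  have "poly (root_poly xs) T = 0" using T(1) by (induction xs) auto
  then have "poly P T = 0" by (simp add: P)
  then have "(\<Prod>x\<leftarrow>X. 1 - x * T) + (-1) ^ n * (Y - prod_list X) * T ^ n = 0" unfolding evalP E_def .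
  moreover have "T \<noteq> 0" using T(1) xs0 by auto
  ultimately show ?thesis using T(2) by (intro exI[of _ T]) simp
qed

lemma threshold_radius:
  assumes "\<delta> > 0" "n > 0"
  shows "\<exists>\<rho>. 0 < \<rho> \<and> \<rho> < 1 \<and> real n * (inverse (\<rho> ^ n) - \<rho> ^ n) < \<delta>"
proof -
  \<comment> \<open>With \<open>\<rho> ^ n = 1 / (1 + e)\<close> the difference is at most
    \<open>2 * e\<close>, so \<open>n\<close> copies of it give \<open>\<delta> / 2\<close>.\<close>
  define e where "e = \<delta> / (4 * real n)"
  have e: "e > 0" using assms by (simp add: e_def)
  define \<rho> where "\<rho> = root n (inverse (1 + e))"
  have q: "0 < inverse (1 + e)" "inverse (1 + e) < 1" using e by (auto simp: field_simps)
  have pow: "\<rho> ^ n = inverse (1 + e)" unfolding \<rho>_def using assms(2) q by simp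
  have "1 - e \<le> inverse (1 + e)" using e by (simp add: field_simps)
  then have "inverse (\<rho> ^ n) - \<rho> ^ n \<le> 2 * e" unfolding pow by simp
  then have "real n * (inverse (\<rho> ^ n) - \<rho> ^ n) \<le> real n * (2 * e)" by (intro mult_left_mono) auto
  also have "\<dots> = \<delta> / 2" using assms(2) by (simp add: e_def)
  also have "\<dots> < \<delta>" using assms(1) by simp
  finally have "real n * (inverse (\<rho> ^ n) - \<rho> ^ n) < \<delta>" .
  moreover have "0 < \<rho>" "\<rho> < 1" unfolding \<rho>_def using assms(2) q by auto
  ultimately show ?thesis by blast
qed

section \<open>The local polynomial\<close>

abbreviation combination :: "nat \<Rightarrow> (nat \<Rightarrow> complex) \<Rightarrow> complex \<Rightarrow> (nat \<Rightarrow> nat) \<Rightarrow> nat \<Rightarrow> complex" where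
  "combination n a b m l \<equiv> (\<Sum>i=1..n. of_nat (m i) * a i) + of_nat l * b"

text \<open>Bounding every multiplicity by the degree \<open>k\<close> is stable under adding pairs
  and leaves at most \<open>(k + 1)^(n + 1)\<close> exponents of degree \<open>k\<close>.\<close>

definition exponent_set :: "nat \<Rightarrow> (nat \<Rightarrow> complex) \<Rightarrow> complex \<Rightarrow> (nat \<times> complex) set" where
  "exponent_set n a b = {(k, c). \<exists>m l. (\<forall>i\<in>{1..n}. m i \<le> k) \<and> l \<le> k \<and>
     c = combination n a b m l}"

lemma exponent_setI:
  assumes "\<And>i. i \<in> {1..n} \<Longrightarrow> m i \<le> k" "l \<le> k" "c = combination n a b m l"
  shows "(k, c) \<in> exponent_set n a b"
  unfolding exponent_set_def mem_Collect_eq case_prod_conv using assms by blast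

lemma exponent_setD:
  assumes "y \<in> exponent_set n a b"
  shows "\<exists>m l. (\<forall>i\<in>{1..n}. m i \<le> fst y) \<and> l \<le> fst y \<and> snd y = combination n a b m l"
  using assms unfolding exponent_set_def mem_Collect_eq case_prod_unfold .

lemma add_closed_exponent_set: "add_closed (exponent_set n a b)"
  unfolding add_closed_def
proof (intro ballI)
  fix x y assume x: "x \<in> exponent_set n a b" and y: "y \<in> exponent_set n a b"
  obtain m l where x: "\<forall>i\<in>{1..n}. m i \<le> fst x" "l \<le> fst x" "snd x = combination n a b m l"
    using exponent_setD[OF x] by blast
  obtain m' l' where y: "\<forall>i\<in>{1..n}. m' i \<le> fst y" "l' \<le> fst y" "snd y = combination n a b m' l'"
    using exponent_setD[OF y] by blast
  show "(fst x + fst y, snd x + snd y) \<in> exponent_set n a b"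
  proof (rule exponent_setI)
    show "m i + m' i \<le> fst x + fst y" if "i \<in> {1..n}" for i using x(1) y(1) that by (simp add: add_mono)
    show "l + l' \<le> fst x + fst y" using x(2) y(2) by simp
    show "snd x + snd y = (\<Sum>i=1..n. of_nat (m i + m' i) * a i) + of_nat (l + l') * b"
      unfolding x y by (simp add: algebra_simps sum.distrib)
  qed
qed

lemma imaginary_exponent_set:
  assumes "\<And>i. i \<in> {1..n} \<Longrightarrow> Re (a i) = 0" "Re b = 0"
  shows "imaginary_exponents (exponent_set n a b)"
  unfolding imaginary_exponents_def
proof
  fix y assume "y \<in> exponent_set n a b"
  then obtain m :: "nat \<Rightarrow> nat" and l :: nat where "snd y = combination n a b m l"
    using exponent_setD by blast
  then show "Re (snd y) = 0" using assms by (auto intro!: sum.neutral)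
qed

lemma exponent_set_norm:
  assumes "y \<in> exponent_set n a b"
  shows "norm (snd y) \<le> ((\<Sum>i=1..n. norm (a i)) + norm b) * real (fst y)"
proof -
  obtain m l where y: "\<forall>i\<in>{1..n}. m i \<le> fst y" "l \<le> fst y" "snd y = combination n a b m l"
    using exponent_setD[OF assms] by blast
  have "norm (snd y) \<le> norm (\<Sum>i=1..n. of_nat (m i) * a i) + norm (of_nat l * b)"
    unfolding y(3) by (rule norm_triangle_ineq)
  also have "\<dots> \<le> (\<Sum>i=1..n. norm (of_nat (m i) * a i)) + norm (of_nat l * b)" by (intro add_mono norm_sum) simp
  also have "\<dots> \<le> (\<Sum>i=1..n. real (fst y) * norm (a i)) + real (fst y) * norm b"
    using y by (intro add_mono sum_mono) (auto simp: norm_mult intro!: mult_right_mono)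
  finally show ?thesis by (simp add: sum_distrib_left algebra_simps)
qed

lemma exponent_set_card:
  shows "finite {c. (k, c) \<in> exponent_set n a b}" "card {c. (k, c) \<in> exponent_set n a b} \<le> Suc k ^ (n + 1)"
proof -
  define D where "D = ({1..n} \<rightarrow>\<^sub>E {0..k}) \<times> {0..k}"
  define f where "f = (\<lambda>(m, l). combination n a b m l)"
  have D: "finite D" "card D = Suc k ^ (n + 1)"
    by (auto simp: D_def card_cartesian_product card_PiE intro: finite_PiE)
  have sub: "{c. (k, c) \<in> exponent_set n a b} \<subseteq> f ` D"
  proof
    fix c assume "c \<in> {c. (k, c) \<in> exponent_set n a b}"
    then have "(k, c) \<in> exponent_set n a b" by simp
    then obtain m l where y: "\<forall>i\<in>{1..n}. m i \<le> k" "l \<le> k" "c = combination n a b m l"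
      using exponent_setD[of "(k, c)" n a b] unfolding fst_conv snd_conv by blast
    have "(restrict m {1..n}, l) \<in> D" using y by (auto simp: D_def)
    moreover have "c = f (restrict m {1..n}, l)" unfolding f_def y(3) by (auto intro: sum.cong)
    ultimately show "c \<in> f ` D" by blast
  qed
  show "finite {c. (k, c) \<in> exponent_set n a b}" by (rule finite_subset[OF sub]) (use D in auto)
  have "card {c. (k, c) \<in> exponent_set n a b} \<le> card (f ` D)" by (rule card_mono[OF _ sub]) (use D in auto)
  also have "\<dots> \<le> card D" by (rule card_image_le) (use D in auto)
  finally show "card {c. (k, c) \<in> exponent_set n a b} \<le> Suc k ^ (n + 1)" using D by simp
qed

lemma prod_powr_sum:
  "finite X \<Longrightarrow> p > 0 \<Longrightarrow> (\<Prod>i\<in>X. of_nat p powr f i) = (of_nat p powr (\<Sum>i\<in>X. f i) :: complex)"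
  by (induction X rule: finite_induct) (auto simp: powr_add)

text \<open>Expanding the product over subsets of the indices, the full subset cancels against the
  correction term and \<open>b\<close> takes its place. So the perturbation, too, leaves only
  coefficients 1 and -1.\<close>

lemma local_polynomial_prime_poly:
  assumes "n \<ge> 2"
  shows "\<exists>L. admissible (exponent_set n a b) 1 L \<and> (\<forall>p>0. \<forall>s. local_polynomial n a b p s = prime_poly L p s)"
proof -
  \<comment> \<open>The empty subset is the constant 1 of \<open>prime_poly\<close>; the full one
    cancels.\<close>
  define \<S> where "\<S> = Pow {1..n} - {{}, {1..n}}"
  have "finite \<S>" by (simp add: \<S>_def)
  then obtain xs where xs: "set xs = \<S>" "distinct xs" using finite_distinct_list by blast
  define g where "g = (\<lambda>X. ((-1) ^ card X :: complex, card X, \<Sum>i\<in>X. a i))"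
  define L where "L = map g xs @ [((-1) ^ n, n, b)]"
  have "admissible_term (exponent_set n a b) 1 (g X)" if "X \<in> \<S>" for X
  proof -
    have X: "X \<subseteq> {1..n}" "X \<noteq> {}" using that by (auto simp: \<S>_def)
    then have fin: "finite X" using finite_subset by blast
    then have c: "card X \<ge> 1" using X by (simp add: Suc_leI card_gt_0_iff)
    have "(\<Sum>i=1..n. of_nat (if i \<in> X then 1 else 0) * a i) = (\<Sum>i=1..n. if i \<in> X then a i else 0)"
      by (intro sum.cong) auto
    also have "\<dots> = (\<Sum>i\<in>{1..n} \<inter> X. a i)" by (simp add: sum.inter_restrict)
    also have "{1..n} \<inter> X = X" using X by auto
    finally have "(card X, \<Sum>i\<in>X. a i) \<in> exponent_set n a b"
      by (intro exponent_setI[of n "\<lambda>i. if i \<in> X then 1 else 0" _ 0]) (use c in auto)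
    then show ?thesis using c by (auto simp: admissible_term_def g_def pdegree_def uminus_power_if)
  qed
  moreover have "admissible_term (exponent_set n a b) 1 ((-1) ^ n, n, b)"
  proof -
    have "(n, b) \<in> exponent_set n a b"
      by (rule exponent_setI[of n "\<lambda>i. 0" _ 1]) (use assms in auto)
    then show ?thesis using assms by (auto simp: admissible_term_def pdegree_def uminus_power_if)
  qed
  ultimately have adm: "admissible (exponent_set n a b) 1 L" using xs by (auto simp: L_def)
  have "local_polynomial n a b p s = prime_poly L p s" if p: "p > 0" for p s
  proof -
    define F where "F = (\<lambda>X. (-1) ^ card X * of_nat p powr ((\<Sum>i\<in>X. a i) - of_nat (card X) * s))"
    have F: "(\<Prod>i\<in>X. - (of_nat p powr (a i - s))) = F X" if "finite X" for X
    proof -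
      have "(\<Prod>i\<in>X. - (of_nat p powr (a i - s))) = (-1) ^ card X * (\<Prod>i\<in>X. of_nat p powr (a i - s))"
        by (rule prod_uminus)
      also have "(\<Prod>i\<in>X. of_nat p powr (a i - s)) = of_nat p powr (\<Sum>i\<in>X. a i - s)" by (rule prod_powr_sum[OF that p])
      finally show ?thesis by (simp add: F_def sum_subtractf)
    qed
    have "(\<Prod>i=1..n. 1 - of_nat p powr (a i - s)) = (\<Prod>i=1..n. (- (of_nat p powr (a i - s))) + 1)"
      by (intro prod.cong) auto
    also have "\<dots> = (\<Sum>X\<in>Pow {1..n}. (\<Prod>i\<in>X. - (of_nat p powr (a i - s))) * (\<Prod>i\<in>{1..n} - X. 1))"
      by (rule prod_add) simp
    also have "\<dots> = (\<Sum>X\<in>Pow {1..n}. F X)"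
      by (intro sum.cong refl) (use F finite_subset in auto)
    also have "Pow {1..n} = insert {} (insert {1..n} \<S>)" by (auto simp: \<S>_def)
    also have "(\<Sum>X\<in>insert {} (insert {1..n} \<S>). F X) = F {} + (F {1..n} + (\<Sum>X\<in>\<S>. F X))"
      using assms \<open>finite \<S>\<close> by (subst sum.insert; simp add: \<S>_def)+
    finally have 1: "(\<Prod>i=1..n. 1 - of_nat p powr (a i - s)) = 1 + ((-1) ^ n * of_nat p powr ((\<Sum>i=1..n. a i) - of_nat n * s) + (\<Sum>X\<in>\<S>. F X))"
      using p by (simp add: F_def)
    have 2: "of_nat p powr c * of_nat p powr (- (of_nat n * s)) = of_nat p powr (c - of_nat n * s)" for c
      by (simp add: powr_add[symmetric])
    have "(\<Sum>x\<leftarrow>map g xs. prime_term x p s) = (\<Sum>X\<leftarrow>xs. F X)"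
      by (simp add: o_def g_def prime_term_def pdegree_def F_def)
    also have "\<dots> = (\<Sum>X\<in>\<S>. F X)" using sum.distinct_set_conv_list[OF xs(2), of F] xs(1) by simp
    finally have "prime_poly L p s = 1 + ((\<Sum>X\<in>\<S>. F X) + (-1) ^ n * of_nat p powr (b - of_nat n * s))"
      by (simp add: prime_poly_def L_def prime_term_def pdegree_def)
    moreover have "(-1) ^ n * (of_nat p powr b - of_nat p powr (\<Sum>i=1..n. a i)) * of_nat p powr (- (of_nat n * s)) =
        (-1) ^ n * of_nat p powr (b - of_nat n * s) - (-1) ^ n * of_nat p powr ((\<Sum>i=1..n. a i) - of_nat n * s)"
      by (simp only: mult.assoc left_diff_distrib right_diff_distrib 2)
    ultimately show ?thesis unfolding local_polynomial_def 1 by simp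
  qed
  then show ?thesis using adm by blast
qed

text \<open>For small \<open>u > 0\<close> all phases have modulus at most 1: every cosine is then
  positive and the sine of the nonzero phase \<open>\<beta> * u\<close> does not vanish.\<close>

lemma trig_factor_nonzero:
  fixes \<alpha> :: "nat \<Rightarrow> real"
  assumes "\<beta> \<noteq> 0" "n > 0"
  shows "\<exists>u. (\<Sum>i=1..n. exp (\<i> * of_real (\<alpha> i * u))) * (1 - exp (\<i> * of_real (\<beta> * u))) \<noteq> 0"
proof -
  define S where "S = 1 + (\<Sum>i=1..n. \<bar>\<alpha> i\<bar>) + \<bar>\<beta>\<bar>"
  have sn: "(\<Sum>i=1..n. \<bar>\<alpha> i\<bar>) \<ge> 0" by (rule sum_nonneg) simp
  then have S: "S \<ge> 1" by (simp add: S_def)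
  define u where "u = 1 / S"
  have u: "u > 0" using S by (simp add: u_def)
  have small: "\<bar>t * u\<bar> \<le> 1" if "\<bar>t\<bar> \<le> S" for t using that S by (simp add: u_def abs_mult)
  have cosp: "cos t > 0" if "\<bar>t\<bar> \<le> 1" for t :: real
    by (rule cos_gt_zero_pi) (use that pi_gt3 in linarith)+
  have "Re (\<Sum>i=1..n. exp (\<i> * of_real (\<alpha> i * u))) = (\<Sum>i=1..n. cos (\<alpha> i * u))"
    by (simp add: Re_exp)
  also have "\<dots> > 0"
  proof (rule sum_pos)
    show "cos (\<alpha> i * u) > 0" if "i \<in> {1..n}" for i
    proof (rule cosp, rule small)
      have "\<bar>\<alpha> i\<bar> \<le> (\<Sum>i=1..n. \<bar>\<alpha> i\<bar>)" using that by (intro member_le_sum) auto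
      then show "\<bar>\<alpha> i\<bar> \<le> S" by (simp add: S_def)
    qed
  qed (use assms in auto)
  finally have 1: "(\<Sum>i=1..n. exp (\<i> * of_real (\<alpha> i * u))) \<noteq> 0" by (metis less_irrefl zero_complex.sel(1))
  have "sin \<bar>\<beta> * u\<bar> > 0"
  proof (rule sin_gt_zero)
    show "0 < \<bar>\<beta> * u\<bar>" using assms u by simp
    have "\<bar>\<beta> * u\<bar> \<le> 1" by (rule small) (use sn in \<open>simp add: S_def\<close>)
    then show "\<bar>\<beta> * u\<bar> < pi" using pi_gt3 by linarith
  qed
  then have "sin (\<beta> * u) \<noteq> 0" by (auto simp: abs_if split: if_splits)
  then have "Im (1 - exp (\<i> * of_real (\<beta> * u))) \<noteq> 0" by (simp add: Im_exp)
  then have "1 - exp (\<i> * of_real (\<beta> * u)) \<noteq> 0" by force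
  with 1 show ?thesis by (intro exI[of _ u]) simp
qed

lemma powr_imaginary:
  assumes "p > 0" "Re z = 0"
  shows "of_nat p powr z = exp (\<i> * of_real (Im z * ln (real p)))" "norm (of_nat p powr z) = 1"
proof -
  have "Ln (of_nat p) = of_real (ln (real p))" using Ln_of_real[of "real p"] assms(1) by simp
  moreover have "z = \<i> * of_real (Im z)" using assms(2) by (simp add: complex_eq_iff)
  ultimately show "of_nat p powr z = exp (\<i> * of_real (Im z * ln (real p)))"
    using assms(1) by (simp add: powr_def mult_ac) (metis mult.assoc)
  show "norm (of_nat p powr z) = 1" using assms by (simp add: norm_of_nat_powr)
qed

text \<open>Joins the two ingredients: \<open>E\<close> at \<open>ln p\<close> has the modulus that
  \<open>polynomial_root_in_disc\<close> requires to be large, so primes with large \<open>E\<close>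
  have a root of modulus below a fixed \<open>\<rho> < 1\<close>.\<close>

lemma primes_with_zeros:
  assumes n: "n \<ge> 2" and a: "\<And>i. i \<in> {1..n} \<Longrightarrow> Re (a i) = 0" and b: "Re b = 0" and ne: "(\<Sum>i=1..n. a i) \<noteq> b"
  shows "\<exists>G \<eta>. dense_primes G \<and> \<eta> > 0 \<and>
    (\<forall>p. prime p \<longrightarrow> G p \<longrightarrow> (\<exists>w. local_polynomial n a b p w = 0 \<and> Re w * ln (real p) \<ge> \<eta>))"
proof -
  define A where "A = (\<Sum>i=1..n. a i)"
  have ReA: "Re A = 0" using a by (simp add: A_def)
  define \<beta> where "\<beta> = Im b - Im A"
  have "A \<noteq> b" using ne by (simp add: A_def)
  then have \<beta>: "\<beta> \<noteq> 0" using ReA b by (auto simp: \<beta>_def complex_eq_iff)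
  \<comment> \<open>The product of the two exponential factors is expanded; \<open>True\<close>
    marks the shifted frequency, with coefficient -1.\<close>
  define I where "I = {1..n} \<times> {False, True}"
  define c where "c = (\<lambda>(i::nat, t). if t then - 1 else 1 :: real)"
  define l where "l = (\<lambda>(i, t). Im (a i) + (if t then \<beta> else 0))"
  define E where "E = (\<lambda>u::real. \<Sum>x\<in>I. of_real (c x) * exp (\<i> * of_real (l x * u)))"
  have E: "E u = (\<Sum>i=1..n. exp (\<i> * of_real (Im (a i) * u))) * (1 - exp (\<i> * of_real (\<beta> * u)))" for u
  proof -
    have "E u = (\<Sum>i=1..n. \<Sum>t\<in>{False, True}. of_real (c (i, t)) * exp (\<i> * of_real (l (i, t) * u)))"
      unfolding E_def I_def by (simp only: sum.cartesian_product split_def prod.collapse)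
    also have "\<dots> = (\<Sum>i=1..n. exp (\<i> * of_real (Im (a i) * u)) * (1 - exp (\<i> * of_real (\<beta> * u))))"
    proof (rule sum.cong[OF refl])
      fix i
      have "exp (\<i> * of_real ((Im (a i) + \<beta>) * u)) = exp (\<i> * of_real (Im (a i) * u)) * exp (\<i> * of_real (\<beta> * u))"
        by (simp add: exp_add[symmetric] algebra_simps)
      then show "(\<Sum>t\<in>{False, True}. of_real (c (i, t)) * exp (\<i> * of_real (l (i, t) * u))) =
          exp (\<i> * of_real (Im (a i) * u)) * (1 - exp (\<i> * of_real (\<beta> * u)))"
        by (simp add: c_def l_def right_diff_distrib)
    qed
    finally show ?thesis by (simp only: sum_distrib_right)
  qed
  have "finite I" by (simp add: I_def)
  obtain u0 where "E u0 \<noteq> 0" using trig_factor_nonzero[OF \<beta>, of n "\<lambda>i. Im (a i)"] n unfolding E by auto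
  then obtain \<delta> where \<delta>: "\<delta> > 0" "\<not> summable (\<lambda>p. if prime p \<and> norm (E (ln p)) \<ge> \<delta> then 1 / real p else 0)"
    using primes_trig_sum_large[OF \<open>finite I\<close>, of c l u0] unfolding E_def by blast
  obtain \<rho> where \<rho>: "0 < \<rho>" "\<rho> < 1" "real n * (inverse (\<rho> ^ n) - \<rho> ^ n) < \<delta>"
    using threshold_radius[OF \<delta>(1), of n] n by auto
  have zero: "\<exists>w. local_polynomial n a b p w = 0 \<and> Re w * ln (real p) \<ge> - ln \<rho>"
    if p: "prime p" "norm (E (ln p)) \<ge> \<delta>" for p
  proof -
    have p0: "p > 0" "p > 1" using prime_gt_0_nat[OF p(1)] prime_gt_1_nat[OF p(1)] by auto
    have lnp: "ln (real p) > 0" using p0 by simp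
    define X where "X = map (\<lambda>i. of_nat p powr a i :: complex) [1..<Suc n]"
    define Y where "Y = (of_nat p powr b :: complex)"
    have set: "set [1..<Suc n] = {1..n}" by auto
    have lenX: "length X = n" by (simp add: X_def)
    have nX: "norm x = 1" if x: "x \<in> set X" for x
    proof -
      obtain i where "i \<in> {1..n}" "x = of_nat p powr a i" using x unfolding X_def set_map set by blast
      then show ?thesis using powr_imaginary(2)[OF p0(1) a] by simp
    qed
    have nY: "norm Y = 1" unfolding Y_def by (rule powr_imaginary(2)[OF p0(1) b])
    have sumX: "sum_list X = (\<Sum>i=1..n. of_nat p powr a i)"
      unfolding X_def set[symmetric] by (simp add: sum.distinct_set_conv_list del: set_upt upt_Suc)
    have prodX: "prod_list X = of_nat p powr A"
    proof -
      have "prod_list X = (\<Prod>i=1..n. of_nat p powr a i)"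
        unfolding X_def set[symmetric] by (simp add: prod.distinct_set_conv_list del: set_upt upt_Suc)
      then show ?thesis unfolding A_def using prod_powr_sum[of "{1..n}" p a] p0 by simp
    qed
    have "(\<Sum>i=1..n. exp (\<i> * of_real (Im (a i) * ln (real p)))) = sum_list X"
      unfolding sumX by (intro sum.cong refl powr_imaginary(1)[symmetric] a p0)
    moreover have "exp (\<i> * of_real (\<beta> * ln (real p))) = of_nat p powr (b - A)"
      using powr_imaginary(1)[OF p0(1), of "b - A"] b ReA by (simp add: \<beta>_def)
    ultimately have "E (ln p) = sum_list X * (1 - of_nat p powr (b - A))" unfolding E by simp
    also have "of_nat p powr (b - A) = Y / prod_list X" using p0 by (simp add: Y_def prodX powr_diff)
    finally have "norm (E (ln p)) = norm (sum_list X) * norm (1 - Y / prod_list X)" by (simp only: norm_mult)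
    \<comment> \<open>Dividing by the unimodular product of \<open>X\<close> does not change the
      modulus.\<close>
    also have "norm (1 - Y / prod_list X) = norm (Y - prod_list X)"
    proof -
      have "norm (prod_list X) = 1" unfolding prodX by (rule powr_imaginary(2)[OF p0(1) ReA])
      moreover from this have "prod_list X \<noteq> 0" by auto
      then have "1 - Y / prod_list X = (prod_list X - Y) / prod_list X" by (simp add: field_simps)
      ultimately show ?thesis by (simp add: norm_divide norm_minus_commute)
    qed
    finally have "\<delta> \<le> norm (Y - prod_list X) * norm (sum_list X)" using p(2) by (simp add: mult.commute)
    then have "real n * (inverse (\<rho> ^ n) - \<rho> ^ n) < norm (Y - prod_list X) * norm (sum_list X)" using \<rho>(3) by linarith
    from polynomial_root_in_disc[OF lenX n nX nY \<rho>(1) less_imp_le[OF \<rho>(2)] this]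
    obtain T where T: "T \<noteq> 0" "norm T < \<rho>" "(\<Prod>x\<leftarrow>X. 1 - x * T) + (-1) ^ n * (Y - prod_list X) * T ^ n = 0" by blast
    \<comment> \<open>Any logarithm would do: \<open>p powr (- w) = T\<close> is all that matters,
      and \<open>Re w * ln p = - ln (norm T)\<close> is independent of the branch.\<close>
    define w where "w = - Ln T / of_real (ln (real p))"
    have Lnp: "Ln (of_nat p) = of_real (ln (real p))" using Ln_of_real[of "real p"] p0 by simp
    have pw: "of_nat p powr (- w) = T"
      using p0 lnp T(1) by (simp add: powr_def w_def Lnp)
    have pnw: "of_nat p powr (- (of_nat n * w)) = T ^ n"
    proof -
      have "of_nat p powr (- (of_nat n * w)) = exp (of_nat n * (- w * Ln (of_nat p)))"
        using p0 by (simp add: powr_def mult_ac)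
      also have "\<dots> = exp (- w * Ln (of_nat p)) ^ n" by (rule exp_of_nat_mult)
      also have "exp (- w * Ln (of_nat p)) = of_nat p powr (- w)" using p0 by (simp add: powr_def)
      finally show ?thesis by (simp add: pw)
    qed
    have paw: "of_nat p powr (c - w) = of_nat p powr c * T" for c
      using powr_add[of "of_nat p" c "- w"] pw by simp
    have "(\<Prod>i=1..n. 1 - of_nat p powr (a i - w)) = (\<Prod>x\<leftarrow>X. 1 - x * T)"
      unfolding X_def set[symmetric] paw by (simp add: prod.distinct_set_conv_list o_def del: set_upt upt_Suc)
    then have "local_polynomial n a b p w = (\<Prod>x\<leftarrow>X. 1 - x * T) + (-1) ^ n * (Y - prod_list X) * T ^ n"
      unfolding local_polynomial_def pnw A_def[symmetric] by (simp add: Y_def prodX)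
    moreover have "Re w * ln (real p) = - ln (norm T)" using lnp T(1) by (simp add: w_def)
    moreover have "ln (norm T) \<le> ln \<rho>" using T(1,2) by (intro ln_mono) auto
    ultimately show ?thesis using T(3) by (intro exI[of _ w]) simp
  qed
  show ?thesis
  proof (rule exI[of _ "\<lambda>p::nat. norm (E (ln (real p))) \<ge> \<delta>"], rule exI[of _ "- ln \<rho>"], intro conjI allI impI)
    show "0 < - ln \<rho>" using \<rho> by simp
  qed (use \<delta> zero in auto)
qed

section \<open>Assembly of the theorem\<close>

lemma abs_convergent_prod_inverse:
  fixes f :: "nat \<Rightarrow> complex"
  assumes "abs_convergent_prod f"
  shows "abs_convergent_prod (\<lambda>p. inverse (f p))"
proof (rule summable_imp_abs_convergent_prod)
  have sm: "summable (\<lambda>p. norm (f p - 1))" using assms by (rule abs_convergent_prod_imp_summable)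
  \<comment> \<open>The comparison is only eventual, because finitely many \<open>f p\<close> may
    vanish and are then inverted to 0.\<close>
  then have "eventually (\<lambda>p. norm (f p - 1) < 1/2) sequentially"
    using order_tendstoD(2)[OF summable_LIMSEQ_zero[OF sm], of "1/2"] by simp
  then have "eventually (\<lambda>p. norm (norm (inverse (f p) - 1)) \<le> 2 * norm (f p - 1)) sequentially"
  proof eventually_elim
    case (elim p)
    have half: "norm (f p) \<ge> 1/2" using elim norm_triangle_ineq2[of 1 "1 - f p"] by (simp add: norm_minus_commute)
    then have "f p \<noteq> 0" by auto
    then have "inverse (f p) - 1 = (1 - f p) / f p" by (simp add: field_simps)
    then have "norm (inverse (f p) - 1) = norm (f p - 1) / norm (f p)" by (simp add: norm_divide norm_minus_commute)
    also have "\<dots> \<le> norm (f p - 1) / (1/2)" using half \<open>f p \<noteq> 0\<close> by (intro divide_left_mono) auto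
    finally show ?case by simp
  qed
  then show "summable (\<lambda>p. norm (inverse (f p) - 1))"
    by (rule summable_comparison_test_ev) (intro summable_mult sm)
qed

lemma eventually_cosparse_eqI:
  fixes f g :: "complex \<Rightarrow> complex"
  assumes "open A" "\<And>s. s \<in> A \<Longrightarrow> f s = g s"
  shows "\<forall>\<^sub>\<approx>s\<in>A. f s = g s"
proof -
  have "\<forall>\<^sub>\<approx>s\<in>A. s \<in> A" using assms(1) by (simp add: eventually_in_cosparse)
  then show ?thesis by eventually_elim (rule assms(2))
qed

lemma Z_eq_zeta_product:
  assumes "(\<Sum>i=1..n. a i) = b" "\<And>i. i \<in> {1..n} \<Longrightarrow> Re (a i) = 0" "Re s > 1"
  shows "Z n a b s = (\<Prod>i=1..n. riemann_zeta (s - a i))"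
proof -
  have "(\<lambda>p. \<Prod>i=1..n. inverse (zeta_factor (s - a i) p)) has_prod (\<Prod>i=1..n. riemann_zeta (s - a i))"
  proof (rule has_prod_prod)
    fix i assume "i \<in> {1..n}"
    then have re: "Re (s - a i) > 1" using assms by simp
    show "(\<lambda>p. inverse (zeta_factor (s - a i) p)) has_prod riemann_zeta (s - a i)"
      using has_prod_inverse[OF Euler_product(1)[OF re]] by (simp add: riemann_zeta_eq_dirichlet[OF re])
  qed
  also have "(\<lambda>p. \<Prod>i=1..n. inverse (zeta_factor (s - a i) p)) = euler_factor n a b s"
  proof
    fix p
    show "(\<Prod>i=1..n. inverse (zeta_factor (s - a i) p)) = euler_factor n a b s p"
      using prod_inversef[of "\<lambda>i. 1 - of_nat p powr (a i - s)" "{1..n}"]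
      by (simp add: euler_factor_def local_polynomial_def zeta_factor_def assms(1)[symmetric] o_def)
  qed
  finally show ?thesis unfolding Z_def by (rule has_prod_unique[symmetric])
qed

theorem theoremC:
  fixes n :: nat and a :: "nat \<Rightarrow> complex" and b :: complex
  assumes "n \<ge> 2"
    and "\<And>i. i \<in> {1..n} \<Longrightarrow> Re (a i) = 0"
    and "Re b = 0"
  shows "(\<forall>s. Re s > 1 \<longrightarrow> abs_convergent_prod (euler_factor n a b s)) \<and>
    ((\<exists>g. meromorphic_continuation (Z n a b) {s. Re s > 1} g UNIV) \<longleftrightarrow> (\<Sum>i=1..n. a i) = b) \<and>
    ((\<Sum>i=1..n. a i) = b \<longrightarrow>
      (\<forall>s. Re s > 1 \<longrightarrow> Z n a b s = (\<Prod>i=1..n. riemann_zeta (s - a i))) \<and>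
      meromorphic_continuation (Z n a b) {s. Re s > 1}
        (\<lambda>s. \<Prod>i=1..n. riemann_zeta (s - a i)) UNIV) \<and>
    ((\<Sum>i=1..n. a i) \<noteq> b \<longrightarrow>
      natural_boundary_imaginary_axis (Z n a b) {s. Re s > 1})"
proof -
  let ?W = "exponent_set n a b"
  have W: "imaginary_exponents ?W" by (rule imaginary_exponent_set[OF assms(2,3)])
  obtain L where L_ex: "admissible ?W 1 L \<and> (\<forall>p>0. \<forall>s. local_polynomial n a b p s = prime_poly L p s)"
    using local_polynomial_prime_poly[OF assms(1)] by (rule exE)
  have L: "admissible ?W 1 L" "\<And>p s. p > 0 \<Longrightarrow> local_polynomial n a b p s = prime_poly L p s"
    using L_ex by auto
  have ef: "euler_factor n a b s = (\<lambda>p. inverse (euler_term L s p))" for s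
    using L(2) prime_gt_0_nat by (auto simp: euler_factor_def fun_eq_iff)
  have conv: "abs_convergent_prod (euler_factor n a b s)" if "Re s > 1" for s
    unfolding ef by (intro abs_convergent_prod_inverse convergent_prime_poly(1)[OF L(1) W]) (use that in simp)
  \<comment> \<open>This holds also where a local polynomial vanishes: both sides are then
    0.\<close>
  have Z: "Z n a b s = inverse (euler_prod L s)" if "Re s > 1" for s
    unfolding Z_def ef euler_prod_def
    by (intro prodinf_inverse convergent_prime_poly(2)[OF L(1) W]) (use that in simp)
  have cont: "meromorphic_continuation (Z n a b) {s. Re s > 1} (\<lambda>s. \<Prod>i=1..n. riemann_zeta (s - a i)) UNIV"
    if "(\<Sum>i=1..n. a i) = b"
    unfolding meromorphic_continuation_def
  proof (intro conjI)
    show "(\<lambda>s. \<Prod>i=1..n. riemann_zeta (s - a i)) meromorphic_on UNIV"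
      using zeta_compose_affine(1)[of 1] by (intro meromorphic_intros) simp
    show "\<forall>\<^sub>\<approx>s\<in>{s. Re s > 1}. (\<Prod>i=1..n. riemann_zeta (s - a i)) = Z n a b s"
      by (rule eventually_cosparse_eqI[OF open_halfspace_Re_gt]) (use Z_eq_zeta_product[OF that assms(2)] in auto)
  qed simp
  have boundary: "natural_boundary_imaginary_axis (Z n a b) {s. Re s > 1}" if ne: "(\<Sum>i=1..n. a i) \<noteq> b"
  proof -
    obtain g where g: "g meromorphic_on {s. Re s > 0}"
      "\<forall>\<^sub>\<approx>s\<in>{s. Re s > 1}. g s = inverse (euler_prod L s)"
      and pole: "poles_at_prime_zeros ?W L g"
      by (rule euler_prod_continuation[OF add_closed_exponent_set W L(1)])
    obtain G \<eta> where G: "dense_primes G" "\<eta> > 0"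
      "\<And>p. prime p \<Longrightarrow> G p \<Longrightarrow> \<exists>w. prime_poly L p w = 0 \<and> Re w * ln (real p) \<ge> \<eta>"
    proof -
      have "\<exists>G \<eta>. dense_primes G \<and> \<eta> > 0 \<and>
        (\<forall>p. prime p \<longrightarrow> G p \<longrightarrow> (\<exists>w. local_polynomial n a b p w = 0 \<and> Re w * ln (real p) \<ge> \<eta>))"
        by (rule primes_with_zeros[OF assms ne])
      then obtain G \<eta> where G: "dense_primes G" "\<eta> > 0"
        "\<forall>p. prime p \<longrightarrow> G p \<longrightarrow> (\<exists>w. local_polynomial n a b p w = 0 \<and> Re w * ln (real p) \<ge> \<eta>)"
        by (elim exE conjE) (rule that)
      show thesis by (rule that[OF G(1,2)]) (use G(3) L(2) prime_gt_0_nat in force)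
    qed
    have "\<forall>\<^sub>\<approx>s\<in>{s. Re s > 1}. s \<in> {s. Re s > 1}"
      by (rule eventually_in_cosparse) (auto simp: open_halfspace_Re_gt)
    with g(2) have "\<forall>\<^sub>\<approx>s\<in>{s. Re s > 1}. g s = Z n a b s"
      by eventually_elim (simp add: Z)
    then have "meromorphic_continuation (Z n a b) {s. Re s > 1} g {s. Re s > 0}"
      unfolding meromorphic_continuation_def using g(1) by auto
    moreover have False
      if "Re z = 0" "r > 0" "meromorphic_continuation g {s. Re s > 0} h ({s. Re s > 0} \<union> ball z r)" for z r h
    proof (rule no_continuation_across[OF W L(1) exponent_set_card exponent_set_norm _ pole G that(1,2)])
      show "0 \<le> (\<Sum>i=1..n. norm (a i)) + norm b" by (intro add_nonneg_nonneg sum_nonneg) auto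
    qed (use that in \<open>auto simp: meromorphic_continuation_def\<close>)
    ultimately show ?thesis unfolding natural_boundary_imaginary_axis_def by blast
  qed
  have no_UNIV: "\<not> (\<exists>g. meromorphic_continuation (Z n a b) {s. Re s > 1} g UNIV)" if ne: "(\<Sum>i=1..n. a i) \<noteq> b"
  proof
    assume "\<exists>g. meromorphic_continuation (Z n a b) {s. Re s > 1} g UNIV"
    then obtain h where h: "h meromorphic_on UNIV" "\<forall>\<^sub>\<approx>s\<in>{s. Re s > 1}. h s = Z n a b s"
      unfolding meromorphic_continuation_def by blast
    obtain g where g: "g meromorphic_on {s. Re s > 0}" "\<forall>\<^sub>\<approx>s\<in>{s. Re s > 1}. g s = Z n a b s"
      and no: "\<And>z r h. Re z = 0 \<Longrightarrow> r > 0 \<Longrightarrow> \<not> meromorphic_continuation g {s. Re s > 0} h ({s. Re s > 0} \<union> ball z r)"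
      using boundary[OF ne] unfolding natural_boundary_imaginary_axis_def meromorphic_continuation_def[of "Z n a b"] by blast
    have "\<forall>\<^sub>\<approx>s\<in>{s. Re s > 1}. h s = g s" using h(2) g(2) by eventually_elim simp
    then have "eventually (\<lambda>s. h s = g s) (at 2)"
      by (subst (asm) eventually_cosparse_open_eq[OF open_halfspace_Re_gt]) auto
    then have "\<forall>\<^sub>\<approx>s\<in>{s. Re s > 0}. h s = g s"
      by (intro meromorphic_eq_cosparse[OF _ g(1) open_halfspace_Re_gt connected_halfplane_Re, of _ 2]
          meromorphic_on_subset[OF h(1)]) auto
    \<comment> \<open>By the identity theorem, started at 2, a global continuation agrees with
      \<open>g\<close> on the right half-plane, so it would cross the axis at 0.\<close>
    then have "meromorphic_continuation g {s. Re s > 0} h ({s. Re s > 0} \<union> ball 0 1)"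
      unfolding meromorphic_continuation_def using meromorphic_on_subset[OF h(1)] by auto
    then show False using no[of 0 1 h] by simp
  qed
  show ?thesis
  proof (intro conjI impI allI)
    show "(\<exists>g. meromorphic_continuation (Z n a b) {s. Re s > 1} g UNIV) \<longleftrightarrow> (\<Sum>i=1..n. a i) = b"
      using cont no_UNIV by metis
    show "Z n a b s = (\<Prod>i=1..n. riemann_zeta (s - a i))" if "(\<Sum>i=1..n. a i) = b" "Re s > 1" for s
      by (rule Z_eq_zeta_product[OF that(1) assms(2) that(2)])
  qed (fact conv cont boundary)+
qed

end
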